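(* Let $\mathcal P_q(\beta,R,m)$ be the class of distributions defined in the context. There is $c>0$, depending only on $\beta$, $R$ and the constants of Assumptions (A1)--(A6), such that for every $q\in\mathcal Q$ with $q\le q^\sharp:=c_K^{(2\beta+2)/(2\beta+1)}(nm^2)^{1/(2\beta+1)}$, $$\inf_{\widetilde C_n}\ \sup_{P\in\mathcal P_q(\beta,R,m)}\mathbb E_P\bigl\|\widetilde C_n-C\bigr\|_{L^2(E\times E)}^2\ \ge\ c\Bigl[(nm^2q)^{-(2\beta+1)/(2\beta+2)}+\frac1n\Bigr],$$ where the infimum is over all estimators $\widetilde C_n$ of $C$ based on the observations of $n$ subjects.
   Context: Model. $E=\mathbb S^1=\mathbb R/\mathbb Z$ with Lebesgue measure. One observes $(T_{ij},Y_{ij})$ with $Y_{ij}=X_i(T_{ij})+\varepsilon_{ij}$, $1\le i\le n$, $1\le j\le N_i$, where the $X_i$ are i.i.d. copies of a centred Gaussian element $X$ of $L^2(E)$ with covariance $C(s,t)=\operatorname{Cov}(X(s),X(t))$, the times $T_{ij}$ are i.i.d. with density $f$ on $E$, the errors $\varepsilon_{ij}$ are i.i.d. centred with variance $\sigma^2$, and the three families are independent. $G_q=\mathbb Z/q\mathbb Z$ acts on $E$ by $t\mapsto t+\ell/q$; $C$ is $G_q$-invariant if $C(s+1/q,t+1/q)=C(s,t)$. $\mathcal Q$ is a finite family $1=q_0<q_1<\dots<q_J$ with $q_j\mid q_{j+1}$. Assumptions. (A1) $C$ is Hölder of order $\beta\in(0,2]$ on $E\times E$ with $\|C\|_{C^\beta}\le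 R$. (A2) $0<a\le f\le b$. (A3) The counts form a triangular array, i.i.d. in $i$, with $\mathbb E N=m_n$, $\mathbb E[N(N-1)]\asymp m_n^2$, $\mathbb E[N^4]\lesssim m_n^4$ uniformly in $n$. (A4) There is $K_0>0$ with $\|X(t)\|_{L^p}\le K_0\sqrt p$ for all $t\in E$, $p\ge1$, and $\|\varepsilon\|_{L^p}\le K_0\sqrt p$. (A5) The design is $G_q$-invariant ($f(\cdot+1/q)=f$) for every $q\in\mathcal Q$. (A6) $K$ is a symmetric Lipschitz kernel supported in $[-1,1]$ with $\int K=1$ (with bandwidths $h<1/4$). Class. For $\beta>0$, $R>0$, $m\ge2$, $q\in\mathcal Q$, $\mathcal P_q(\beta,R,m)$ is the set of joint distributions of $(X,\{T_{ij}\},\{\varepsilon_{ij}\})$ such that (A1)--(A6) hold with $\|C\|_{C^\beta}\le R$ and sampling intensity $\mathbb E N_i\asymp m$, the process $X$ is Gaussian, and $C$ is $G_q$-invariant. Notation. $c_K=(\int K^2)^2/\int(K\star K)^2$. $\asymp$ denotes two-sided bounds with constants not depending on $n,m,q$. *)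

theory Defs
  imports "HOL-Probability.Probability"
begin

text \<open>
  Points of the circle \<open>E = \<real>/\<int>\<close> are represented by \<open>{0..<1}\<close>, and functions on \<open>E\<close> (or on \<open>E \<times> E\<close>)
  by functions on the line (plane) that are 1-periodic in each variable.
\<close>

definition circle :: "real measure" where
  "circle = restrict_space lborel {0..<1}"

definition periodic1 :: "(real \<Rightarrow> 'a) \<Rightarrow> bool" where
  "periodic1 g \<longleftrightarrow> (\<forall>t. g (t + 1) = g t)"

text \<open>
  Hoelder norms. For a periodic function the difference quotient over all pairs of points of the plane has the
  same supremum as the quotient taken with the distance of the torus. As usual in nonparametric
  statistics, order \<open>\<beta> = k + \<alpha>\<close> is read with \<open>k\<close> the largest integer strictly below \<open>\<beta>\<close>: order 1 is
  Lipschitz, order 2 is Lipschitz gradient.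
\<close>

definition sup_norm :: "('a \<Rightarrow> 'b::real_normed_vector) \<Rightarrow> ennreal" where
  "sup_norm g = (SUP x. ennreal (norm (g x)))"

definition hoelder_seminorm ::
    "real \<Rightarrow> ('a::metric_space \<Rightarrow> 'b::real_normed_vector) \<Rightarrow> ennreal" where
  "hoelder_seminorm \<alpha> g = (SUP x. SUP y\<in>-{x}. ennreal (norm (g x - g y) / dist x y powr \<alpha>))"

definition gradient :: "(real \<times> real \<Rightarrow> real) \<Rightarrow> real \<times> real \<Rightarrow> real \<times> real" where
  "gradient g z = (frechet_derivative g (at z) (1, 0), frechet_derivative g (at z) (0, 1))"

definition hoelder_norm :: "real \<Rightarrow> (real \<times> real \<Rightarrow> real) \<Rightarrow> ennreal" where
  "hoelder_norm \<beta> g =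
     (if \<beta> \<le> 1 then sup_norm g + hoelder_seminorm \<beta> g
      else if \<forall>z. g differentiable (at z)
        then sup_norm g + sup_norm (gradient g) + hoelder_seminorm (\<beta> - 1) (gradient g)
      else \<infinity>)"

text \<open>Centred normal law, with the degenerate law of variance 0 included.\<close>

definition centred_normal :: "'w measure \<Rightarrow> ('w \<Rightarrow> real) \<Rightarrow> bool" where
  "centred_normal M U \<longleftrightarrow>
     U \<in> borel_measurable M \<and>
     ((\<exists>\<sigma>>0. distributed M lborel U (normal_density 0 \<sigma>)) \<or> (AE w in M. U w = 0))"

text \<open>\<open>\<parallel>U\<parallel>\<^bsub>L\<^sup>p\<^esub> \<le> K0 \<surd>p\<close> for all real \<open>p \<ge> 1\<close>.\<close>

definition subgaussian :: "real \<Rightarrow> 'w measure \<Rightarrow> ('w \<Rightarrow> real) \<Rightarrow> bool" where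
  "subgaussian K0 M U \<longleftrightarrow>
     U \<in> borel_measurable M \<and>
     (\<forall>p\<ge>1. integrable M (\<lambda>w. \<bar>U w\<bar> powr p) \<and>
        (\<integral>w. \<bar>U w\<bar> powr p \<partial>M) powr (1 / p) \<le> K0 * sqrt p)"

text \<open>
  A joint distribution of the model. As the curves are i.i.d., the times are i.i.d., the errors are
  i.i.d., the counts are i.i.d., and these families are independent, it is given by four marginals:
  a curve (a measurable process on a probability space), the density of the times, the law of the
  errors and the law of the counts. No law of a curve is lost by the choice of \<open>nat \<Rightarrow> real\<close> as
  sample space: a centred Gaussian element of \<open>L\<^sup>2(E)\<close> is a measurable function of a sequence of
  independent standard normal variables (Karhunen-Loeve). The sample space of the curve is a factor
  of the sample space of the data, so that the value of the curve at an independent random time is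
  unambiguous although the curve is only assumed to be jointly measurable.
\<close>

record fda_model =
  curve_space :: "(nat \<Rightarrow> real) measure"
  curve :: "(nat \<Rightarrow> real) \<Rightarrow> real \<Rightarrow> real"
  design_density :: "real \<Rightarrow> real"
  noise :: "real measure"
  counts :: "nat pmf"

definition cov_fun :: "fda_model \<Rightarrow> real \<Rightarrow> real \<Rightarrow> real" where
  "cov_fun P s t =
     (let Q = curve_space P; X = curve P
      in \<integral>w. (X w s - (\<integral>v. X v s \<partial>Q)) * (X w t - (\<integral>v. X v t \<partial>Q)) \<partial>Q)"

definition gaussian_curve :: "fda_model \<Rightarrow> bool" where
  "gaussian_curve P \<longleftrightarrow>
     (let Q = curve_space P; X = curve P in
        prob_space Q \<and>
        case_prod X \<in> borel_measurable (Q \<Otimes>\<^sub>M borel) \<and>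
        (\<forall>w\<in>space Q. periodic1 (X w)) \<and>
        (AE w in Q. integrable circle (\<lambda>t. (X w t)\<^sup>2)) \<and>
        (\<forall>g\<in>borel_measurable circle. integrable circle (\<lambda>t. (g t)\<^sup>2) \<longrightarrow>
            centred_normal Q (\<lambda>w. \<integral>t. X w t * g t \<partial>circle)) \<and>
        (\<forall>S a. finite S \<longrightarrow> centred_normal Q (\<lambda>w. \<Sum>t\<in>S. a t * X w t)))"

text \<open>The constants in the bounds on the design density, on the moments of the curve and the
  errors, and on the moments of the counts.\<close>

record model_bounds =
  dens_lo :: real
  dens_hi :: real
  subg :: real
  mean_lo :: real
  mean_hi :: real
  pair_lo :: real
  pair_hi :: real
  fourth_hi :: real

definition bounds_positive :: "model_bounds \<Rightarrow> bool" where
  "bounds_positive B \<longleftrightarrow>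
     0 < dens_lo B \<and> 0 < dens_hi B \<and> 0 < subg B \<and> 0 < mean_lo B \<and> 0 < mean_hi B \<and>
     0 < pair_lo B \<and> 0 < pair_hi B \<and> 0 < fourth_hi B"

definition admissible_design :: "model_bounds \<Rightarrow> nat set \<Rightarrow> (real \<Rightarrow> real) \<Rightarrow> bool" where
  "admissible_design B \<Q> f \<longleftrightarrow>
     f \<in> borel_measurable borel \<and> periodic1 f \<and> (\<integral>t. f t \<partial>circle) = 1 \<and>
     (\<forall>t. dens_lo B \<le> f t \<and> f t \<le> dens_hi B) \<and>
     (\<forall>q\<in>\<Q>. \<forall>t. f (t + 1 / real q) = f t)"

definition admissible_noise :: "model_bounds \<Rightarrow> real measure \<Rightarrow> bool" where
  "admissible_noise B \<nu> \<longleftrightarrow>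
     prob_space \<nu> \<and> sets \<nu> = sets borel \<and> (\<integral>x. x \<partial>\<nu>) = 0 \<and> subgaussian (subg B) \<nu> (\<lambda>x. x)"

definition admissible_counts :: "model_bounds \<Rightarrow> real \<Rightarrow> nat pmf \<Rightarrow> bool" where
  "admissible_counts B m p \<longleftrightarrow>
     (let \<mu> = measure_pmf.expectation p real in
        integrable (measure_pmf p) (\<lambda>k. real k ^ 4) \<and>
        mean_lo B * m \<le> \<mu> \<and> \<mu> \<le> mean_hi B * m \<and>
        pair_lo B * \<mu>\<^sup>2 \<le> measure_pmf.expectation p (\<lambda>k. real k * (real k - 1)) \<and>
        measure_pmf.expectation p (\<lambda>k. real k * (real k - 1)) \<le> pair_hi B * \<mu>\<^sup>2 \<and>
        measure_pmf.expectation p (\<lambda>k. real k ^ 4) \<le> fourth_hi B * \<mu> ^ 4)"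

definition divisor_chain :: "nat set \<Rightarrow> bool" where
  "divisor_chain \<Q> \<longleftrightarrow>
     (\<exists>J r. r 0 = 1 \<and> (\<forall>j<J. r j < r (Suc j) \<and> r j dvd r (Suc j)) \<and> \<Q> = r ` {..J})"

definition shift_invariant :: "nat \<Rightarrow> (real \<Rightarrow> real \<Rightarrow> real) \<Rightarrow> bool" where
  "shift_invariant q C \<longleftrightarrow> (\<forall>s t. C (s + 1 / real q) (t + 1 / real q) = C s t)"

definition model_class ::
    "model_bounds \<Rightarrow> nat set \<Rightarrow> real \<Rightarrow> real \<Rightarrow> real \<Rightarrow> nat \<Rightarrow> fda_model set" where
  "model_class B \<Q> \<beta> R m q =
     {P. gaussian_curve P \<and>
         hoelder_norm \<beta> (case_prod (cov_fun P)) \<le> ennreal R \<and>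
         shift_invariant q (cov_fun P) \<and>
         (\<forall>t. subgaussian (subg B) (curve_space P) (\<lambda>w. curve P w t)) \<and>
         admissible_design B \<Q> (design_density P) \<and>
         admissible_noise B (noise P) \<and>
         admissible_counts B m (counts P)}"

text \<open>
  The observation of a subject is its count \<open>k\<close> and the pairs (time, value) for \<open>j < k\<close>, padded by
  zeros for \<open>j \<ge> k\<close>.
\<close>

type_synonym observation = "nat \<times> (nat \<Rightarrow> real \<times> real)"

definition subject_space ::
    "fda_model \<Rightarrow> ((nat \<Rightarrow> real) \<times> nat \<times> (nat \<Rightarrow> real) \<times> (nat \<Rightarrow> real)) measure" where
  "subject_space P =
     curve_space P \<Otimes>\<^sub>M measure_pmf (counts P) \<Otimes>\<^sub>M
     (\<Pi>\<^sub>M j\<in>UNIV. density circle (\<lambda>t. ennreal (design_density P t))) \<Otimes>\<^sub>M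
     (\<Pi>\<^sub>M j\<in>UNIV. noise P)"

fun observe ::
    "fda_model \<Rightarrow> (nat \<Rightarrow> real) \<times> nat \<times> (nat \<Rightarrow> real) \<times> (nat \<Rightarrow> real) \<Rightarrow> observation" where
  "observe P (w, k, T, e) = (k, \<lambda>j. if j < k then (T j, curve P w (T j) + e j) else (0, 0))"

definition data_space :: "nat \<Rightarrow> (nat \<Rightarrow> observation) measure" where
  "data_space n =
     (\<Pi>\<^sub>M i\<in>{..<n}. count_space UNIV \<Otimes>\<^sub>M (\<Pi>\<^sub>M j\<in>UNIV. borel \<Otimes>\<^sub>M borel))"

definition data_law :: "nat \<Rightarrow> fda_model \<Rightarrow> (nat \<Rightarrow> observation) measure" where
  "data_law n P =
     distr (\<Pi>\<^sub>M i\<in>{..<n}. subject_space P) (data_space n) (\<lambda>\<omega>. \<lambda>i\<in>{..<n}. observe P (\<omega> i))"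

text \<open>
  Estimators are jointly measurable in the data and the two arguments. Values outside \<open>L\<^sup>2(E \<times> E)\<close>
  are not excluded; their loss is \<open>\<infinity>\<close>.
\<close>

definition estimators :: "nat \<Rightarrow> ((nat \<Rightarrow> observation) \<Rightarrow> real \<Rightarrow> real \<Rightarrow> real) set" where
  "estimators n =
     {Ce. (\<lambda>(d, s, t). Ce d s t) \<in> borel_measurable (data_space n \<Otimes>\<^sub>M circle \<Otimes>\<^sub>M circle)}"

definition risk ::
    "nat \<Rightarrow> fda_model \<Rightarrow> ((nat \<Rightarrow> observation) \<Rightarrow> real \<Rightarrow> real \<Rightarrow> real) \<Rightarrow> ennreal" where
  "risk n P Ce =
     (\<integral>\<^sup>+ d. (\<integral>\<^sup>+ (s, t). ennreal ((Ce d s t - cov_fun P s t)\<^sup>2) \<partial>(circle \<Otimes>\<^sub>M circle)) \<partial>data_law n P)"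

definition smoothing_kernel :: "(real \<Rightarrow> real) \<Rightarrow> bool" where
  "smoothing_kernel K \<longleftrightarrow>
     (\<forall>x. K (- x) = K x) \<and> (\<exists>L. L-lipschitz_on UNIV K) \<and>
     (\<forall>x. 1 < \<bar>x\<bar> \<longrightarrow> K x = 0) \<and> (\<integral>x. K x \<partial>lborel) = 1"

definition kernel_const :: "(real \<Rightarrow> real) \<Rightarrow> real" where
  "kernel_const K =
     (\<integral>x. (K x)\<^sup>2 \<partial>lborel)\<^sup>2 / (\<integral>x. (\<integral>y. K y * K (x - y) \<partial>lborel)\<^sup>2 \<partial>lborel)"

definition q_sharp :: "(real \<Rightarrow> real) \<Rightarrow> real \<Rightarrow> nat \<Rightarrow> real \<Rightarrow> real" where
  "q_sharp K \<beta> n m =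
     kernel_const K powr ((2 * \<beta> + 2) / (2 * \<beta> + 1)) * (real n * m\<^sup>2) powr (1 / (2 * \<beta> + 1))"

end

theory Submission
  imports Defs
begin

text \<open>
  Both terms of the bound come from curves \<open>X = \<Sum>\<^sub>c \<xi>\<^sub>c \<psi>\<^sub>c\<close> with independent standard normal \<open>\<xi>\<^sub>c\<close>
  and disjointly supported \<open>\<psi>\<^sub>c\<close>, observed with normal errors; design and counts are those of any
  member of the class. The likelihood ratio of the observations against pure noise is then explicit.

  For the first term the circle is cut into \<open>q M\<close> cells of length \<open>h = 1 / (q M)\<close>, and \<open>\<psi>\<^sub>c\<close> is
  \<open>1/q\<close>-periodic: on every cell congruent to \<open>c\<close> it is a bump of height of order \<open>h\<^bsup>\<beta>/2\<^esup>\<close> on the left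
  half and \<open>\<plusminus>\<close> the same bump on the right half. The sign \<open>\<theta>\<^sub>c\<close> changes the covariance
  only off the diagonal, so single observations carry no information on it; given the times, the
  affinity of two models that differ in one sign is exactly \<open>\<surd>((1 + u + v) / ((1 + u) (1 + v)))\<close>, where
  \<open>u\<close> and \<open>v\<close> sum the squared bumps over the times in the left and the right halves. It is at
  least \<open>1 - u v\<close>, and the expectation of \<open>u v\<close> involves pairs of observations only. Assouad's argument
  over the \<open>M\<close> signs, with \<open>M\<^bsup>2\<beta>+2\<^esup>\<close> of order \<open>n m\<^sup>2 q\<^bsup>-2\<beta>\<^esup>\<close>, gives a bound that is at least the
  claimed rate; \<open>q \<le> q\<^sup>\<sharp>\<close> ensures that this number of cells is bounded away from 0. The term
  \<open>1/n\<close> comes from two constant curves whose variances differ by a factor \<open>1 + 1/\<surd>n\<close>.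
\<close>

section \<open>Gaussian product measures\<close>

text \<open>The bumps enter the covariance as products of two, so \<psi> of height h^(\<beta>/2)
  gives a covariance that oscillates by h^\<beta> at scale h, as Hoelder order \<beta> permits. The
  sign has to sit on one half of each cell: \<psi> and -\<psi> have the same covariance, and a
  change on the diagonal would already be visible in single observations. The affinity multiplies
  over subjects, and its bound 1 - u v holds for u and v of any size, so the unbounded counts enter
  only through E[N(N-1)]. A class of congruent cells consists of q cells of length 1/(q M) and has
  mass 1/M whatever q is. With squared height A of order (q M)^(-\<beta>), the expectation of u v is
  of order m^2 (A/M)^2. Keeping n times this bounded fixes M, and the M local losses of order
  (A/M)^2 add up to A^2/M. Up to constants this exceeds (n m^2 q)^(-(2\<beta>+1)/(2\<beta>+2)) by
  the factor q^(1/(2\<beta>+2)). In the 1/n term a subject, however often observed, reveals at best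
  one normal draw, so the affinity bound is uniform in the count.\<close>

lemma PiM_density:
  assumes fin: "finite I"
    and p: "\<And>i. prob_space (M i)" "\<And>i. prob_space (density (M i) (f i))"
    and [measurable]: "\<And>i. f i \<in> borel_measurable (M i)"
  shows "PiM I (\<lambda>i. density (M i) (f i)) = density (PiM I M) (\<lambda>x. \<Prod>i\<in>I. f i (x i))"
proof -
  interpret A: product_prob_space M by (rule product_prob_spaceI) (rule p)
  interpret B: product_prob_space "\<lambda>i. density (M i) (f i)" by (rule product_prob_spaceI) (rule p)
  have "density (PiM I M) (\<lambda>x. \<Prod>i\<in>I. f i (x i)) = PiM I (\<lambda>i. density (M i) (f i))"
  proof (rule B.PiM_eqI[OF fin])
    show "sets (density (PiM I M) (\<lambda>x. \<Prod>i\<in>I. f i (x i))) = sets (PiM I (\<lambda>i. density (M i) (f i)))"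
      by (simp cong: sets_PiM_cong)
    fix A assume A: "\<And>i. i \<in> I \<Longrightarrow> A i \<in> sets (density (M i) (f i))"
    then have [measurable]: "\<And>i. i \<in> I \<Longrightarrow> A i \<in> sets (M i)" by simp
    have [measurable]: "Pi\<^sub>E I A \<in> sets (PiM I M)" using fin by (auto intro!: sets_PiM_I_finite)
    have "emeasure (density (PiM I M) (\<lambda>x. \<Prod>i\<in>I. f i (x i))) (Pi\<^sub>E I A)
        = (\<integral>\<^sup>+x. (\<Prod>i\<in>I. f i (x i)) * indicator (Pi\<^sub>E I A) x \<partial>PiM I M)"
      by (simp add: emeasure_density)
    also have "\<dots> = (\<integral>\<^sup>+x. (\<Prod>i\<in>I. f i (x i) * indicator (A i) (x i)) \<partial>PiM I M)"
    proof (rule nn_integral_cong)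
      fix x assume x: "x \<in> space (PiM I M)"
      then have ext: "x \<in> extensional I" by (auto simp: space_PiM PiE_def)
      show "(\<Prod>i\<in>I. f i (x i)) * indicator (Pi\<^sub>E I A) x = (\<Prod>i\<in>I. f i (x i) * indicator (A i) (x i))"
      proof (cases "x \<in> Pi\<^sub>E I A")
        case True
        then have "x i \<in> A i" if "i \<in> I" for i using that by (auto simp: PiE_def Pi_def)
        with True show ?thesis by (auto intro!: prod.cong)
      next
        case False
        then obtain i where "i \<in> I" "x i \<notin> A i" using ext by (auto simp: PiE_def)
        then have "(\<Prod>i\<in>I. f i (x i) * indicator (A i) (x i)) = 0"
          using fin by (intro prod_zero bexI[of _ i]) auto
        then show ?thesis using False by simp
      qed
    qed
    also have "\<dots> = (\<Prod>i\<in>I. \<integral>\<^sup>+x. f i x * indicator (A i) x \<partial>M i)"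
      using fin by (intro A.product_nn_integral_prod) auto
    also have "\<dots> = (\<Prod>i\<in>I. emeasure (density (M i) (f i)) (A i))"
      by (intro prod.cong refl) (simp add: emeasure_density)
    finally show "emeasure (density (PiM I M) (\<lambda>x. \<Prod>i\<in>I. f i (x i))) (Pi\<^sub>E I A)
      = (\<Prod>i\<in>I. emeasure (density (M i) (f i)) (A i))" .
  qed
  then show ?thesis by simp
qed

lemma distr_PiM_componentwise:
  assumes fin: "finite I"
    and p: "\<And>i. prob_space (M i)"
    and [measurable]: "\<And>i. f i \<in> measurable (M i) (N i)"
  shows "distr (PiM I M) (PiM I N) (\<lambda>x. \<lambda>i\<in>I. f i (x i)) = PiM I (\<lambda>i. distr (M i) (N i) (f i))"
proof -
  interpret A: product_prob_space M by (rule product_prob_spaceI) (rule p)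
  interpret B: product_prob_space "\<lambda>i. distr (M i) (N i) (f i)"
    by (rule product_prob_spaceI) (intro prob_space.prob_space_distr p, simp)
  show ?thesis
  proof (rule B.PiM_eqI[OF fin])
    show "sets (distr (PiM I M) (PiM I N) (\<lambda>x. \<lambda>i\<in>I. f i (x i))) = sets (PiM I (\<lambda>i. distr (M i) (N i) (f i)))"
      by (simp cong: sets_PiM_cong)
    fix A assume "\<And>i. i \<in> I \<Longrightarrow> A i \<in> sets (distr (M i) (N i) (f i))"
    then have A[measurable]: "\<And>i. i \<in> I \<Longrightarrow> A i \<in> sets (N i)" by simp
    have [measurable]: "Pi\<^sub>E I A \<in> sets (PiM I N)" using fin by (auto intro!: sets_PiM_I_finite)
    have eq: "(\<lambda>x. \<lambda>i\<in>I. f i (x i)) -` Pi\<^sub>E I A \<inter> space (PiM I M) = Pi\<^sub>E I (\<lambda>i. f i -` A i \<inter> space (M i))"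
      by (auto simp: space_PiM PiE_def Pi_def)
    show "emeasure (distr (PiM I M) (PiM I N) (\<lambda>x. \<lambda>i\<in>I. f i (x i))) (Pi\<^sub>E I A)
      = (\<Prod>i\<in>I. emeasure (distr (M i) (N i) (f i)) (A i))"
      apply (subst emeasure_distr)
        apply measurable
        apply (use fin A in auto)[2]
      apply (subst eq)
      apply (subst A.emeasure_PiM[OF fin])
       apply (auto intro!: prod.cong simp: emeasure_distr)
      done
  qed
qed

section \<open>Gaussian exponential integrals and translations of the errors\<close>

definition gauss :: "real \<Rightarrow> real measure" where
  "gauss \<sigma> = density lborel (\<lambda>x. ennreal (normal_density 0 \<sigma> x))"

abbreviation noise_seq :: "real \<Rightarrow> (nat \<Rightarrow> real) measure" where
  "noise_seq \<sigma> \<equiv> PiM UNIV (\<lambda>_. gauss \<sigma>)"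

abbreviation gauss_vec :: "nat \<Rightarrow> (nat \<Rightarrow> real) measure" where
  "gauss_vec M \<equiv> PiM {..<M} (\<lambda>_. gauss 1)"

lemma sets_gauss [simp, measurable_cong]: "sets (gauss \<sigma>) = sets borel"
  by (simp add: gauss_def)

lemma space_gauss [simp]: "space (gauss \<sigma>) = UNIV"
  by (simp add: gauss_def)

lemma prob_space_gauss: "0 < \<sigma> \<Longrightarrow> prob_space (gauss \<sigma>)"
  unfolding gauss_def by (rule prob_space_normal_density)

text \<open>The integral of exp(b x - n x^2 / 2) over a standard normal x. With x the random
  amplitude of one bump, it is that bump's factor in the likelihood ratio against pure
  noise.\<close>

definition gauss_lik :: "real \<Rightarrow> real \<Rightarrow> real" where
  "gauss_lik n b = exp (b\<^sup>2 / (2 * (1 + n))) / sqrt (1 + n)"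

lemma nn_integral_normal_density: "0 < \<sigma> \<Longrightarrow> (\<integral>\<^sup>+x. ennreal (normal_density \<mu> \<sigma> x) \<partial>lborel) = 1"
  using prob_space.emeasure_space_1[OF prob_space_normal_density[of \<sigma> \<mu>]]
  by (simp add: emeasure_density)

text \<open>Completing the square turns the integrand into a multiple of a normal density with mean
  \<open>\<mu>\<close> and deviation \<open>\<tau>\<close>. Negative n down to -1 is allowed because
  exponentials of positive squares are integrated later.\<close>

lemma nn_integral_gauss_exp:
  assumes s: "0 < \<sigma>" and n: "-1 < n"
  shows "(\<integral>\<^sup>+x. ennreal (exp (b * (x / \<sigma>) - n * (x / \<sigma>)\<^sup>2 / 2)) \<partial>gauss \<sigma>) = ennreal (gauss_lik n b)"
proof -
  define \<mu> where "\<mu> = b * \<sigma> / (1 + n)"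
  define \<tau> where "\<tau> = \<sigma> / sqrt (1 + n)"
  have t: "0 < \<tau>" "\<tau>\<^sup>2 = \<sigma>\<^sup>2 / (1 + n)" using s n by (auto simp: \<tau>_def power_divide)
  have p: "0 < 1 + n" using n by simp
  have eq: "normal_density 0 \<sigma> x * exp (b * (x / \<sigma>) - n * (x / \<sigma>)\<^sup>2 / 2) = gauss_lik n b * normal_density \<mu> \<tau> x" for x
  proof -
    have "- (x - 0)\<^sup>2 / (2 * \<sigma>\<^sup>2) + (b * (x / \<sigma>) - n * (x / \<sigma>)\<^sup>2 / 2) = b\<^sup>2 / (2 * (1 + n)) + - (x - \<mu>)\<^sup>2 / (2 * \<tau>\<^sup>2)"
    proof -
      define z where "z = x / \<sigma>"
      define c where "c = b / (1 + n)"
      have x: "x = \<sigma> * z" and b: "b = c * (1 + n)" using s p by (auto simp: z_def c_def)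
      have m: "\<mu> = \<sigma> * c" using p by (simp add: \<mu>_def c_def)
      have "(x - \<mu>)\<^sup>2 = \<sigma>\<^sup>2 * (z - c)\<^sup>2" unfolding m x by (simp add: power_mult_distrib flip: right_diff_distrib)
      then have "- (x - \<mu>)\<^sup>2 / (2 * \<tau>\<^sup>2) = - (1 + n) * (z - c)\<^sup>2 / 2"
        unfolding t using s p by (simp add: divide_simps) (simp add: algebra_simps)
      moreover have "b\<^sup>2 / (2 * (1 + n)) = c\<^sup>2 * (1 + n) / 2"
        unfolding b using p by (simp add: power_mult_distrib power2_eq_square divide_simps)
      moreover have "- (x - 0)\<^sup>2 / (2 * \<sigma>\<^sup>2) = - z\<^sup>2 / 2"
        unfolding x using s by (simp add: field_simps power2_eq_square)
      moreover have "- z\<^sup>2 / 2 + (b * z - n * z\<^sup>2 / 2) = c\<^sup>2 * (1 + n) / 2 + - (1 + n) * (z - c)\<^sup>2 / 2"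
        unfolding b by (simp add: field_simps power2_eq_square)
      ultimately show ?thesis unfolding z_def by linarith
    qed
    then have "exp (- (x - 0)\<^sup>2 / (2 * \<sigma>\<^sup>2)) * exp (b * (x / \<sigma>) - n * (x / \<sigma>)\<^sup>2 / 2)
        = exp (b\<^sup>2 / (2 * (1 + n))) * exp (- (x - \<mu>)\<^sup>2 / (2 * \<tau>\<^sup>2))"
      by (metis exp_add)
    moreover have "1 / sqrt (2 * pi * \<sigma>\<^sup>2) = 1 / sqrt (1 + n) * (1 / sqrt (2 * pi * \<tau>\<^sup>2))"
      unfolding t using s p by (simp add: real_sqrt_mult real_sqrt_divide)
    ultimately show ?thesis
      unfolding normal_density_def gauss_lik_def by (simp add: field_simps)
  qed
  have g0: "0 \<le> gauss_lik n b" using p by (simp add: gauss_lik_def)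
  have "(\<integral>\<^sup>+x. ennreal (exp (b * (x / \<sigma>) - n * (x / \<sigma>)\<^sup>2 / 2)) \<partial>gauss \<sigma>)
     = (\<integral>\<^sup>+x. ennreal (gauss_lik n b) * ennreal (normal_density \<mu> \<tau> x) \<partial>lborel)"
    unfolding gauss_def
    apply (subst nn_integral_density)
    apply (simp_all add: ennreal_mult[symmetric] eq[simplified] g0)
    done
  also have "\<dots> = ennreal (gauss_lik n b)"
    by (subst nn_integral_cmult) (simp_all add: nn_integral_normal_density t)
  finally show ?thesis .
qed

text \<open>The one-dimensional Cameron-Martin formula, from translation invariance of Lebesgue
  measure.\<close>

lemma gauss_translate:
  assumes s: "0 < \<sigma>"
  shows "distr (gauss \<sigma>) borel (\<lambda>x. d + x) = density (gauss \<sigma>) (\<lambda>x. ennreal (exp (d / \<sigma> * (x / \<sigma>) - (d / \<sigma>)\<^sup>2 / 2)))"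
proof -
  have "distr (gauss \<sigma>) borel (\<lambda>x. d + x) = density lborel (\<lambda>x. ennreal (normal_density 0 \<sigma> (x - d)))"
  proof (rule measure_eqI)
    fix A assume "A \<in> sets (distr (gauss \<sigma>) borel (\<lambda>x. d + x))"
    then have [measurable]: "A \<in> sets borel" by simp
    have "emeasure (distr (gauss \<sigma>) borel (\<lambda>x. d + x)) A = (\<integral>\<^sup>+x. indicator A (d + x) \<partial>gauss \<sigma>)"
      by (subst nn_integral_indicator[symmetric]) (simp_all add: nn_integral_distr del: nn_integral_indicator)
    also have "\<dots> = (\<integral>\<^sup>+x. ennreal (normal_density 0 \<sigma> x) * indicator A (d + x) \<partial>lborel)"
      unfolding gauss_def by (subst nn_integral_density) auto
    also have "\<dots> = (\<integral>\<^sup>+x. ennreal (normal_density 0 \<sigma> (x - d)) * indicator A x \<partial>lborel)"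
      using nn_integral_real_affine[of "\<lambda>x. ennreal (normal_density 0 \<sigma> (x - d)) * indicator A x" 1 d]
      by simp
    also have "\<dots> = emeasure (density lborel (\<lambda>x. ennreal (normal_density 0 \<sigma> (x - d)))) A"
      by (simp add: emeasure_density)
    finally show "emeasure (distr (gauss \<sigma>) borel (\<lambda>x. d + x)) A = \<dots>" .
  qed simp
  also have "\<dots> = density lborel (\<lambda>x. ennreal (normal_density 0 \<sigma> x) * ennreal (exp (d / \<sigma> * (x / \<sigma>) - (d / \<sigma>)\<^sup>2 / 2)))"
  proof (rule density_cong)
    have "normal_density 0 \<sigma> (x - d) = normal_density 0 \<sigma> x * exp (d / \<sigma> * (x / \<sigma>) - (d / \<sigma>)\<^sup>2 / 2)" for x
      unfolding normal_density_def using s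
      by (simp add: exp_add[symmetric] field_simps power2_eq_square exp_minus exp_diff)
    then show "AE x in lborel. ennreal (normal_density 0 \<sigma> (x - d)) =
        ennreal (normal_density 0 \<sigma> x) * ennreal (exp (d / \<sigma> * (x / \<sigma>) - (d / \<sigma>)\<^sup>2 / 2))"
      by (simp add: ennreal_mult)
  qed auto
  also have "\<dots> = density (gauss \<sigma>) (\<lambda>x. ennreal (exp (d / \<sigma> * (x / \<sigma>) - (d / \<sigma>)\<^sup>2 / 2)))"
    unfolding gauss_def by (subst density_density_eq) auto
  finally show ?thesis .
qed

text \<open>Times and errors are infinite sequences because the count is random; given the count
  only finitely many coordinates matter, and this passes to the finite product.\<close>

lemma nn_integral_PiM_restrict:
  assumes "\<And>i. prob_space (M i)" and "finite J" "J \<subseteq> I"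
    and [measurable]: "F \<in> borel_measurable (PiM J M)"
  shows "(\<integral>\<^sup>+x. F (restrict x J) \<partial>PiM I M) = (\<integral>\<^sup>+x. F x \<partial>PiM J M)"
proof -
  interpret product_prob_space M by (rule product_prob_spaceI) (rule assms)
  have [measurable]: "(\<lambda>x. restrict x J) \<in> measurable (PiM I M) (PiM J M)"
    using assms by (intro measurable_restrict_subset)
  show ?thesis
    by (subst distr_PiM_restrict_finite[OF assms(2,3), symmetric]) (simp add: nn_integral_distr)
qed

lemma nn_integral_PiM_prod:
  assumes p: "\<And>i. prob_space (M i)" and J: "finite J" "J \<subseteq> I"
    and [measurable]: "\<And>i. i \<in> J \<Longrightarrow> f i \<in> borel_measurable (M i)"
  shows "(\<integral>\<^sup>+x. (\<Prod>i\<in>J. f i (x i)) \<partial>PiM I M) = (\<Prod>i\<in>J. \<integral>\<^sup>+x. f i x \<partial>M i)"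
proof -
  interpret product_prob_space M by (rule product_prob_spaceI) (rule p)
  have "(\<integral>\<^sup>+x. (\<Prod>i\<in>J. f i (x i)) \<partial>PiM I M) = (\<integral>\<^sup>+x. (\<Prod>i\<in>J. f i (restrict x J i)) \<partial>PiM I M)"
    by (intro nn_integral_cong prod.cong) auto
  also have "\<dots> = (\<integral>\<^sup>+x. (\<Prod>i\<in>J. f i (x i)) \<partial>PiM J M)"
    by (rule nn_integral_PiM_restrict[OF p J, where F="\<lambda>x. \<Prod>i\<in>J. f i (x i)"]) measurable
  also have "\<dots> = (\<Prod>i\<in>J. \<integral>\<^sup>+x. f i x \<partial>M i)"
    using J by (intro product_nn_integral_prod) auto
  finally show ?thesis .
qed

lemma prod_ennreal_exp: "(\<Prod>i\<in>I. ennreal (exp (f i))) = ennreal (exp (\<Sum>i\<in>I. f i))"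
  by (cases "finite I") (simp_all add: prod_ennreal exp_sum)

text \<open>The Cameron-Martin formula for the first \<open>k\<close> errors. The restriction to
  finitely many coordinates is essential, since a translation of the whole sequence need not be
  absolutely continuous.\<close>

lemma nn_integral_gauss_seq_translate:
  fixes k :: nat
  assumes s: "0 < \<sigma>" and H: "H \<in> borel_measurable (PiM {..<k} (\<lambda>_. borel))"
  shows "(\<integral>\<^sup>+e. H (\<lambda>j\<in>{..<k}. d j + e j) \<partial>noise_seq \<sigma>) =
    (\<integral>\<^sup>+e. H (restrict e {..<k}) * ennreal (exp (\<Sum>j<k. d j / \<sigma> * (e j / \<sigma>) - (d j / \<sigma>)\<^sup>2 / 2)) \<partial>noise_seq \<sigma>)"
proof -
  note [measurable] = H
  have setsG: "sets (PiM {..<k} (\<lambda>_. gauss \<sigma>)) = sets (PiM {..<k} (\<lambda>_. borel))"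
    by (intro sets_PiM_cong) auto
  note [measurable_cong] = setsG
  note p = prob_space_gauss[OF s]
  let ?r = "\<lambda>j x. ennreal (exp (d j / \<sigma> * (x / \<sigma>) - (d j / \<sigma>)\<^sup>2 / 2))"
  have pd: "prob_space (density (gauss \<sigma>) (?r j))" for j
    unfolding gauss_translate[OF s, symmetric] by (rule prob_space.prob_space_distr[OF p]) simp
  have "(\<integral>\<^sup>+e. H (\<lambda>j\<in>{..<k}. d j + e j) \<partial>noise_seq \<sigma>) =
      (\<integral>\<^sup>+e. H (\<lambda>j\<in>{..<k}. d j + restrict e {..<k} j) \<partial>noise_seq \<sigma>)"
    by (intro nn_integral_cong arg_cong[where f=H]) auto
  also have "\<dots> = (\<integral>\<^sup>+e. H (\<lambda>j\<in>{..<k}. d j + e j) \<partial>PiM {..<k} (\<lambda>_. gauss \<sigma>))"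
    by (rule nn_integral_PiM_restrict[where F="\<lambda>e. H (\<lambda>j\<in>{..<k}. d j + e j)"]) (use p in auto)
  also have "\<dots> = (\<integral>\<^sup>+e. H e \<partial>distr (PiM {..<k} (\<lambda>_. gauss \<sigma>)) (PiM {..<k} (\<lambda>_. borel)) (\<lambda>e. \<lambda>j\<in>{..<k}. d j + e j))"
    by (subst nn_integral_distr) auto
  also have "distr (PiM {..<k} (\<lambda>_. gauss \<sigma>)) (PiM {..<k} (\<lambda>_. borel)) (\<lambda>e. \<lambda>j\<in>{..<k}. d j + e j)
      = PiM {..<k} (\<lambda>j. density (gauss \<sigma>) (?r j))"
    unfolding gauss_translate[OF s, symmetric]
    by (rule distr_PiM_componentwise) (use p in auto)
  also have "\<dots> = density (PiM {..<k} (\<lambda>_. gauss \<sigma>)) (\<lambda>x. \<Prod>j<k. ?r j (x j))"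
    by (rule PiM_density) (use p pd in auto)
  also have "(\<integral>\<^sup>+e. H e \<partial>density (PiM {..<k} (\<lambda>_. gauss \<sigma>)) (\<lambda>x. \<Prod>j<k. ?r j (x j)))
     = (\<integral>\<^sup>+e. (\<Prod>j<k. ?r j (e j)) * H e \<partial>PiM {..<k} (\<lambda>_. gauss \<sigma>))"
    by (subst nn_integral_density) auto
  also have "\<dots> = (\<integral>\<^sup>+e. (\<Prod>j<k. ?r j (restrict e {..<k} j)) * H (restrict e {..<k}) \<partial>noise_seq \<sigma>)"
    by (rule nn_integral_PiM_restrict[where F="\<lambda>e. (\<Prod>j<k. ?r j (e j)) * H e", symmetric]) (use p in auto)
  also have "\<dots> = (\<integral>\<^sup>+e. H (restrict e {..<k}) * ennreal (exp (\<Sum>j<k. d j / \<sigma> * (e j / \<sigma>) - (d j / \<sigma>)\<^sup>2 / 2)) \<partial>noise_seq \<sigma>)"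
    by (intro nn_integral_cong) (simp add: prod_ennreal_exp mult.commute cong: prod.cong)
  finally show ?thesis .
qed

lemma nn_integral_gauss_seq_exp:
  fixes k :: nat
  assumes s: "0 < \<sigma>"
  shows "(\<integral>\<^sup>+e. ennreal (exp (\<Sum>j<k. t j * (e j / \<sigma>))) \<partial>noise_seq \<sigma>) = ennreal (exp (\<Sum>j<k. (t j)\<^sup>2 / 2))"
proof -
  have "(\<integral>\<^sup>+e. ennreal (exp (\<Sum>j<k. t j * (e j / \<sigma>))) \<partial>noise_seq \<sigma>)
     = (\<integral>\<^sup>+e. (\<Prod>j<k. ennreal (exp (t j * (e j / \<sigma>)))) \<partial>noise_seq \<sigma>)"
    by (simp add: prod_ennreal_exp)
  also have "\<dots> = (\<Prod>j<k. \<integral>\<^sup>+x. ennreal (exp (t j * (x / \<sigma>))) \<partial>gauss \<sigma>)"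
    by (rule nn_integral_PiM_prod) (use prob_space_gauss[OF s] in auto)
  also have "\<dots> = (\<Prod>j<k. ennreal (exp ((t j)\<^sup>2 / 2)))"
    using nn_integral_gauss_exp[OF s, of 0] by (simp add: gauss_lik_def)
  finally show ?thesis by (simp add: prod_ennreal_exp)
qed

lemma sum_disjoint_square:
  fixes r :: "'a \<Rightarrow> real"
  assumes "\<And>c c'. c \<in> I \<Longrightarrow> c' \<in> I \<Longrightarrow> c \<noteq> c' \<Longrightarrow> r c * r c' = 0"
  shows "(\<Sum>c\<in>I. r c)\<^sup>2 = (\<Sum>c\<in>I. (r c)\<^sup>2)"
proof (cases "finite I")
  case True
  have "(\<Sum>c\<in>I. r c)\<^sup>2 = (\<Sum>c\<in>I. \<Sum>c'\<in>I. r c * r c')"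
    by (simp add: power2_eq_square sum_product)
  also have "\<dots> = (\<Sum>c\<in>I. \<Sum>c'\<in>I. if c' = c then (r c)\<^sup>2 else 0)"
    using assms by (intro sum.cong refl) (auto simp: power2_eq_square)
  finally show ?thesis using True by simp
qed simp

text \<open>
  The linear statistics of disjointly supported weights are independent; the proof linearises each
  exponential square by an auxiliary standard normal variable, so that only one-dimensional
  Gaussian integrals occur.
\<close>

lemma nn_integral_gauss_seq_exp_squares:
  fixes k :: nat and r :: "'c \<Rightarrow> nat \<Rightarrow> real"
  assumes s: "0 < \<sigma>" and fin: "finite I"
    and disj: "\<And>c c' j. c \<in> I \<Longrightarrow> c' \<in> I \<Longrightarrow> c \<noteq> c' \<Longrightarrow> j < k \<Longrightarrow> r c j * r c' j = 0"
    and g: "\<And>c. c \<in> I \<Longrightarrow> 0 \<le> g c" "\<And>c. c \<in> I \<Longrightarrow> g c * (\<Sum>j<k. (r c j)\<^sup>2) < 1"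
  shows "(\<integral>\<^sup>+e. ennreal (exp (\<Sum>c\<in>I. g c * (\<Sum>j<k. r c j * (e j / \<sigma>))\<^sup>2 / 2)) \<partial>noise_seq \<sigma>)
    = ennreal (\<Prod>c\<in>I. 1 / sqrt (1 - g c * (\<Sum>j<k. (r c j)\<^sup>2)))"
proof -
  let ?E = "noise_seq \<sigma>" and ?W = "PiM I (\<lambda>_. gauss 1)"
  interpret E: prob_space ?E by (rule prob_space_PiM) (rule prob_space_gauss[OF s])
  interpret W: prob_space ?W by (rule prob_space_PiM) (rule prob_space_gauss, simp)
  interpret EW: pair_sigma_finite ?E ?W ..
  have p1: "prob_space (gauss 1)" by (rule prob_space_gauss) simp
  define L where "L e c = (\<Sum>j<k. r c j * (e j / \<sigma>))" for e c
  have lin: "ennreal (exp (\<Sum>c\<in>I. g c * (L e c)\<^sup>2 / 2)) =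
      (\<integral>\<^sup>+w. ennreal (exp (\<Sum>c\<in>I. sqrt (g c) * L e c * w c)) \<partial>?W)" for e
  proof -
    have "(\<integral>\<^sup>+w. ennreal (exp (\<Sum>c\<in>I. sqrt (g c) * L e c * w c)) \<partial>?W)
      = (\<integral>\<^sup>+w. (\<Prod>c\<in>I. ennreal (exp (sqrt (g c) * L e c * w c))) \<partial>?W)"
      by (simp add: prod_ennreal_exp)
    also have "\<dots> = (\<Prod>c\<in>I. \<integral>\<^sup>+w. ennreal (exp (sqrt (g c) * L e c * w)) \<partial>gauss 1)"
      by (rule nn_integral_PiM_prod) (use p1 fin in auto)
    also have "\<dots> = (\<Prod>c\<in>I. ennreal (exp (g c * (L e c)\<^sup>2 / 2)))"
      using nn_integral_gauss_exp[of 1 0] g(1)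
      by (intro prod.cong) (auto simp: gauss_lik_def power_mult_distrib)
    finally show ?thesis by (simp add: prod_ennreal_exp)
  qed
  have "(\<integral>\<^sup>+e. ennreal (exp (\<Sum>c\<in>I. g c * (L e c)\<^sup>2 / 2)) \<partial>?E)
     = (\<integral>\<^sup>+e. \<integral>\<^sup>+w. ennreal (exp (\<Sum>c\<in>I. sqrt (g c) * L e c * w c)) \<partial>?W \<partial>?E)"
    by (simp add: lin)
  also have "\<dots> = (\<integral>\<^sup>+w. \<integral>\<^sup>+e. ennreal (exp (\<Sum>c\<in>I. sqrt (g c) * L e c * w c)) \<partial>?E \<partial>?W)"
    by (rule EW.Fubini'[symmetric]) (use fin in \<open>simp add: L_def\<close>)
  also have "\<dots> = (\<integral>\<^sup>+w. (\<Prod>c\<in>I. ennreal (exp (g c * (\<Sum>j<k. (r c j)\<^sup>2) * (w c)\<^sup>2 / 2))) \<partial>?W)"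
  proof (rule nn_integral_cong)
    fix w
    have "(\<integral>\<^sup>+e. ennreal (exp (\<Sum>c\<in>I. sqrt (g c) * L e c * w c)) \<partial>?E)
      = (\<integral>\<^sup>+e. ennreal (exp (\<Sum>j<k. (\<Sum>c\<in>I. sqrt (g c) * w c * r c j) * (e j / \<sigma>))) \<partial>?E)"
      unfolding L_def sum_distrib_left sum_distrib_right
      by (subst sum.swap) (simp add: mult_ac)
    also have "\<dots> = ennreal (exp (\<Sum>j<k. (\<Sum>c\<in>I. sqrt (g c) * w c * r c j)\<^sup>2 / 2))"
      by (rule nn_integral_gauss_seq_exp[OF s])
    \<comment> \<open>For each \<open>j\<close> at most one \<open>r c j\<close> is nonzero, so the
      square has no mixed terms and the integrand in \<open>w\<close> becomes a product over
      \<open>c\<close>.\<close>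
    also have "(\<Sum>j<k. (\<Sum>c\<in>I. sqrt (g c) * w c * r c j)\<^sup>2 / 2) = (\<Sum>j<k. \<Sum>c\<in>I. g c * (w c)\<^sup>2 * (r c j)\<^sup>2 / 2)"
    proof (rule sum.cong[OF refl])
      fix j assume "j \<in> {..<k}"
      then have "(\<Sum>c\<in>I. sqrt (g c) * w c * r c j)\<^sup>2 = (\<Sum>c\<in>I. (sqrt (g c) * w c * r c j)\<^sup>2)"
        by (intro sum_disjoint_square) (use disj in auto)
      also have "\<dots> = (\<Sum>c\<in>I. g c * (w c)\<^sup>2 * (r c j)\<^sup>2)"
        using g(1) by (intro sum.cong) (auto simp: power_mult_distrib)
      finally show "(\<Sum>c\<in>I. sqrt (g c) * w c * r c j)\<^sup>2 / 2 = (\<Sum>c\<in>I. g c * (w c)\<^sup>2 * (r c j)\<^sup>2 / 2)"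
        by (simp add: sum_divide_distrib)
    qed
    also have "\<dots> = (\<Sum>c\<in>I. g c * (\<Sum>j<k. (r c j)\<^sup>2) * (w c)\<^sup>2 / 2)"
      by (subst sum.swap) (simp add: sum_distrib_left sum_distrib_right sum_divide_distrib mult_ac)
    finally show "(\<integral>\<^sup>+e. ennreal (exp (\<Sum>c\<in>I. sqrt (g c) * L e c * w c)) \<partial>?E)
      = (\<Prod>c\<in>I. ennreal (exp (g c * (\<Sum>j<k. (r c j)\<^sup>2) * (w c)\<^sup>2 / 2)))"
      by (simp add: prod_ennreal_exp)
  qed
  also have "\<dots> = (\<Prod>c\<in>I. \<integral>\<^sup>+w. ennreal (exp (g c * (\<Sum>j<k. (r c j)\<^sup>2) * w\<^sup>2 / 2)) \<partial>gauss 1)"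
    by (rule nn_integral_PiM_prod) (use p1 fin in auto)
  also have "\<dots> = (\<Prod>c\<in>I. ennreal (1 / sqrt (1 - g c * (\<Sum>j<k. (r c j)\<^sup>2))))"
  proof (rule prod.cong[OF refl])
    \<comment> \<open>The exponent is a positive square, so the Gaussian integral is used with a
      negative n; the assumption \<open>g(2)\<close> keeps it above -1.\<close>
    fix c assume "c \<in> I"
    then show "(\<integral>\<^sup>+w. ennreal (exp (g c * (\<Sum>j<k. (r c j)\<^sup>2) * w\<^sup>2 / 2)) \<partial>gauss 1) = ennreal (1 / sqrt (1 - g c * (\<Sum>j<k. (r c j)\<^sup>2)))"
      using nn_integral_gauss_exp[of 1 "- (g c * (\<Sum>j<k. (r c j)\<^sup>2))" 0] g(2)[of c] by (simp add: gauss_lik_def)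
  qed
  also have "\<dots> = ennreal (\<Prod>c\<in>I. 1 / sqrt (1 - g c * (\<Sum>j<k. (r c j)\<^sup>2)))"
    by (rule prod_ennreal) (use g(2) in \<open>auto simp: less_imp_le\<close>)
  finally show ?thesis by (simp add: L_def)
qed

section \<open>Likelihood of a finite-rank Gaussian curve\<close>

definition obs_space :: "observation measure" where
  "obs_space = count_space UNIV \<Otimes>\<^sub>M (\<Pi>\<^sub>M j\<in>UNIV. borel \<Otimes>\<^sub>M borel)"

text \<open>In contrast to \<open>observe\<close>, the last component holds the observed values
  themselves; feeding it the errors produces pure noise data.\<close>

definition obs_of :: "nat \<times> (nat \<Rightarrow> real) \<times> (nat \<Rightarrow> real) \<Rightarrow> observation" where
  "obs_of = (\<lambda>(k, T, y). (k, \<lambda>j. if j < k then (T j, y j) else (0, 0)))"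

text \<open>Given the times, the log-likelihood of an amplitude w of \<psi>_c against pure noise is
  w times \<open>lik_stat\<close> minus w^2 / 2 times \<open>lik_weight\<close>; both are functions
  of the observation alone.\<close>

definition lik_weight :: "real \<Rightarrow> (nat \<Rightarrow> real \<Rightarrow> real) \<Rightarrow> nat \<Rightarrow> observation \<Rightarrow> real" where
  "lik_weight \<sigma> \<psi> c = (\<lambda>(k, z). \<Sum>j<k. (\<psi> c (fst (z j)) / \<sigma>)\<^sup>2)"

definition lik_stat :: "real \<Rightarrow> (nat \<Rightarrow> real \<Rightarrow> real) \<Rightarrow> nat \<Rightarrow> observation \<Rightarrow> real" where
  "lik_stat \<sigma> \<psi> c = (\<lambda>(k, z). \<Sum>j<k. \<psi> c (fst (z j)) / \<sigma> * (snd (z j) / \<sigma>))"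

text \<open>A product over bumps, because disjoint supports leave no interaction between the
  amplitudes in the exponent.\<close>

definition curve_lik :: "real \<Rightarrow> nat \<Rightarrow> (nat \<Rightarrow> real \<Rightarrow> real) \<Rightarrow> observation \<Rightarrow> real" where
  "curve_lik \<sigma> M \<psi> x = (\<Prod>c<M. gauss_lik (lik_weight \<sigma> \<psi> c x) (lik_stat \<sigma> \<psi> c x))"

definition rank_model :: "fda_model \<Rightarrow> real \<Rightarrow> nat \<Rightarrow> (nat \<Rightarrow> real \<Rightarrow> real) \<Rightarrow> fda_model" where
  "rank_model P \<sigma> M \<psi> = P\<lparr>curve_space := gauss_vec M,
     curve := (\<lambda>w t. \<Sum>c<M. w c * \<psi> c t), noise := gauss \<sigma>\<rparr>"

definition design_law :: "fda_model \<Rightarrow> real measure" where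
  "design_law P = density circle (\<lambda>t. ennreal (design_density P t))"

abbreviation times_seq :: "fda_model \<Rightarrow> (nat \<Rightarrow> real) measure" where
  "times_seq P \<equiv> PiM UNIV (\<lambda>_. design_law P)"

definition null_space :: "fda_model \<Rightarrow> real \<Rightarrow> (nat \<times> (nat \<Rightarrow> real) \<times> (nat \<Rightarrow> real)) measure" where
  "null_space P \<sigma> = measure_pmf (counts P) \<Otimes>\<^sub>M times_seq P \<Otimes>\<^sub>M noise_seq \<sigma>"

text \<open>The law of a subject with zero curve. It dominates all models that share the design and
  counts of \<open>P\<close>, so all sign patterns are compared through densities with respect to
  it.\<close>

definition null_law :: "fda_model \<Rightarrow> real \<Rightarrow> observation measure" where
  "null_law P \<sigma> = distr (null_space P \<sigma>) obs_space obs_of"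

abbreviation root_lik :: "real \<Rightarrow> nat \<Rightarrow> (nat \<Rightarrow> real \<Rightarrow> real) \<Rightarrow> (nat \<Rightarrow> real \<Rightarrow> real) \<Rightarrow> observation \<Rightarrow> real" where
  "root_lik \<sigma> M \<psi> \<psi>' x \<equiv> sqrt (curve_lik \<sigma> M \<psi> x * curve_lik \<sigma> M \<psi>' x)"

text \<open>The Hellinger affinity given count and times, whose laws are the same in both
  models.\<close>

abbreviation obs_affinity :: "real \<Rightarrow> nat \<Rightarrow> (nat \<Rightarrow> real \<Rightarrow> real) \<Rightarrow> (nat \<Rightarrow> real \<Rightarrow> real) \<Rightarrow> nat \<Rightarrow> (nat \<Rightarrow> real) \<Rightarrow> ennreal" where
  "obs_affinity \<sigma> M \<psi> \<psi>' k T \<equiv> \<integral>\<^sup>+e. ennreal (root_lik \<sigma> M \<psi> \<psi>' (obs_of (k, T, e))) \<partial>noise_seq \<sigma>"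

section \<open>Measurability and integration on the pure noise space\<close>

lemma measurable_circle_ident: "(\<lambda>x. x) \<in> measurable circle borel"
  unfolding circle_def by (rule measurable_restrict_space1) simp

text \<open>\<open>null_space\<close> carries the trace sigma-algebra of \<open>circle\<close> in
  its times. Measurability is checked on this Borel version and pulled back along the
  identity.\<close>

definition obs_base :: "(nat \<times> (nat \<Rightarrow> real) \<times> (nat \<Rightarrow> real)) measure" where
  "obs_base = count_space UNIV \<Otimes>\<^sub>M PiM UNIV (\<lambda>_. borel) \<Otimes>\<^sub>M PiM UNIV (\<lambda>_. borel)"

lemma measurable_design_seq_ident:
  "(\<lambda>T::nat \<Rightarrow> real. T) \<in> measurable (times_seq P) (PiM UNIV (\<lambda>_. borel))"
proof (rule measurable_abs_UNIV)
  fix j :: nat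
  have "(\<lambda>x. x) \<in> measurable (design_law P) borel"
    unfolding design_law_def by (simp add: measurable_circle_ident)
  from measurable_compose[OF measurable_component_singleton[of j UNIV "\<lambda>_. design_law P"] this]
  show "(\<lambda>T. T j) \<in> borel_measurable (times_seq P)"
    by simp
qed

lemma measurable_design_seq:
  "f \<in> measurable (PiM UNIV (\<lambda>_::nat. borel)) N \<Longrightarrow> f \<in> measurable (times_seq P) N"
  by (drule measurable_compose[OF measurable_design_seq_ident])

lemma measurable_null_space_ident: "(\<lambda>x. x) \<in> measurable (null_space P \<sigma>) obs_base"
proof -
  have "(\<lambda>x. (fst x, fst (snd x), snd (snd x))) \<in> measurable (null_space P \<sigma>) obs_base"
    unfolding null_space_def obs_base_def
    by (intro measurable_Pair measurable_compose[OF measurable_compose[OF measurable_snd measurable_fst] measurable_design_seq_ident]) measurable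
  then show ?thesis by simp
qed

lemma measurable_null_space: "f \<in> measurable obs_base N \<Longrightarrow> f \<in> measurable (null_space P \<sigma>) N"
  by (drule measurable_compose[OF measurable_null_space_ident])

lemma measurable_null_space_pair:
  "f \<in> measurable (Q \<Otimes>\<^sub>M obs_base) N \<Longrightarrow> f \<in> measurable (Q \<Otimes>\<^sub>M null_space P \<sigma>) N"
proof -
  assume f: "f \<in> measurable (Q \<Otimes>\<^sub>M obs_base) N"
  have "(\<lambda>x. (fst x, snd x)) \<in> measurable (Q \<Otimes>\<^sub>M null_space P \<sigma>) (Q \<Otimes>\<^sub>M obs_base)"
    by (intro measurable_Pair measurable_fst measurable_compose[OF measurable_snd measurable_null_space_ident])
  from measurable_compose[OF this f] show ?thesis by simp
qed

lemma measurable_obs_of [measurable]: "obs_of \<in> measurable (null_space P \<sigma>) obs_space"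
proof (rule measurable_null_space)
  have "(\<lambda>(k, T, y). (k, \<lambda>j. if j < k then (T j, y j) else (0, 0))) \<in> measurable obs_base obs_space"
    unfolding obs_space_def obs_base_def split_beta'
    by (intro measurable_Pair measurable_fst measurable_abs_UNIV) measurable
  then show "obs_of \<in> measurable obs_base obs_space" by (simp add: obs_of_def)
qed

lemma measurable_lik_weight [measurable]:
  assumes [measurable]: "\<psi> c \<in> borel_measurable borel"
  shows "lik_weight \<sigma> \<psi> c \<in> borel_measurable obs_space"
  unfolding lik_weight_def obs_space_def by measurable

lemma measurable_lik_stat [measurable]:
  assumes [measurable]: "\<psi> c \<in> borel_measurable borel"
  shows "lik_stat \<sigma> \<psi> c \<in> borel_measurable obs_space"
  unfolding lik_stat_def obs_space_def by measurable

lemma measurable_curve_lik [measurable]: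
  assumes [measurable]: "\<And>c. \<psi> c \<in> borel_measurable borel"
  shows "curve_lik \<sigma> M \<psi> \<in> borel_measurable obs_space"
  unfolding curve_lik_def gauss_lik_def by measurable

lemma lik_weight_nonneg: "0 \<le> lik_weight \<sigma> \<psi> c x"
  by (auto simp: lik_weight_def split: prod.split intro!: sum_nonneg)

lemma gauss_lik_pos: "0 \<le> n \<Longrightarrow> 0 < gauss_lik n b"
  by (simp add: gauss_lik_def)

lemma curve_lik_pos: "0 < curve_lik \<sigma> M \<psi> x"
  by (simp add: curve_lik_def prod_pos gauss_lik_pos lik_weight_nonneg)

lemma prob_space_design_seq: "prob_space (design_law P) \<Longrightarrow> prob_space (times_seq P)"
  by (rule prob_space_PiM)

lemma prob_space_gauss_seq: "0 < \<sigma> \<Longrightarrow> prob_space (noise_seq \<sigma>)"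
  by (rule prob_space_PiM) (rule prob_space_gauss)

abbreviation affinity :: "fda_model \<Rightarrow> real \<Rightarrow> nat \<Rightarrow> (nat \<Rightarrow> real \<Rightarrow> real) \<Rightarrow> (nat \<Rightarrow> real \<Rightarrow> real) \<Rightarrow> ennreal" where
  "affinity P \<sigma> M \<psi> \<psi>' \<equiv> \<integral>\<^sup>+x. ennreal (root_lik \<sigma> M \<psi> \<psi>' x) \<partial>null_law P \<sigma>"

lemma prob_space_null_space:
  assumes "prob_space (design_law P)" "0 < \<sigma>"
  shows "prob_space (null_space P \<sigma>)"
  unfolding null_space_def
  by (intro prob_space_pair prob_space_design_seq prob_space_gauss_seq assms) (rule measure_pmf.prob_space_axioms)

lemma prob_space_null_law:
  assumes "prob_space (design_law P)" "0 < \<sigma>"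
  shows "prob_space (null_law P \<sigma>)"
  unfolding null_law_def by (intro prob_space.prob_space_distr prob_space_null_space assms) simp

lemma nn_integral_null_space:
  assumes D: "prob_space (design_law P)" and s: "0 < \<sigma>"
    and F: "F \<in> borel_measurable (null_space P \<sigma>)"
  shows "(\<integral>\<^sup>+b. F b \<partial>null_space P \<sigma>) =
    (\<integral>\<^sup>+k. \<integral>\<^sup>+T. \<integral>\<^sup>+e. F (k, T, e) \<partial>noise_seq \<sigma> \<partial>times_seq P \<partial>measure_pmf (counts P))"
proof -
  interpret T: prob_space "times_seq P" by (rule prob_space_design_seq[OF D])
  interpret E: prob_space "noise_seq \<sigma>" by (rule prob_space_gauss_seq[OF s])
  interpret TE: pair_prob_space "times_seq P" "noise_seq \<sigma>" ..
  note F' = F[unfolded null_space_def]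
  have "(\<integral>\<^sup>+b. F b \<partial>null_space P \<sigma>) =
    (\<integral>\<^sup>+k. \<integral>\<^sup>+x. F (k, x) \<partial>(times_seq P \<Otimes>\<^sub>M noise_seq \<sigma>) \<partial>measure_pmf (counts P))"
    unfolding null_space_def by (rule TE.nn_integral_fst[OF F', symmetric])
  also have "\<dots> = (\<integral>\<^sup>+k. \<integral>\<^sup>+T. \<integral>\<^sup>+e. F (k, T, e) \<partial>noise_seq \<sigma> \<partial>times_seq P \<partial>measure_pmf (counts P))"
  proof (rule nn_integral_cong)
    fix k
    have "(\<lambda>x. F (k, x)) \<in> borel_measurable (times_seq P \<Otimes>\<^sub>M noise_seq \<sigma>)"
      by (rule measurable_Pair2[OF F']) simp
    from E.nn_integral_fst[OF this]
    show "(\<integral>\<^sup>+x. F (k, x) \<partial>(times_seq P \<Otimes>\<^sub>M noise_seq \<sigma>))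
      = (\<integral>\<^sup>+T. \<integral>\<^sup>+e. F (k, T, e) \<partial>noise_seq \<sigma> \<partial>times_seq P)" by simp
  qed
  finally show ?thesis .
qed

text \<open>For a fixed curve and fixed times the data are the errors shifted by the curve values
  \<open>d j\<close>; the padding by zeros makes the data depend on the first \<open>k\<close>
  errors only.\<close>

lemma nn_integral_translated_noise:
  assumes s: "0 < \<sigma>" and [measurable]: "F \<in> borel_measurable obs_space"
  shows "(\<integral>\<^sup>+e. F (k, \<lambda>j. if j < k then (T j, d j + e j) else (0, 0)) \<partial>noise_seq \<sigma>) =
    (\<integral>\<^sup>+e. F (obs_of (k, T, e)) * ennreal (exp (\<Sum>j<k. d j / \<sigma> * (e j / \<sigma>) - (d j / \<sigma>)\<^sup>2 / 2)) \<partial>noise_seq \<sigma>)"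
proof -
  let ?H = "\<lambda>e. F (k, \<lambda>j. if j < k then (T j, e j) else (0, 0))"
  have "(\<lambda>e. (k, \<lambda>j. if j < k then (T j, e j) else (0, 0))) \<in> measurable (PiM {..<k} (\<lambda>_. borel)) obs_space"
    unfolding obs_space_def
  proof (intro measurable_Pair measurable_const measurable_abs_UNIV)
    show "(\<lambda>e. if j < k then (T j, e j) else (0, 0)) \<in> measurable (PiM {..<k} (\<lambda>_. borel)) (borel \<Otimes>\<^sub>M borel)" for j
      by (cases "j < k") auto
  qed simp
  then have H: "?H \<in> borel_measurable (PiM {..<k} (\<lambda>_. borel))"
    by measurable
  have e1: "?H (\<lambda>j\<in>{..<k}. d j + e j) = F (k, \<lambda>j. if j < k then (T j, d j + e j) else (0, 0))" for e
    by (intro arg_cong[where f=F]) auto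
  have e2: "?H (restrict e {..<k}) = F (obs_of (k, T, e))" for e
    unfolding obs_of_def by (auto intro!: arg_cong[where f=F])
  show ?thesis
    using nn_integral_gauss_seq_translate[OF s H, of d] unfolding e1 e2 .
qed

text \<open>The Cameron-Martin density is averaged over the amplitudes. By disjointness the squared
  curve is a sum of squares, so the exponent is a separate quadratic in each \<open>w c\<close> and
  every factor is a \<open>gauss_lik\<close>.\<close>

lemma curve_lik_eq_mixture:
  assumes disj: "\<And>c c' t. c < M \<Longrightarrow> c' < M \<Longrightarrow> c \<noteq> c' \<Longrightarrow> \<psi> c t * \<psi> c' t = 0"
  shows "(\<integral>\<^sup>+w. ennreal (exp (\<Sum>j<k. (\<Sum>c<M. w c * \<psi> c (T j)) / \<sigma> * (e j / \<sigma>)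
            - ((\<Sum>c<M. w c * \<psi> c (T j)) / \<sigma>)\<^sup>2 / 2)) \<partial>gauss_vec M)
     = ennreal (curve_lik \<sigma> M \<psi> (obs_of (k, T, e)))"
proof -
  let ?n = "\<lambda>c. lik_weight \<sigma> \<psi> c (obs_of (k, T, e))" and ?b = "\<lambda>c. lik_stat \<sigma> \<psi> c (obs_of (k, T, e))"
  have n: "?n c = (\<Sum>j<k. (\<psi> c (T j) / \<sigma>)\<^sup>2)" and b: "?b c = (\<Sum>j<k. \<psi> c (T j) / \<sigma> * (e j / \<sigma>))" for c
    by (auto simp: lik_weight_def lik_stat_def obs_of_def intro!: sum.cong)
  have ex: "(\<Sum>j<k. (\<Sum>c<M. w c * \<psi> c (T j)) / \<sigma> * (e j / \<sigma>) - ((\<Sum>c<M. w c * \<psi> c (T j)) / \<sigma>)\<^sup>2 / 2)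
      = (\<Sum>c<M. ?b c * w c - ?n c * (w c)\<^sup>2 / 2)" for w
  proof -
    have sq: "(\<Sum>c<M. w c * \<psi> c t)\<^sup>2 = (\<Sum>c<M. (w c)\<^sup>2 * (\<psi> c t)\<^sup>2)" for t
      by (subst sum_disjoint_square) (use disj in \<open>auto simp: power_mult_distrib mult_ac\<close>)
    have "(\<Sum>j<k. (\<Sum>c<M. w c * \<psi> c (T j)) / \<sigma> * (e j / \<sigma>) - ((\<Sum>c<M. w c * \<psi> c (T j)) / \<sigma>)\<^sup>2 / 2)
      = (\<Sum>j<k. \<Sum>c<M. \<psi> c (T j) / \<sigma> * (e j / \<sigma>) * w c - (\<psi> c (T j) / \<sigma>)\<^sup>2 * (w c)\<^sup>2 / 2)"
      unfolding power_divide sq by (simp add: sum_subtractf sum_divide_distrib sum_distrib_right sum_distrib_left mult_ac)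
    also have "\<dots> = (\<Sum>c<M. ?b c * w c - ?n c * (w c)\<^sup>2 / 2)"
      unfolding n b by (subst sum.swap) (simp add: sum_subtractf sum_divide_distrib sum_distrib_right)
    finally show ?thesis .
  qed
  have "(\<integral>\<^sup>+w. (\<Prod>c<M. ennreal (exp (?b c * w c - ?n c * (w c)\<^sup>2 / 2))) \<partial>gauss_vec M)
     = (\<Prod>c<M. \<integral>\<^sup>+w. ennreal (exp (?b c * w - ?n c * w\<^sup>2 / 2)) \<partial>gauss 1)"
    by (rule nn_integral_PiM_prod) (auto intro: prob_space_gauss)
  also have "\<dots> = (\<Prod>c<M. ennreal (gauss_lik (?n c) (?b c)))"
  proof (rule prod.cong[OF refl])
    fix c
    have "-1 < ?n c" using lik_weight_nonneg[of \<sigma> \<psi> c "obs_of (k, T, e)"] by simp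
    from nn_integral_gauss_exp[OF _ this, of 1 "?b c"]
    show "(\<integral>\<^sup>+w. ennreal (exp (?b c * w - ?n c * w\<^sup>2 / 2)) \<partial>gauss 1) = ennreal (gauss_lik (?n c) (?b c))"
      by simp
  qed
  also have "\<dots> = ennreal (curve_lik \<sigma> M \<psi> (obs_of (k, T, e)))"
    unfolding curve_lik_def by (rule prod_ennreal) (simp add: less_imp_le gauss_lik_pos lik_weight_nonneg)
  finally show ?thesis unfolding ex by (simp add: prod_ennreal_exp)
qed

lemma rank_model_simps [simp]:
  "curve_space (rank_model P \<sigma> M \<psi>) = gauss_vec M"
  "curve (rank_model P \<sigma> M \<psi>) = (\<lambda>w t. \<Sum>c<M. w c * \<psi> c t)"
  "noise (rank_model P \<sigma> M \<psi>) = gauss \<sigma>"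
  "design_density (rank_model P \<sigma> M \<psi>) = design_density P"
  "counts (rank_model P \<sigma> M \<psi>) = counts P"
  by (simp_all add: rank_model_def)

lemma subject_space_rank_model:
  "subject_space (rank_model P \<sigma> M \<psi>) = gauss_vec M \<Otimes>\<^sub>M null_space P \<sigma>"
  by (simp add: subject_space_def null_space_def design_law_def)

lemma observe_rank_model:
  "observe (rank_model P \<sigma> M \<psi>) = (\<lambda>(w, k, T, e). (k, \<lambda>j. if j < k then (T j, (\<Sum>c<M. w c * \<psi> c (T j)) + e j) else (0, 0)))"
  by (auto simp: fun_eq_iff)

lemma measurable_observe_rank_model [measurable]:
  assumes [measurable]: "\<And>c. \<psi> c \<in> borel_measurable borel"
  shows "observe (rank_model P \<sigma> M \<psi>) \<in> measurable (gauss_vec M \<Otimes>\<^sub>M null_space P \<sigma>) obs_space"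
proof (rule measurable_null_space_pair)
  show "observe (rank_model P \<sigma> M \<psi>) \<in> measurable (gauss_vec M \<Otimes>\<^sub>M obs_base) obs_space"
    unfolding observe_rank_model obs_base_def obs_space_def split_beta'
    by (intro measurable_Pair measurable_abs_UNIV) measurable
qed

text \<open>For a fixed curve the law is a translate of pure noise; exchanging the order of
  integration moves the average over the amplitudes onto the translation density, where
  \<open>curve_lik_eq_mixture\<close> evaluates it.\<close>

lemma subject_law_density:
  assumes D: "prob_space (design_law P)" and s: "0 < \<sigma>"
    and [measurable]: "\<And>c. \<psi> c \<in> borel_measurable borel"
    and disj: "\<And>c c' t. c < M \<Longrightarrow> c' < M \<Longrightarrow> c \<noteq> c' \<Longrightarrow> \<psi> c t * \<psi> c' t = 0"
  shows "distr (subject_space (rank_model P \<sigma> M \<psi>)) obs_space (observe (rank_model P \<sigma> M \<psi>))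
    = density (null_law P \<sigma>) (\<lambda>x. ennreal (curve_lik \<sigma> M \<psi> x))"
    (is "distr ?S _ ?o = _")
proof (rule measure_eqI)
  fix A assume "A \<in> sets (distr ?S obs_space ?o)"
  then have [measurable]: "A \<in> sets obs_space" by simp
  let ?Q = "gauss_vec M" and ?B = "null_space P \<sigma>"
  interpret Q: prob_space ?Q by (rule prob_space_PiM) (rule prob_space_gauss, simp)
  interpret B: prob_space ?B by (rule prob_space_null_space[OF D s])
  interpret QB: pair_sigma_finite ?Q ?B ..
  let ?F = "indicator A :: observation \<Rightarrow> ennreal"
  let ?X = "\<lambda>w t. \<Sum>c<M. w c * \<psi> c t"
  let ?E = "\<lambda>w (k, T, e). ennreal (exp (\<Sum>j<k. ?X w (T j) / \<sigma> * (e j / \<sigma>) - (?X w (T j) / \<sigma>)\<^sup>2 / 2))"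
  have mE: "(\<lambda>(w, b). ?E w b) \<in> borel_measurable (?Q \<Otimes>\<^sub>M ?B)"
    by (rule measurable_null_space_pair) (unfold obs_base_def, measurable)
  have "emeasure (distr ?S obs_space ?o) A = (\<integral>\<^sup>+x. ?F (?o x) \<partial>(?Q \<Otimes>\<^sub>M ?B))"
    unfolding subject_space_rank_model
    by (subst nn_integral_indicator[symmetric]) (simp_all add: nn_integral_distr del: nn_integral_indicator)
  also have "\<dots> = (\<integral>\<^sup>+w. \<integral>\<^sup>+b. ?F (?o (w, b)) \<partial>?B \<partial>?Q)"
    by (rule B.nn_integral_fst[symmetric]) measurable
  also have "\<dots> = (\<integral>\<^sup>+w. \<integral>\<^sup>+b. ?F (obs_of b) * ?E w b \<partial>?B \<partial>?Q)"
  proof (rule nn_integral_cong)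
    fix w assume w: "w \<in> space ?Q"
    have m1: "(\<lambda>b. ?F (?o (w, b))) \<in> borel_measurable ?B"
      by (rule measurable_Pair2[OF _ w]) measurable
    have "(\<lambda>b. ?E w b) \<in> borel_measurable ?B"
      using measurable_Pair2[OF mE w] by simp
    then have m2: "(\<lambda>b. ?F (obs_of b) * ?E w b) \<in> borel_measurable ?B"
      by measurable
    show "(\<integral>\<^sup>+b. ?F (?o (w, b)) \<partial>?B) = (\<integral>\<^sup>+b. ?F (obs_of b) * ?E w b \<partial>?B)"
      unfolding nn_integral_null_space[OF D s m1] nn_integral_null_space[OF D s m2]
      unfolding observe_rank_model prod.case
      by (intro nn_integral_cong nn_integral_translated_noise[OF s]) measurable
  qed
  also have "\<dots> = (\<integral>\<^sup>+b. \<integral>\<^sup>+w. ?F (obs_of b) * ?E w b \<partial>?Q \<partial>?B)"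
    by (rule QB.Fubini'[symmetric]) (use mE in \<open>simp add: split_beta'\<close>)
  also have "\<dots> = (\<integral>\<^sup>+b. ?F (obs_of b) * ennreal (curve_lik \<sigma> M \<psi> (obs_of b)) \<partial>?B)"
  proof (rule nn_integral_cong)
    fix b :: "nat \<times> (nat \<Rightarrow> real) \<times> (nat \<Rightarrow> real)"
    assume b: "b \<in> space ?B"
    have "(\<lambda>w. ?E w b) \<in> borel_measurable ?Q"
      using measurable_Pair1[OF mE b] by simp
    then have "(\<integral>\<^sup>+w. ?F (obs_of b) * ?E w b \<partial>?Q) = ?F (obs_of b) * (\<integral>\<^sup>+w. ?E w b \<partial>?Q)"
      by (rule nn_integral_cmult)
    also have "(\<integral>\<^sup>+w. ?E w b \<partial>?Q) = ennreal (curve_lik \<sigma> M \<psi> (obs_of b))"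
      using curve_lik_eq_mixture[OF disj] by (cases b) simp
    finally show "(\<integral>\<^sup>+w. ?F (obs_of b) * ?E w b \<partial>?Q) = ?F (obs_of b) * ennreal (curve_lik \<sigma> M \<psi> (obs_of b))" .
  qed
  also have "\<dots> = (\<integral>\<^sup>+x. ?F x * ennreal (curve_lik \<sigma> M \<psi> x) \<partial>null_law P \<sigma>)"
    unfolding null_law_def by (subst nn_integral_distr) measurable
  also have "\<dots> = emeasure (density (null_law P \<sigma>) (\<lambda>x. ennreal (curve_lik \<sigma> M \<psi> x))) A"
    by (subst emeasure_density) (simp_all add: null_law_def mult.commute)
  finally show "emeasure (distr ?S obs_space ?o) A = \<dots>" .
qed (simp add: null_law_def)

section \<open>Two-point bounds\<close>

text \<open>Le Cam's method. As f g = min(f, g) max(f, g), Cauchy-Schwarz gives \<rho>^2 \<le>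
  (integral of min) (integral of max), and the latter is at most 2. The sum of the two risks
  dominates \<delta> times the integral of the minimum.\<close>

lemma two_point_bound:
  fixes f g :: "'a \<Rightarrow> real"
  assumes [measurable]: "f \<in> borel_measurable M" "g \<in> borel_measurable M"
      "l1 \<in> borel_measurable M" "l2 \<in> borel_measurable M"
    and pos: "\<And>x. 0 \<le> f x" "\<And>x. 0 \<le> g x"
    and one: "(\<integral>\<^sup>+x. ennreal (f x) \<partial>M) = 1" "(\<integral>\<^sup>+x. ennreal (g x) \<partial>M) = 1"
    and aff: "ennreal \<rho> \<le> (\<integral>\<^sup>+x. ennreal (sqrt (f x * g x)) \<partial>M)" and "0 \<le> \<rho>"
    and sep: "\<And>x. x \<in> space M \<Longrightarrow> ennreal \<delta> \<le> l1 x + l2 x" and d: "0 \<le> \<delta>"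
  shows "ennreal (\<delta> * \<rho>\<^sup>2 / 2) \<le> (\<integral>\<^sup>+x. l1 x \<partial>density M (\<lambda>x. ennreal (f x))) + (\<integral>\<^sup>+x. l2 x \<partial>density M (\<lambda>x. ennreal (g x)))"
proof -
  define m where "m x = min (f x) (g x)" for x
  define h where "h x = max (f x) (g x)" for x
  have [measurable]: "m \<in> borel_measurable M" "h \<in> borel_measurable M"
    unfolding m_def[abs_def] h_def[abs_def] by measurable
  have mh: "0 \<le> m x" "0 \<le> h x" for x using pos[of x] by (auto simp: m_def h_def)
  have "(ennreal \<rho>)\<^sup>2 \<le> (\<integral>\<^sup>+x. ennreal (sqrt (f x * g x)) \<partial>M)\<^sup>2"
    using aff by (rule power_mono) simp
  also have "\<dots> = (\<integral>\<^sup>+x. ennreal (sqrt (m x)) * ennreal (sqrt (h x)) \<partial>M)\<^sup>2"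
  proof (intro arg_cong[where f="\<lambda>x. x\<^sup>2"] nn_integral_cong)
    fix x
    have "f x * g x = m x * h x" by (auto simp: m_def h_def min_def max_def)
    then show "ennreal (sqrt (f x * g x)) = ennreal (sqrt (m x)) * ennreal (sqrt (h x))"
      using mh[of x] by (simp add: real_sqrt_mult ennreal_mult)
  qed
  also have "\<dots> \<le> (\<integral>\<^sup>+x. (ennreal (sqrt (m x)))\<^sup>2 \<partial>M) * (\<integral>\<^sup>+x. (ennreal (sqrt (h x)))\<^sup>2 \<partial>M)"
    by (rule Cauchy_Schwarz_nn_integral) measurable
  also have "\<dots> = (\<integral>\<^sup>+x. ennreal (m x) \<partial>M) * (\<integral>\<^sup>+x. ennreal (h x) \<partial>M)"
    using mh by (simp add: ennreal_power)
  also have "(\<integral>\<^sup>+x. ennreal (h x) \<partial>M) \<le> (\<integral>\<^sup>+x. ennreal (f x) + ennreal (g x) \<partial>M)"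
    using pos by (intro nn_integral_mono) (auto simp: h_def max_def)
  also have "\<dots> = 2" by (subst nn_integral_add) (auto simp: one)
  finally have "(ennreal \<rho>)\<^sup>2 \<le> (\<integral>\<^sup>+x. ennreal (m x) \<partial>M) * 2"
    by (simp add: mult_left_mono)
  then have r: "ennreal (\<rho>\<^sup>2 / 2) \<le> (\<integral>\<^sup>+x. ennreal (m x) \<partial>M)"
  proof -
    assume a: "(ennreal \<rho>)\<^sup>2 \<le> (\<integral>\<^sup>+x. ennreal (m x) \<partial>M) * 2"
    have "ennreal (\<rho>\<^sup>2 / 2) * 2 = (ennreal \<rho>)\<^sup>2"
      using \<open>0 \<le> \<rho>\<close> by (simp add: ennreal_power ennreal_mult[symmetric] flip: ennreal_numeral)
    with a have "ennreal (\<rho>\<^sup>2 / 2) * 2 \<le> (\<integral>\<^sup>+x. ennreal (m x) \<partial>M) * 2" by simp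
    then show ?thesis
      by (simp add: ennreal_mult_le_mult_iff mult.commute)
  qed
  have "ennreal (\<delta> * \<rho>\<^sup>2 / 2) = ennreal \<delta> * ennreal (\<rho>\<^sup>2 / 2)"
    using d by (simp add: ennreal_mult[symmetric])
  also have "\<dots> \<le> ennreal \<delta> * (\<integral>\<^sup>+x. ennreal (m x) \<partial>M)"
    using r by (rule mult_left_mono) simp
  also have "\<dots> = (\<integral>\<^sup>+x. ennreal \<delta> * ennreal (m x) \<partial>M)"
    by (simp add: nn_integral_cmult)
  also have "\<dots> \<le> (\<integral>\<^sup>+x. ennreal (f x) * l1 x + ennreal (g x) * l2 x \<partial>M)"
  proof (rule nn_integral_mono)
    fix x assume "x \<in> space M"
    then have "ennreal \<delta> * ennreal (m x) \<le> (l1 x + l2 x) * ennreal (m x)"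
      by (intro mult_right_mono sep) auto
    also have "\<dots> = ennreal (m x) * l1 x + ennreal (m x) * l2 x"
      by (simp add: distrib_left mult.commute)
    also have "\<dots> \<le> ennreal (f x) * l1 x + ennreal (g x) * l2 x"
      by (intro add_mono mult_right_mono) (auto simp: m_def intro!: ennreal_leI)
    finally show "ennreal \<delta> * ennreal (m x) \<le> ennreal (f x) * l1 x + ennreal (g x) * l2 x" .
  qed
  also have "\<dots> = (\<integral>\<^sup>+x. l1 x \<partial>density M (\<lambda>x. ennreal (f x))) + (\<integral>\<^sup>+x. l2 x \<partial>density M (\<lambda>x. ennreal (g x)))"
    by (simp add: nn_integral_add nn_integral_density)
  finally show ?thesis .
qed

lemma sqrt_prod: "sqrt (\<Prod>i\<in>I. f i) = (\<Prod>i\<in>I. sqrt (f i))"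
  by (induction I rule: infinite_finite_induct) (simp_all add: real_sqrt_mult)

definition disjoint_family_fun :: "nat \<Rightarrow> (nat \<Rightarrow> real \<Rightarrow> real) \<Rightarrow> bool" where
  "disjoint_family_fun M \<psi> \<longleftrightarrow> (\<forall>c<M. \<forall>c'<M. c \<noteq> c' \<longrightarrow> (\<forall>t. \<psi> c t * \<psi> c' t = 0))"

lemma sets_null_law [simp, measurable_cong]: "sets (null_law P \<sigma>) = sets obs_space"
  by (simp add: null_law_def)

lemma space_obs_space [simp]: "space obs_space = UNIV"
  by (simp add: obs_space_def space_pair_measure space_PiM)

text \<open>No integral is computed: the likelihood is the density of a law already known to be a
  probability.\<close>

lemma nn_integral_curve_lik:
  assumes D: "prob_space (design_law P)" and s: "0 < \<sigma>"
    and m[measurable]: "\<And>c. \<psi> c \<in> borel_measurable borel"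
    and disj: "disjoint_family_fun M \<psi>"
  shows "(\<integral>\<^sup>+x. ennreal (curve_lik \<sigma> M \<psi> x) \<partial>null_law P \<sigma>) = 1"
proof -
  have "prob_space (subject_space (rank_model P \<sigma> M \<psi>))"
    unfolding subject_space_rank_model
    by (intro prob_space_pair prob_space_null_space D s prob_space_PiM prob_space_gauss) simp
  moreover have "observe (rank_model P \<sigma> M \<psi>) \<in> measurable (subject_space (rank_model P \<sigma> M \<psi>)) obs_space"
    unfolding subject_space_rank_model by measurable
  ultimately have "prob_space (distr (subject_space (rank_model P \<sigma> M \<psi>)) obs_space (observe (rank_model P \<sigma> M \<psi>)))"
    by (rule prob_space.prob_space_distr)
  then have "prob_space (density (null_law P \<sigma>) (\<lambda>x. ennreal (curve_lik \<sigma> M \<psi> x)))"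
    by (subst (asm) subject_law_density[OF D s m]) (use disj in \<open>auto simp: disjoint_family_fun_def\<close>)
  from prob_space.emeasure_space_1[OF this]
  have "emeasure (density (null_law P \<sigma>) (\<lambda>x. ennreal (curve_lik \<sigma> M \<psi> x))) (space obs_space) = 1"
    by (simp add: null_law_def)
  then show ?thesis
    by (subst (asm) emeasure_density) (simp_all del: space_obs_space, simp)
qed

lemma data_law_density:
  assumes D: "prob_space (design_law P)" and s: "0 < \<sigma>"
    and m[measurable]: "\<And>c. \<psi> c \<in> borel_measurable borel"
    and disj: "disjoint_family_fun M \<psi>"
  shows "data_law n (rank_model P \<sigma> M \<psi>) =
    density (PiM {..<n} (\<lambda>_. null_law P \<sigma>)) (\<lambda>d. ennreal (\<Prod>i<n. curve_lik \<sigma> M \<psi> (d i)))"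
proof -
  let ?S = "subject_space (rank_model P \<sigma> M \<psi>)" and ?o = "observe (rank_model P \<sigma> M \<psi>)"
  have p: "prob_space ?S"
    unfolding subject_space_rank_model
    by (intro prob_space_pair prob_space_null_space D s prob_space_PiM prob_space_gauss) simp
  have [measurable]: "?o \<in> measurable ?S obs_space"
    unfolding subject_space_rank_model by measurable
  have eq: "distr ?S obs_space ?o = density (null_law P \<sigma>) (\<lambda>x. ennreal (curve_lik \<sigma> M \<psi> x))"
    by (rule subject_law_density[OF D s m]) (use disj in \<open>auto simp: disjoint_family_fun_def\<close>)
  have "data_law n (rank_model P \<sigma> M \<psi>) =
     distr (PiM {..<n} (\<lambda>_. ?S)) (PiM {..<n} (\<lambda>_. obs_space)) (\<lambda>\<omega>. \<lambda>i\<in>{..<n}. ?o (\<omega> i))"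
    unfolding data_law_def data_space_def obs_space_def ..
  also have "\<dots> = PiM {..<n} (\<lambda>_. distr ?S obs_space ?o)"
    by (rule distr_PiM_componentwise) (auto intro: p)
  also have "\<dots> = density (PiM {..<n} (\<lambda>_. null_law P \<sigma>)) (\<lambda>d. \<Prod>i<n. ennreal (curve_lik \<sigma> M \<psi> (d i)))"
    unfolding eq by (rule PiM_density)
      (auto intro: prob_space_null_law D s prob_space.prob_space_distr[OF p] simp: eq[symmetric])
  also have "\<dots> = density (PiM {..<n} (\<lambda>_. null_law P \<sigma>)) (\<lambda>d. ennreal (\<Prod>i<n. curve_lik \<sigma> M \<psi> (d i)))"
    by (simp add: prod_ennreal less_imp_le curve_lik_pos)
  finally show ?thesis .
qed

text \<open>The affinity of \<open>n\<close> subjects is the \<open>n\<close>-th power, and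
  Bernoulli's inequality with n \<epsilon> \<le> 1/2 keeps it above 1/2. The 8 is this 1/2 squared,
  together with the 2 in \<open>two_point_bound\<close>.\<close>

lemma data_law_two_point:
  assumes D: "prob_space (design_law P)" and s: "0 < \<sigma>"
    and m[measurable]: "\<And>c. \<psi> c \<in> borel_measurable borel" "\<And>c. \<psi>' c \<in> borel_measurable borel"
    and disj: "disjoint_family_fun M \<psi>" "disjoint_family_fun M \<psi>'"
    and aff: "ennreal (1 - \<epsilon>) \<le> affinity P \<sigma> M \<psi> \<psi>'"
    and e: "0 \<le> \<epsilon>" "real n * \<epsilon> \<le> 1 / 2" and n: "1 \<le> n"
    and l[measurable]: "l1 \<in> borel_measurable (data_space n)" "l2 \<in> borel_measurable (data_space n)"
    and sep: "\<And>d. d \<in> space (data_space n) \<Longrightarrow> ennreal \<delta> \<le> l1 d + l2 d" and d: "0 \<le> \<delta>"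
  shows "ennreal (\<delta> / 8) \<le> (\<integral>\<^sup>+d. l1 d \<partial>data_law n (rank_model P \<sigma> M \<psi>)) + (\<integral>\<^sup>+d. l2 d \<partial>data_law n (rank_model P \<sigma> M \<psi>'))"
proof -
  let ?N = "PiM {..<n} (\<lambda>_. null_law P \<sigma>)"
  have N: "sets ?N = sets (data_space n)"
    unfolding data_space_def obs_space_def[symmetric] by (intro sets_PiM_cong) auto
  have pm: "(\<lambda>d. \<Prod>i<n. curve_lik \<sigma> M \<phi> (d i)) \<in> borel_measurable ?N"
    if [measurable]: "\<And>c. \<phi> c \<in> borel_measurable borel" for \<phi>
    by measurable
  note [measurable_cong] = N
  interpret product_prob_space "\<lambda>_::nat. null_law P \<sigma>"
    by (rule product_prob_spaceI) (rule prob_space_null_law[OF D s])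
  have cl: "0 \<le> curve_lik \<sigma> M \<phi> x" for \<phi> x using curve_lik_pos[of \<sigma> M \<phi> x] by simp
  have one: "(\<integral>\<^sup>+x. ennreal (\<Prod>i<n. curve_lik \<sigma> M \<phi> (x i)) \<partial>?N) = 1"
    if "\<And>c. \<phi> c \<in> borel_measurable borel" "disjoint_family_fun M \<phi>" for \<phi>
  proof -
    note [measurable] = that(1)
    have "(\<integral>\<^sup>+x. ennreal (\<Prod>i<n. curve_lik \<sigma> M \<phi> (x i)) \<partial>?N) = (\<integral>\<^sup>+x. (\<Prod>i<n. ennreal (curve_lik \<sigma> M \<phi> (x i))) \<partial>?N)"
      by (simp add: prod_ennreal cl)
    also have "\<dots> = (\<Prod>i<n. \<integral>\<^sup>+x. ennreal (curve_lik \<sigma> M \<phi> x) \<partial>null_law P \<sigma>)"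
      by (rule product_nn_integral_prod) auto
    finally show ?thesis by (simp add: nn_integral_curve_lik[OF D s that])
  qed
  have e1: "\<epsilon> \<le> 1 / 2"
  proof -
    have "1 * \<epsilon> \<le> real n * \<epsilon>" using n e(1) by (intro mult_right_mono) auto
    with e(2) show ?thesis by simp
  qed
  have r: "1 / 2 \<le> (1 - \<epsilon>) ^ n"
    using Bernoulli_inequality[of "- \<epsilon>" n] e e1 by simp
  have "ennreal ((1 - \<epsilon>) ^ n) = ennreal (1 - \<epsilon>) ^ n"
    using e1 by (simp add: ennreal_power)
  also have "\<dots> \<le> affinity P \<sigma> M \<psi> \<psi>' ^ n"
    using aff by (rule power_mono) simp
  also have "\<dots> = (\<Prod>i<n. \<integral>\<^sup>+x. ennreal (root_lik \<sigma> M \<psi> \<psi>' x) \<partial>null_law P \<sigma>)"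
    by simp
  also have "\<dots> = (\<integral>\<^sup>+x. (\<Prod>i<n. ennreal (root_lik \<sigma> M \<psi> \<psi>' (x i))) \<partial>?N)"
    by (rule product_nn_integral_prod[symmetric]) auto
  also have "\<dots> = (\<integral>\<^sup>+x. ennreal (sqrt ((\<Prod>i<n. curve_lik \<sigma> M \<psi> (x i)) * (\<Prod>i<n. curve_lik \<sigma> M \<psi>' (x i)))) \<partial>?N)"
    by (simp add: prod_ennreal cl prod.distrib[symmetric] sqrt_prod)
  finally have aff': "ennreal ((1 - \<epsilon>) ^ n) \<le> \<dots>" .
  have "ennreal (\<delta> / 8) \<le> ennreal (\<delta> * ((1 - \<epsilon>) ^ n)\<^sup>2 / 2)"
  proof (rule ennreal_leI)
    have "(1 / 2)\<^sup>2 \<le> ((1 - \<epsilon>) ^ n)\<^sup>2" using r by (intro power_mono) auto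
    then have "\<delta> * (1 / 4) \<le> \<delta> * ((1 - \<epsilon>) ^ n)\<^sup>2" using d by (intro mult_left_mono) (auto simp: power2_eq_square)
    then show "\<delta> / 8 \<le> \<delta> * ((1 - \<epsilon>) ^ n)\<^sup>2 / 2" by simp
  qed
  also have "\<dots> \<le> (\<integral>\<^sup>+d. l1 d \<partial>data_law n (rank_model P \<sigma> M \<psi>)) + (\<integral>\<^sup>+d. l2 d \<partial>data_law n (rank_model P \<sigma> M \<psi>'))"
    unfolding data_law_density[OF D s m(1) disj(1)] data_law_density[OF D s m(2) disj(2)]
  proof (rule two_point_bound[OF _ _ _ _ _ _ one[OF m(1) disj(1)] one[OF m(2) disj(2)] aff'])
    show "ennreal \<delta> \<le> l1 x + l2 x" if "x \<in> space ?N" for x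
      using that sets_eq_imp_space_eq[OF N] by (intro sep) simp
    show "0 \<le> (1 - \<epsilon>) ^ n" using e1 by simp
  qed (use d in \<open>auto intro!: prod_nonneg cl pm\<close>)
  finally show ?thesis .
qed

section \<open>Affinity of neighbouring models\<close>

lemma lik_obs_of:
  "lik_weight \<sigma> \<psi> c (obs_of (k, T, e)) = (\<Sum>j<k. (\<psi> c (T j) / \<sigma>)\<^sup>2)"
  "lik_stat \<sigma> \<psi> c (obs_of (k, T, e)) = (\<Sum>j<k. \<psi> c (T j) / \<sigma> * (e j / \<sigma>))"
  by (auto simp: lik_weight_def lik_stat_def obs_of_def intro!: sum.cong)

lemma half_fraction: "2 * (x / (4 * y)) = x / (2 * (y::real))"
  by (simp add: divide_simps)

lemma gauss_lik_mult_same: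
  assumes "0 \<le> n"
  shows "gauss_lik n b * gauss_lik n b' = (1 / sqrt (1 + n) * exp ((b\<^sup>2 + b'\<^sup>2) / (4 * (1 + n))))\<^sup>2"
proof -
  have "2 * ((b\<^sup>2 + b'\<^sup>2) / (4 * (1 + n))) = b\<^sup>2 / (2 * (1 + n)) + b'\<^sup>2 / (2 * (1 + n))"
    unfolding half_fraction by (rule add_divide_distrib)
  then have "(exp ((b\<^sup>2 + b'\<^sup>2) / (4 * (1 + n))))\<^sup>2 = exp (b\<^sup>2 / (2 * (1 + n))) * exp (b'\<^sup>2 / (2 * (1 + n)))"
    by (metis exp_add exp_double)
  then show ?thesis
    using assms by (simp add: gauss_lik_def power_divide power_mult_distrib)
qed

text \<open>The exact value of this affinity is \<open>\<surd>((1 + u + v) / ((1 + u) (1 + v)))\<close>.\<close>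

lemma flip_conditional_affinity:
  fixes k :: nat
  assumes s: "0 < \<sigma>" and c0: "c0 < M"
    and disj: "disjoint_family_fun M \<psi>"
    and A: "\<And>t. A t * B t = 0" "\<And>t. \<psi> c0 t = A t + B t" "\<And>t. \<psi>' c0 t = A t - B t"
    and same: "\<And>c. c \<noteq> c0 \<Longrightarrow> \<psi>' c = \<psi> c"
  defines "u \<equiv> \<lambda>T. \<Sum>j<k. (A (T j) / \<sigma>)\<^sup>2" and "v \<equiv> \<lambda>T. \<Sum>j<k. (B (T j) / \<sigma>)\<^sup>2"
  shows "ennreal (1 - u T * v T) \<le>
    obs_affinity \<sigma> M \<psi> \<psi>' k T"
proof -
  define n where "n c = (\<Sum>j<k. (\<psi> c (T j) / \<sigma>)\<^sup>2)" for c
  \<comment> \<open>The bump \<open>c0\<close> is replaced by its two halves: index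
    \<open>c0\<close> keeps \<open>A\<close>, the additional index \<open>M\<close> receives
    \<open>B\<close>. This enlarged family is again disjoint.\<close>
  define \<phi> where "\<phi> c = (if c = M then B else if c = c0 then A else \<psi> c)" for c
  define g where "g c = 1 / (1 + n (if c = M then c0 else c))" for c
  define S where "S f e = (\<Sum>j<k. f (T j) / \<sigma> * (e j / \<sigma>))" for f e
  define N where "N c = (\<Sum>j<k. (\<phi> c (T j) / \<sigma>)\<^sup>2)" for c
  have n0: "0 \<le> n c" for c by (simp add: n_def sum_nonneg)
  have uv0: "0 \<le> u T" "0 \<le> v T" by (simp_all add: u_def v_def sum_nonneg)
  have AB: "(x + y)\<^sup>2 = x\<^sup>2 + y\<^sup>2" "(x - y)\<^sup>2 = x\<^sup>2 + y\<^sup>2" if "x * y = 0" for x y :: real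
    using that by (auto simp: power2_eq_square)
  have n_c0: "n c0 = u T + v T"
    unfolding n_def u_def v_def sum.distrib[symmetric] power_divide A(2) AB(1)[OF A(1)]
    by (simp add: add_divide_distrib)
  \<comment> \<open>Flipping the sign does not change the weights, since \<open>A\<close> and
    \<open>B\<close> are disjoint; the two models differ in the statistic of \<open>c0\<close>
    only.\<close>
  have w: "lik_weight \<sigma> \<psi> c (obs_of (k, T, e)) = n c" "lik_weight \<sigma> \<psi>' c (obs_of (k, T, e)) = n c" for c e
    by (cases "c = c0"; simp add: lik_obs_of n_def same A AB power_divide)+
  have Sc0: "S (\<psi> c0) e = S A e + S B e" "S (\<psi>' c0) e = S A e - S B e" for e
    unfolding S_def A by (simp_all add: sum.distrib[symmetric] sum_subtractf[symmetric] add_divide_distrib diff_divide_distrib algebra_simps)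
  \<comment> \<open>For \<open>c0\<close> the squares of S A + S B and S A - S B are averaged, so
    the mixed term cancels and two independent squares remain.\<close>
  have half: "((S (\<psi> c) e)\<^sup>2 + (S (\<psi>' c) e)\<^sup>2) / (4 * (1 + n c)) =
     (if c = c0 then g c * (S A e)\<^sup>2 / 2 + g M * (S B e)\<^sup>2 / 2 else g c * (S (\<phi> c) e)\<^sup>2 / 2)" if "c < M" for c e
  proof (cases "c = c0")
    case True
    have "(S A e + S B e)\<^sup>2 + (S A e - S B e)\<^sup>2 = 2 * ((S A e)\<^sup>2 + (S B e)\<^sup>2)" by (simp add: power2_eq_square algebra_simps)
    then have "((S (\<psi> c) e)\<^sup>2 + (S (\<psi>' c) e)\<^sup>2) / (4 * (1 + n c0)) = ((S A e)\<^sup>2 + (S B e)\<^sup>2) / (2 * (1 + n c0))"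
      unfolding half_fraction[symmetric] unfolding Sc0 True by simp
    then show ?thesis using True that by (simp add: g_def add_divide_distrib mult.commute)
  next
    case False
    then have "((S (\<psi> c) e)\<^sup>2 + (S (\<psi>' c) e)\<^sup>2) / (4 * (1 + n c)) = (S (\<psi> c) e)\<^sup>2 / (2 * (1 + n c))"
      unfolding half_fraction[symmetric] by (simp add: same)
    then show ?thesis using False that by (simp add: g_def \<phi>_def mult.commute)
  qed
  define Z where "Z = (\<Prod>c<M. 1 / sqrt (1 + n c))"
  have Z0: "0 \<le> Z" unfolding Z_def by (intro prod_nonneg) (simp add: n0)
  have sumM: "(\<Sum>c\<le>M. F c) = (\<Sum>c<M. if c = c0 then F c0 + F M else F c)" for F :: "nat \<Rightarrow> real"
  proof -
    have "(\<Sum>c<M. if c = c0 then F c0 + F M else F c) = (\<Sum>c<M. F c + (if c = c0 then F M else 0))"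
      by (intro sum.cong) auto
    also have "\<dots> = (\<Sum>c<M. F c) + F M" using c0 by (simp add: sum.distrib)
    finally show ?thesis by (simp add: lessThan_Suc_atMost[symmetric])
  qed
  have integrand: "root_lik \<sigma> M \<psi> \<psi>' (obs_of (k, T, e))
      = Z * exp (\<Sum>c\<le>M. g c * (S (\<phi> c) e)\<^sup>2 / 2)" for e
  proof -
    have "curve_lik \<sigma> M \<psi> (obs_of (k, T, e)) * curve_lik \<sigma> M \<psi>' (obs_of (k, T, e))
       = (\<Prod>c<M. gauss_lik (n c) (S (\<psi> c) e) * gauss_lik (n c) (S (\<psi>' c) e))"
      unfolding curve_lik_def w by (simp add: lik_obs_of S_def prod.distrib)
    also have "\<dots> = (\<Prod>c<M. (1 / sqrt (1 + n c) * exp (((S (\<psi> c) e)\<^sup>2 + (S (\<psi>' c) e)\<^sup>2) / (4 * (1 + n c))))\<^sup>2)"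
      by (intro prod.cong refl gauss_lik_mult_same n0)
    also have "\<dots> = (Z * exp (\<Sum>c<M. ((S (\<psi> c) e)\<^sup>2 + (S (\<psi>' c) e)\<^sup>2) / (4 * (1 + n c))))\<^sup>2"
      unfolding Z_def by (simp only: exp_sum finite_lessThan prod.distrib[symmetric] prod_power_distrib)
    also have "(\<Sum>c<M. ((S (\<psi> c) e)\<^sup>2 + (S (\<psi>' c) e)\<^sup>2) / (4 * (1 + n c))) = (\<Sum>c\<le>M. g c * (S (\<phi> c) e)\<^sup>2 / 2)"
      unfolding sumM by (intro sum.cong) (use half c0 in \<open>auto simp: \<phi>_def\<close>)
    finally show ?thesis using Z0 by simp
  qed
  have gN: "g c * N c = (if c = c0 then u T / (1 + n c0) else if c = M then v T / (1 + n c0) else n c / (1 + n c))" if "c \<le> M" for c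
    using c0 that by (auto simp: g_def N_def \<phi>_def u_def v_def n_def)
  have lt1: "g c * N c < 1" if "c \<le> M" for c
    unfolding gN[OF that] using uv0 n0[of c] by (auto simp: n_c0)
  \<comment> \<open>All bumps other than \<open>c0\<close> contribute the square root of 1 + n c,
    which the prefactor \<open>Z\<close> cancels; only the two halves of \<open>c0\<close> leave
    something behind.\<close>
  have val: "(\<Prod>c\<le>M. 1 / sqrt (1 - g c * N c)) = (\<Prod>c<M. sqrt (1 + n c)) * sqrt ((1 + n c0) / ((1 + u T) * (1 + v T)))"
  proof -
    have one: "1 - n c / (1 + n c) = 1 / (1 + n c)" for c using n0[of c] by (simp add: field_simps)
    have "(\<Prod>c\<le>M. 1 / sqrt (1 - g c * N c)) = (\<Prod>c<M. 1 / sqrt (1 - g c * N c)) * (1 / sqrt (1 - g M * N M))"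
      by (simp add: lessThan_Suc_atMost[symmetric])
    also have "(\<Prod>c<M. 1 / sqrt (1 - g c * N c)) = (1 / sqrt (1 - g c0 * N c0)) * (\<Prod>c\<in>{..<M} - {c0}. 1 / sqrt (1 - g c * N c))"
      using c0 by (intro prod.remove) auto
    also have "(\<Prod>c\<in>{..<M} - {c0}. 1 / sqrt (1 - g c * N c)) = (\<Prod>c\<in>{..<M} - {c0}. sqrt (1 + n c))"
      by (intro prod.cong refl) (auto simp: gN one real_sqrt_divide)
    also have "1 / sqrt (1 - g c0 * N c0) * (\<Prod>c\<in>{..<M} - {c0}. sqrt (1 + n c)) * (1 / sqrt (1 - g M * N M))
      = (1 / sqrt (1 - g c0 * N c0) * (1 / sqrt (1 - g M * N M)) / sqrt (1 + n c0)) * (sqrt (1 + n c0) * (\<Prod>c\<in>{..<M} - {c0}. sqrt (1 + n c)))"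
      using n0[of c0] by simp
    also have "sqrt (1 + n c0) * (\<Prod>c\<in>{..<M} - {c0}. sqrt (1 + n c)) = (\<Prod>c<M. sqrt (1 + n c))"
      using c0 by (intro prod.remove[symmetric]) auto
    also have "1 / sqrt (1 - g c0 * N c0) * (1 / sqrt (1 - g M * N M)) / sqrt (1 + n c0) = sqrt ((1 + n c0) / ((1 + u T) * (1 + v T)))"
    proof -
      have a: "1 - g c0 * N c0 = (1 + v T) / (1 + n c0)" "1 - g M * N M = (1 + u T) / (1 + n c0)"
        using c0 uv0 unfolding gN[OF less_imp_le[OF c0]] gN[OF order_refl] by (simp_all add: n_c0 field_simps)
      have "1 / sqrt (1 - g c0 * N c0) * (1 / sqrt (1 - g M * N M)) / sqrt (1 + n c0) = sqrt (1 / ((1 - g c0 * N c0) * (1 - g M * N M) * (1 + n c0)))"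
        by (simp add: real_sqrt_divide real_sqrt_mult)
      also have "1 / ((1 - g c0 * N c0) * (1 - g M * N M) * (1 + n c0)) = (1 + n c0) / ((1 + u T) * (1 + v T))"
      proof -
        have "1 / (x / m * (y / m) * m) = m / (y * x)" if "0 < m" for x y m :: real
          using that by (simp add: field_simps)
        then show ?thesis unfolding a using n0[of c0] by simp
      qed
      finally show ?thesis .
    qed
    finally show ?thesis by simp
  qed
  have "obs_affinity \<sigma> M \<psi> \<psi>' k T
     = (\<integral>\<^sup>+e. ennreal Z * ennreal (exp (\<Sum>c\<le>M. g c * (\<Sum>j<k. \<phi> c (T j) / \<sigma> * (e j / \<sigma>))\<^sup>2 / 2)) \<partial>noise_seq \<sigma>)"
    unfolding integrand using Z0 by (simp add: ennreal_mult S_def)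
  also have "\<dots> = ennreal Z * (\<integral>\<^sup>+e. ennreal (exp (\<Sum>c\<le>M. g c * (\<Sum>j<k. \<phi> c (T j) / \<sigma> * (e j / \<sigma>))\<^sup>2 / 2)) \<partial>noise_seq \<sigma>)"
    by (rule nn_integral_cmult) measurable
  also have "(\<integral>\<^sup>+e. ennreal (exp (\<Sum>c\<le>M. g c * (\<Sum>j<k. \<phi> c (T j) / \<sigma> * (e j / \<sigma>))\<^sup>2 / 2)) \<partial>noise_seq \<sigma>)
     = ennreal (\<Prod>c\<le>M. 1 / sqrt (1 - g c * (\<Sum>j<k. (\<phi> c (T j) / \<sigma>)\<^sup>2)))"
  proof (rule nn_integral_gauss_seq_exp_squares[OF s])
    have zero: "A t * \<psi> c t = 0" "B t * \<psi> c t = 0" "\<psi> c t * A t = 0" "\<psi> c t * B t = 0" if "c < M" "c \<noteq> c0" for c t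
    proof -
      have "(A t + B t) * \<psi> c t = 0"
        using disj that c0 unfolding disjoint_family_fun_def A(2)[symmetric] by auto
      then show "A t * \<psi> c t = 0" "B t * \<psi> c t = 0" "\<psi> c t * A t = 0" "\<psi> c t * B t = 0" using A(1)[of t] by auto
    qed
    fix c c' :: nat and j assume "c \<in> {..M}" "c' \<in> {..M}" "c \<noteq> c'" "j < k"
    then have "\<phi> c (T j) * \<phi> c' (T j) = 0"
      using zero[of c "T j"] zero[of c' "T j"] A(1)[of "T j"] disj unfolding \<phi>_def disjoint_family_fun_def by auto
    then show "\<phi> c (T j) / \<sigma> * (\<phi> c' (T j) / \<sigma>) = 0" by simp
  qed (use lt1 n0 in \<open>auto simp: N_def g_def\<close>)
  also have "ennreal Z * \<dots> = ennreal (sqrt ((1 + n c0) / ((1 + u T) * (1 + v T))))"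
  proof -
    have "Z * ((\<Prod>c<M. sqrt (1 + n c)) * x) = x" for x
    proof -
      have "Z * (\<Prod>c<M. sqrt (1 + n c)) = (\<Prod>c<M. 1 / sqrt (1 + n c) * sqrt (1 + n c))"
        unfolding Z_def by (simp only: prod.distrib)
      also have "\<dots> = 1" using n0 by (intro prod.neutral) (auto simp: add_nonneg_eq_0_iff)
      finally show ?thesis by (simp add: mult.assoc[symmetric])
    qed
    moreover have "0 \<le> (\<Prod>c<M. sqrt (1 + n c)) * sqrt ((1 + n c0) / ((1 + u T) * (1 + v T)))"
      using n0 uv0 by (intro mult_nonneg_nonneg prod_nonneg) auto
    ultimately show ?thesis unfolding N_def[symmetric] val using Z0
      by (simp only: ennreal_mult[symmetric])
  qed
  finally have "obs_affinity \<sigma> M \<psi> \<psi>' k T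
     = ennreal (sqrt ((1 + n c0) / ((1 + u T) * (1 + v T))))" .
  \<comment> \<open>The fraction is y = 1 - u v / ((1 + u) (1 + v)). It lies in [0, 1], hence 1 - u
    v \<le> y \<le> sqrt y.\<close>
  moreover have "1 - u T * v T \<le> sqrt ((1 + n c0) / ((1 + u T) * (1 + v T)))"
  proof -
    let ?y = "(1 + n c0) / ((1 + u T) * (1 + v T))"
    have d: "1 \<le> (1 + u T) * (1 + v T)" using uv0 mult_mono[of 1 "1 + u T" 1 "1 + v T"] by simp
    have y: "?y = 1 - u T * v T / ((1 + u T) * (1 + v T))"
      using d by (simp add: n_c0 field_simps)
    have "u T * v T / ((1 + u T) * (1 + v T)) \<le> u T * v T / 1"
      using d uv0 by (intro divide_left_mono) auto
    moreover have "0 \<le> u T * v T / ((1 + u T) * (1 + v T))" using uv0 by simp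
    moreover have "0 \<le> ?y" using uv0 n0[of c0] by simp
    ultimately have "1 - u T * v T \<le> ?y" "?y \<le> 1" "0 \<le> ?y" unfolding y by linarith+
    moreover have "?y \<le> sqrt ?y"
      by (rule real_le_rsqrt) (use mult_left_le[of ?y ?y] \<open>?y \<le> 1\<close> \<open>0 \<le> ?y\<close> in \<open>simp add: power2_eq_square\<close>)
    ultimately show ?thesis by linarith
  qed
  ultimately show ?thesis by (simp add: ennreal_leI)
qed

lemma gauss_lik_mult_scale:
  assumes w: "0 \<le> w" "0 \<le> w'"
  shows "sqrt (gauss_lik w (x * S) * gauss_lik w' (x' * S)) =
    sqrt (1 / (sqrt (1 + w) * sqrt (1 + w'))) * exp ((x\<^sup>2 / (1 + w) + x'\<^sup>2 / (1 + w')) / 2 * S\<^sup>2 / 2)"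
proof -
  have "2 * ((x\<^sup>2 / (1 + w) + x'\<^sup>2 / (1 + w')) / 2 * S\<^sup>2 / 2) = (x * S)\<^sup>2 / (2 * (1 + w)) + (x' * S)\<^sup>2 / (2 * (1 + w'))"
  proof -
    have "(x\<^sup>2 / a) / 2 * S\<^sup>2 = (x * S)\<^sup>2 / (2 * a)" for x a :: real
      by (simp add: power_mult_distrib)
    note * = this
    have "2 * ((X + X') / 2 * S\<^sup>2 / 2) = X / 2 * S\<^sup>2 + X' / 2 * S\<^sup>2" for X X' :: real
      by (simp add: field_simps)
    then show ?thesis by (simp only: *)
  qed
  then have "(exp ((x\<^sup>2 / (1 + w) + x'\<^sup>2 / (1 + w')) / 2 * S\<^sup>2 / 2))\<^sup>2 = exp ((x * S)\<^sup>2 / (2 * (1 + w))) * exp ((x' * S)\<^sup>2 / (2 * (1 + w')))"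
    by (metis exp_add exp_double)
  moreover have "gauss_lik w (x * S) * gauss_lik w' (x' * S) =
    1 / (sqrt (1 + w) * sqrt (1 + w')) * (exp ((x * S)\<^sup>2 / (2 * (1 + w))) * exp ((x' * S)\<^sup>2 / (2 * (1 + w'))))"
    by (simp add: gauss_lik_def)
  ultimately have "gauss_lik w (x * S) * gauss_lik w' (x' * S) =
    1 / (sqrt (1 + w) * sqrt (1 + w')) * (exp ((x\<^sup>2 / (1 + w) + x'\<^sup>2 / (1 + w')) / 2 * S\<^sup>2 / 2))\<^sup>2"
    by simp
  then show ?thesis by (simp only: real_sqrt_mult real_sqrt_abs abs_exp_cancel)
qed

text \<open>The right side is the square root of r = 2 sqrt(a b) / (a + b), the ratio of geometric
  to arithmetic mean, and the left side is r^2. Since r lies in [0, 1], r^2 \<le> r \<le> sqrt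
  r.\<close>

lemma sqrt_geometric_arithmetic_lower:
  fixes a b :: real
  assumes a: "0 < a" and b: "0 < b"
  shows "1 - ((a - b) / (a + b))\<^sup>2 \<le> sqrt (1 / (sqrt a * sqrt b)) / sqrt ((1 / a + 1 / b) / 2)"
proof -
  have p: "1 - ((a - b) / (a + b))\<^sup>2 = 4 * (a * b) / (a + b)\<^sup>2"
  proof -
    have "(a - b)\<^sup>2 = (a + b)\<^sup>2 - 4 * (a * b)" by (simp add: power2_eq_square algebra_simps)
    then have "((a - b) / (a + b))\<^sup>2 = 1 - 4 * (a * b) / (a + b)\<^sup>2"
      using a b by (simp add: power_divide[of "a - b"] diff_divide_distrib[of "(a + b)\<^sup>2"])
    then show ?thesis by simp
  qed
  define r where "r = 2 * sqrt (a * b) / (a + b)"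
  have r2: "r\<^sup>2 = 1 - ((a - b) / (a + b))\<^sup>2"
    unfolding p r_def using a b by (simp add: power_divide power_mult_distrib)
  have r0: "0 \<le> r" using a b by (simp add: r_def)
  have r1: "r \<le> 1"
    by (rule power2_le_imp_le) (simp_all add: r2)
  have "sqrt (1 / (sqrt a * sqrt b)) / sqrt ((1 / a + 1 / b) / 2) = sqrt ((1 / sqrt (a * b)) / ((1 / a + 1 / b) / 2))"
    by (simp add: real_sqrt_divide real_sqrt_mult)
  also have "(1 / sqrt (a * b)) / ((1 / a + 1 / b) / 2) = r"
  proof -
    define h where "h = sqrt (a * b)"
    have h: "0 < h" "h\<^sup>2 = a * b" using a b by (simp_all add: h_def)
    have "(1 / a + 1 / b) / 2 = (a + b) / (2 * h\<^sup>2)" unfolding h using a b by (simp add: field_simps)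
    then have "(1 / h) / ((1 / a + 1 / b) / 2) = (1 / h) / ((a + b) / (2 * h\<^sup>2))" by (simp only:)
    also have "\<dots> = 2 * h / (a + b)" using h(1) a b by (simp add: power2_eq_square divide_simps)
    finally show ?thesis by (simp add: r_def h_def)
  qed
  finally have e: "sqrt (1 / (sqrt a * sqrt b)) / sqrt ((1 / a + 1 / b) / 2) = sqrt r" .
  have "r\<^sup>2 \<le> r" using r0 r1 mult_left_le[of r r] by (simp add: power2_eq_square)
  moreover have "r \<le> sqrt r" using \<open>r\<^sup>2 \<le> r\<close> by (rule real_le_rsqrt)
  ultimately show ?thesis unfolding e r2[symmetric] by linarith
qed

text \<open>Both models depend on the data through the same sum of errors \<open>S\<close>. The
  affinity involves only the relative difference of 1 + w and 1 + w', and as w' = w (1 + \<delta>)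
  it is at most \<delta> / 2 for every count \<open>k\<close>.\<close>

lemma scale_conditional_affinity:
  fixes k :: nat
  assumes s: "0 < \<sigma>" and d: "0 \<le> \<delta>"
    and sg: "\<And>t. \<psi> 0 t = y" "\<And>t. \<psi>' 0 t = y'" and y: "y\<^sup>2 = x" "y'\<^sup>2 = x * (1 + \<delta>)"
  shows "ennreal (1 - \<delta>\<^sup>2 / 4) \<le>
    obs_affinity \<sigma> 1 \<psi> \<psi>' k T"
proof -
  have x0: "0 \<le> x" using y(1) by (metis zero_le_power2)
  define w where "w = real k * x / \<sigma>\<^sup>2"
  define w' where "w' = real k * (x * (1 + \<delta>)) / \<sigma>\<^sup>2"
  have w0: "0 \<le> w" "0 \<le> w'" using x0 d by (simp_all add: w_def w'_def)
  have ww: "w' = w * (1 + \<delta>)" by (simp add: w_def w'_def)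
  define S where "S e = (\<Sum>j<k. 1 * (e j / \<sigma>))" for e
  have l: "lik_weight \<sigma> \<psi> 0 (obs_of (k, T, e)) = w" "lik_weight \<sigma> \<psi>' 0 (obs_of (k, T, e)) = w'"
    "lik_stat \<sigma> \<psi> 0 (obs_of (k, T, e)) = y / \<sigma> * S e" "lik_stat \<sigma> \<psi>' 0 (obs_of (k, T, e)) = y' / \<sigma> * S e" for e
    by (simp_all add: lik_obs_of power_divide sg y w_def w'_def S_def sum_distrib_left)
  define g where "g = ((y / \<sigma>)\<^sup>2 / (1 + w) + (y' / \<sigma>)\<^sup>2 / (1 + w')) / 2"
  define Z where "Z = sqrt (1 / (sqrt (1 + w) * sqrt (1 + w')))"
  have Z0: "0 \<le> Z" using w0 by (simp add: Z_def)
  have g0: "0 \<le> g" using w0 by (simp add: g_def)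
  have gk: "g * real k = (w / (1 + w) + w' / (1 + w')) / 2"
    unfolding g_def power_divide y w_def w'_def by (simp add: field_simps)
  have one: "1 - g * real k = (1 / (1 + w) + 1 / (1 + w')) / 2"
  proof -
    have "w / (1 + w) = 1 - 1 / (1 + w)" "w' / (1 + w') = 1 - 1 / (1 + w')" using w0 by (simp_all add: field_simps)
    then show ?thesis unfolding gk by (simp only:) (simp add: diff_divide_distrib add_divide_distrib)
  qed
  have pos: "0 < 1 - g * real k"
  proof -
    have "0 < 1 / (1 + w)" "0 < 1 / (1 + w')" using w0 by simp_all
    then have "0 < 1 / (1 + w) + 1 / (1 + w')" by (rule add_pos_pos)
    then show ?thesis unfolding one by (rule half_gt_zero)
  qed
  have "obs_affinity \<sigma> 1 \<psi> \<psi>' k T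
     = (\<integral>\<^sup>+e. ennreal Z * ennreal (exp (\<Sum>c\<in>{0::nat}. g * (\<Sum>j<k. 1 * (e j / \<sigma>))\<^sup>2 / 2)) \<partial>noise_seq \<sigma>)"
  proof (rule nn_integral_cong)
    fix e
    have one: "curve_lik \<sigma> 1 \<phi> x = gauss_lik (lik_weight \<sigma> \<phi> 0 x) (lik_stat \<sigma> \<phi> 0 x)" for \<phi> x
      by (simp add: curve_lik_def)
    have "root_lik \<sigma> 1 \<psi> \<psi>' (obs_of (k, T, e)) = Z * exp (g * (S e)\<^sup>2 / 2)"
      unfolding one l Z_def g_def by (rule gauss_lik_mult_scale[OF w0])
    then show "ennreal (root_lik \<sigma> 1 \<psi> \<psi>' (obs_of (k, T, e))) =
        ennreal Z * ennreal (exp (\<Sum>c\<in>{0::nat}. g * (\<Sum>j<k. 1 * (e j / \<sigma>))\<^sup>2 / 2))"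
      unfolding S_def using Z0 by (simp add: ennreal_mult)
  qed
  also have "\<dots> = ennreal Z * (\<integral>\<^sup>+e. ennreal (exp (\<Sum>c\<in>{0::nat}. g * (\<Sum>j<k. 1 * (e j / \<sigma>))\<^sup>2 / 2)) \<partial>noise_seq \<sigma>)"
    by (rule nn_integral_cmult) measurable
  also have "(\<integral>\<^sup>+e. ennreal (exp (\<Sum>c\<in>{0::nat}. g * (\<Sum>j<k. 1 * (e j / \<sigma>))\<^sup>2 / 2)) \<partial>noise_seq \<sigma>)
     = ennreal (\<Prod>c\<in>{0::nat}. 1 / sqrt (1 - g * (\<Sum>j<k. (1::real)\<^sup>2)))"
    by (rule nn_integral_gauss_seq_exp_squares[OF s, where r="\<lambda>_ _. 1"]) (use g0 pos in auto)
  also have "ennreal Z * \<dots> = ennreal (Z / sqrt (1 - g * real k))"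
    using Z0 pos by (simp add: ennreal_mult[symmetric])
  finally have eq: "obs_affinity \<sigma> 1 \<psi> \<psi>' k T = \<dots>" .
  have "1 - \<delta>\<^sup>2 / 4 \<le> 1 - ((w - w') / (2 + w + w'))\<^sup>2"
  proof -
    have "\<bar>(w - w') / (2 + w + w')\<bar> \<le> \<delta> / 2"
    proof -
      have "\<bar>w - w'\<bar> = \<delta> * w" unfolding ww using w0 d by (simp add: algebra_simps)
      moreover have "\<delta> * (2 * w) \<le> \<delta> * (2 + w + w')" using d w0 unfolding ww by (intro mult_left_mono) (auto simp: algebra_simps)
      ultimately show ?thesis using w0 by (simp add: field_simps)
    qed
    then have "((w - w') / (2 + w + w'))\<^sup>2 \<le> (\<delta> / 2)\<^sup>2"
      by (subst abs_le_square_iff[symmetric]) (use d in simp)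
    then show ?thesis by (simp add: power_divide)
  qed
  also have "\<dots> \<le> Z / sqrt (1 - g * real k)"
    using sqrt_geometric_arithmetic_lower[of "1 + w" "1 + w'"] w0 unfolding Z_def one
    by (simp add: add.assoc)
  finally show ?thesis unfolding eq by (rule ennreal_leI)
qed

text \<open>Expanding the product into pairs of indices, the diagonal vanishes because
  \<open>f\<close> and \<open>g\<close> have disjoint supports. Each of the remaining k (k - 1)
  ordered pairs has independent times and costs at most \<alpha>^2.\<close>

lemma nn_integral_pair_count:
  fixes k :: nat
  assumes D: "prob_space D"
    and [measurable]: "f \<in> borel_measurable D" "g \<in> borel_measurable D"
    and fg: "\<And>t. f t * g t = 0" "\<And>t. 0 \<le> f t" "\<And>t. 0 \<le> g t"
    and I: "(\<integral>\<^sup>+t. ennreal (f t) \<partial>D) \<le> ennreal \<alpha>" "(\<integral>\<^sup>+t. ennreal (g t) \<partial>D) \<le> ennreal \<alpha>" and a: "0 \<le> \<alpha>"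
  shows "(\<integral>\<^sup>+T. ennreal ((\<Sum>j<k. f (T j)) * (\<Sum>j<k. g (T j))) \<partial>PiM UNIV (\<lambda>_. D)) \<le> ennreal (real k * (real k - 1) * \<alpha>\<^sup>2)"
proof -
  have pair: "(\<integral>\<^sup>+T. ennreal (f (T i) * g (T j)) \<partial>PiM UNIV (\<lambda>_. D)) \<le> ennreal (if i = j then 0 else \<alpha>\<^sup>2)" for i j :: nat
  proof (cases "i = j")
    case False
    have "(\<integral>\<^sup>+T. ennreal (f (T i) * g (T j)) \<partial>PiM UNIV (\<lambda>_. D)) = (\<integral>\<^sup>+T. (\<Prod>l\<in>{i, j}. ennreal (if l = i then f (T l) else g (T l))) \<partial>PiM UNIV (\<lambda>_. D))"
      using False fg by (simp add: ennreal_mult)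
    also have "\<dots> = (\<Prod>l\<in>{i, j}. \<integral>\<^sup>+t. ennreal (if l = i then f t else g t) \<partial>D)"
      by (rule nn_integral_PiM_prod) (use D in auto)
    also have "\<dots> \<le> ennreal \<alpha> * ennreal \<alpha>"
      using False I by (simp add: mult_mono)
    finally show ?thesis using False a by (simp add: ennreal_mult[symmetric] power2_eq_square)
  qed (simp add: fg)
  have "(\<integral>\<^sup>+T. ennreal ((\<Sum>j<k. f (T j)) * (\<Sum>j<k. g (T j))) \<partial>PiM UNIV (\<lambda>_. D))
     = (\<integral>\<^sup>+T. (\<Sum>i<k. \<Sum>j<k. ennreal (f (T i) * g (T j))) \<partial>PiM UNIV (\<lambda>_. D))"
    using fg by (simp add: sum_product sum_nonneg)
  also have "\<dots> = (\<Sum>i<k. \<Sum>j<k. \<integral>\<^sup>+T. ennreal (f (T i) * g (T j)) \<partial>PiM UNIV (\<lambda>_. D))"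
    by (simp add: nn_integral_sum)
  also have "\<dots> \<le> (\<Sum>i<k. \<Sum>j<k. ennreal (if i = j then 0 else \<alpha>\<^sup>2))"
    by (intro sum_mono pair)
  also have "\<dots> = ennreal (\<Sum>i<k. \<Sum>j<k. if i = j then 0 else \<alpha>\<^sup>2)"
    by (simp add: sum_nonneg)
  also have "(\<Sum>i<k. \<Sum>j<k. if i = j then 0 else \<alpha>\<^sup>2) = real k * (real k - 1) * \<alpha>\<^sup>2"
  proof -
    have "(\<Sum>j<k. if i = j then 0 else \<alpha>\<^sup>2) = (real k - 1) * \<alpha>\<^sup>2" if "i < k" for i
    proof -
      have "(\<Sum>j<k. if i = j then 0 else \<alpha>\<^sup>2) = (\<Sum>j<k. \<alpha>\<^sup>2 - (if j = i then \<alpha>\<^sup>2 else 0))"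
        by (intro sum.cong) auto
      then show ?thesis using that by (simp add: sum_subtractf algebra_simps)
    qed
    then show ?thesis by simp
  qed
  finally show ?thesis .
qed

lemma nn_integral_null_law_affinity:
  assumes D: "prob_space (design_law P)" and s: "0 < \<sigma>"
    and [measurable]: "\<And>c. \<psi> c \<in> borel_measurable borel" "\<And>c. \<psi>' c \<in> borel_measurable borel"
  shows "affinity P \<sigma> M \<psi> \<psi>' =
    (\<integral>\<^sup>+k. \<integral>\<^sup>+T. \<integral>\<^sup>+e. ennreal (root_lik \<sigma> M \<psi> \<psi>' (obs_of (k, T, e)))
       \<partial>noise_seq \<sigma> \<partial>times_seq P \<partial>measure_pmf (counts P))"
  unfolding null_law_def
  by (subst nn_integral_distr) (auto intro!: nn_integral_null_space[OF D s])

lemma scale_affinity: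
  assumes D: "prob_space (design_law P)" and s: "0 < \<sigma>" and d: "0 \<le> \<delta>"
    and \<psi>: "\<And>c t. \<psi> c t = y" "\<And>c t. \<psi>' c t = y'" "y'\<^sup>2 = y\<^sup>2 * (1 + \<delta>)"
  shows "ennreal (1 - \<delta>\<^sup>2 / 4) \<le> affinity P \<sigma> 1 \<psi> \<psi>'"
proof -
  have fn: "\<psi> = (\<lambda>_ _. y)" "\<psi>' = (\<lambda>_ _. y')" using \<psi> by (auto simp: fun_eq_iff)
  interpret T: prob_space "times_seq P" by (rule prob_space_design_seq[OF D])
  have "ennreal (1 - \<delta>\<^sup>2 / 4) = (\<integral>\<^sup>+k. \<integral>\<^sup>+T. ennreal (1 - \<delta>\<^sup>2 / 4) \<partial>times_seq P \<partial>measure_pmf (counts P))"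
    by (simp add: T.emeasure_space_1 measure_pmf.emeasure_space_1)
  also have "\<dots> \<le> affinity P \<sigma> 1 \<psi> \<psi>'"
  proof (subst nn_integral_null_law_affinity[OF D s])
    show "\<psi> c \<in> borel_measurable borel" "\<psi>' c \<in> borel_measurable borel" for c by (simp_all add: fn)
  qed (intro nn_integral_mono scale_conditional_affinity[OF s d, of _ y _ y' "y\<^sup>2"]; simp add: \<psi>)
  finally show ?thesis .
qed

text \<open>\<open>flip_conditional_affinity\<close> averaged over times and counts; disjoint halves
  turn the expectation of u v into a count of pairs.\<close>

lemma flip_affinity:
  assumes D: "prob_space (design_law P)" and s: "0 < \<sigma>" and c0: "c0 < M"
    and m[measurable]: "\<And>c. \<psi> c \<in> borel_measurable borel" "\<And>c. \<psi>' c \<in> borel_measurable borel"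
      "A \<in> borel_measurable borel" "B \<in> borel_measurable borel"
    and disj: "disjoint_family_fun M \<psi>"
    and A: "\<And>t. A t * B t = 0" "\<And>t. \<psi> c0 t = A t + B t" "\<And>t. \<psi>' c0 t = A t - B t"
    and same: "\<And>c. c \<noteq> c0 \<Longrightarrow> \<psi>' c = \<psi> c"
    and I: "(\<integral>\<^sup>+t. ennreal ((A t / \<sigma>)\<^sup>2) \<partial>design_law P) \<le> ennreal \<alpha>"
      "(\<integral>\<^sup>+t. ennreal ((B t / \<sigma>)\<^sup>2) \<partial>design_law P) \<le> ennreal \<alpha>" and a: "0 \<le> \<alpha>"
    and int: "integrable (measure_pmf (counts P)) (\<lambda>k. real k * (real k - 1))"
  shows "ennreal (1 - measure_pmf.expectation (counts P) (\<lambda>k. real k * (real k - 1)) * \<alpha>\<^sup>2)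
    \<le> affinity P \<sigma> M \<psi> \<psi>'"
proof -
  let ?T = "times_seq P" and ?p = "measure_pmf (counts P)"
  interpret T: prob_space ?T by (rule prob_space_design_seq[OF D])
  define u where "u k T = (\<Sum>j<k. (A (T j) / \<sigma>)\<^sup>2)" for k :: nat and T
  define v where "v k T = (\<Sum>j<k. (B (T j) / \<sigma>)\<^sup>2)" for k :: nat and T
  define E where "E = measure_pmf.expectation (counts P) (\<lambda>k. real k * (real k - 1)) * \<alpha>\<^sup>2"
  define aff where "aff = affinity P \<sigma> M \<psi> \<psi>'"
  have mD: "f \<in> borel_measurable borel \<Longrightarrow> f \<in> borel_measurable (design_law P)" for f :: "real \<Rightarrow> real"
    unfolding design_law_def by (simp add: measurable_compose[OF measurable_circle_ident])
  have kk: "0 \<le> real k * (real k - 1)" for k :: nat by (cases k) auto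
  have E0: "0 \<le> E" unfolding E_def by (intro mult_nonneg_nonneg Bochner_Integration.integral_nonneg kk) auto
  have uv0: "0 \<le> u k T" "0 \<le> v k T" for k T by (simp_all add: u_def v_def sum_nonneg)
  have muv: "(\<lambda>T. ennreal (1 - u k T * v k T)) \<in> borel_measurable ?T" "(\<lambda>T. ennreal (u k T * v k T)) \<in> borel_measurable ?T" for k
    unfolding u_def v_def by (rule measurable_design_seq, measurable)+
  \<comment> \<open>Since \<open>ennreal\<close> truncates 1 - u v at 0, integrals are not
    subtracted. Instead 1 is bounded by the sum of the truncated difference and u v, and the second
    integral is moved across at the end.\<close>
  have "(1::ennreal) = (\<integral>\<^sup>+k. \<integral>\<^sup>+T. 1 \<partial>?T \<partial>?p)"
    by (simp add: T.emeasure_space_1 measure_pmf.emeasure_space_1)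
  also have "\<dots> \<le> (\<integral>\<^sup>+k. \<integral>\<^sup>+T. ennreal (1 - u k T * v k T) + ennreal (u k T * v k T) \<partial>?T \<partial>?p)"
  proof (intro nn_integral_mono)
    fix k T
    show "1 \<le> ennreal (1 - u k T * v k T) + ennreal (u k T * v k T)"
    proof (cases "u k T * v k T \<le> 1")
      case True
      then show ?thesis using uv0[of k T] by (simp add: ennreal_plus[symmetric] del: ennreal_plus)
    next
      case False
      then have "ennreal 1 \<le> ennreal (u k T * v k T)" by (intro ennreal_leI) simp
      then show ?thesis by (simp add: add_increasing)
    qed
  qed
  also have "\<dots> = (\<integral>\<^sup>+k. \<integral>\<^sup>+T. ennreal (1 - u k T * v k T) \<partial>?T \<partial>?p) + (\<integral>\<^sup>+k. \<integral>\<^sup>+T. ennreal (u k T * v k T) \<partial>?T \<partial>?p)"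
    by (simp add: nn_integral_add muv)
  also have "(\<integral>\<^sup>+k. \<integral>\<^sup>+T. ennreal (1 - u k T * v k T) \<partial>?T \<partial>?p) \<le> aff"
    unfolding aff_def nn_integral_null_law_affinity[OF D s m(1,2)] u_def v_def
    by (intro nn_integral_mono flip_conditional_affinity[OF s c0 disj A same])
  also have "(\<integral>\<^sup>+k. \<integral>\<^sup>+T. ennreal (u k T * v k T) \<partial>?T \<partial>?p) \<le> (\<integral>\<^sup>+k. ennreal (real k * (real k - 1) * \<alpha>\<^sup>2) \<partial>?p)"
    unfolding u_def v_def
    by (intro nn_integral_mono nn_integral_pair_count[OF D _ _ _ _ _ I a])
       (use A(1) in \<open>auto intro!: mD\<close>)
  also have "\<dots> = ennreal E"
    unfolding E_def using int kk by (subst nn_integral_eq_integral) auto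
  finally have "1 \<le> aff + ennreal E" by (simp add: add_mono)
  then have "ennreal 1 - ennreal E \<le> aff"
    by (simp add: ennreal_minus_le_iff add.commute)
  then show ?thesis using ennreal_minus[OF E0, of 1] unfolding aff_def E_def by simp
qed

section \<open>Finite-rank models in the class\<close>

text \<open>For every real p, y \<le> exp y at y = x^2 / (2 p \<sigma>^2) gives |x|^p \<le> (2 p
  \<sigma>^2)^(p/2) exp(x^2 / (4 \<sigma>^2)), and the Gaussian mean of the last factor is sqrt 2.
  Its p-th root is at most sqrt 2, which with the other sqrt 2 makes the 2 in the
  hypothesis.\<close>

lemma subgaussian_normal:
  assumes U: "distributed M lborel U (normal_density 0 \<sigma>)" and s: "0 < \<sigma>" and K: "2 * \<sigma> \<le> K"
  shows "subgaussian K M U"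
  unfolding subgaussian_def
proof (intro conjI allI impI)
  have [measurable]: "U \<in> borel_measurable M" using distributed_measurable[OF U] by simp
  then show "U \<in> borel_measurable M" .
  have law: "distr M lborel U = gauss \<sigma>"
    using distributed_distr_eq_density[OF U] by (simp add: gauss_def)
  fix p :: real assume p: "1 \<le> p"
  define C where "C = (2 * p * \<sigma>\<^sup>2) powr (p / 2)"
  have C0: "0 \<le> C" by (simp add: C_def)
  have bound: "\<bar>x\<bar> powr p \<le> C * exp (0 * (x / \<sigma>) - (- (1 / 2)) * (x / \<sigma>)\<^sup>2 / 2)" for x
  proof (cases "x = 0")
    case False
    define y where "y = x\<^sup>2 / (2 * p * \<sigma>\<^sup>2)"
    have y: "0 < y" using False p s by (simp add: y_def)
    have x2: "x\<^sup>2 = 2 * p * \<sigma>\<^sup>2 * y" using p s by (simp add: y_def)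
    have "\<bar>x\<bar> powr p = (x\<^sup>2) powr (p / 2)"
    proof -
      have "x\<^sup>2 = \<bar>x\<bar> powr 2" using False by simp
      then have "(x\<^sup>2) powr (p / 2) = \<bar>x\<bar> powr (2 * (p / 2))" by (simp only: powr_powr)
      then show ?thesis by simp
    qed
    also have "\<dots> = C * y powr (p / 2)"
      unfolding x2 C_def using p s y by (simp add: powr_mult)
    also have "\<dots> \<le> C * exp y powr (p / 2)"
    proof -
      have "y \<le> exp y" using exp_ge_add_one_self[of y] by linarith
      then show ?thesis using y p C0 by (intro mult_left_mono powr_mono2) auto
    qed
    also have "exp y powr (p / 2) = exp (0 * (x / \<sigma>) - (- (1 / 2)) * (x / \<sigma>)\<^sup>2 / 2)"
      using p s by (simp add: powr_def y_def power_divide)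
    finally show ?thesis .
  qed (use C0 in simp)
  have "(\<integral>\<^sup>+w. ennreal (\<bar>U w\<bar> powr p) \<partial>M) = (\<integral>\<^sup>+x. ennreal (\<bar>x\<bar> powr p) \<partial>gauss \<sigma>)"
    unfolding law[symmetric] by (subst nn_integral_distr) auto
  also have "\<dots> \<le> (\<integral>\<^sup>+x. ennreal C * ennreal (exp (0 * (x / \<sigma>) - (- (1 / 2)) * (x / \<sigma>)\<^sup>2 / 2)) \<partial>gauss \<sigma>)"
    using bound C0 by (intro nn_integral_mono) (simp add: ennreal_mult[symmetric] ennreal_leI del: ennreal_mult)
  also have "\<dots> = ennreal C * ennreal (gauss_lik (- (1 / 2)) 0)"
    by (subst nn_integral_cmult, measurable) (subst nn_integral_gauss_exp[OF s], simp_all)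
  also have "\<dots> = ennreal (C * sqrt 2)"
    using C0 by (simp add: gauss_lik_def real_sqrt_divide ennreal_mult[symmetric])
  finally have nn: "(\<integral>\<^sup>+w. ennreal (\<bar>U w\<bar> powr p) \<partial>M) \<le> ennreal (C * sqrt 2)" .
  then have "(\<integral>\<^sup>+w. ennreal (\<bar>U w\<bar> powr p) \<partial>M) < \<infinity>"
    by (rule le_less_trans) simp
  then show int: "integrable M (\<lambda>w. \<bar>U w\<bar> powr p)"
    by (intro integrableI_nonneg) auto
  have "(\<integral>w. \<bar>U w\<bar> powr p \<partial>M) \<le> C * sqrt 2"
    using nn C0 by (subst (asm) nn_integral_eq_integral[OF int]) auto
  then have "(\<integral>w. \<bar>U w\<bar> powr p \<partial>M) powr (1 / p) \<le> (C * sqrt 2) powr (1 / p)"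
    using p by (intro powr_mono2 integral_nonneg) auto
  also have "\<dots> = sqrt (2 * p * \<sigma>\<^sup>2) * sqrt 2 powr (1 / p)"
  proof -
    have "C powr (1 / p) = (2 * p * \<sigma>\<^sup>2) powr (1 / 2)"
      unfolding C_def powr_powr using p by simp
    also have "\<dots> = sqrt (2 * p * \<sigma>\<^sup>2)"
      using p by (intro powr_half_sqrt) simp
    finally show ?thesis using C0 by (subst powr_mult) auto
  qed
  also have "\<dots> \<le> sqrt (2 * p * \<sigma>\<^sup>2) * sqrt 2 powr 1"
    using p by (intro mult_left_mono powr_mono) auto
  also have "\<dots> = 2 * \<sigma> * sqrt p"
    using s p by (simp add: real_sqrt_mult)
  also have "\<dots> \<le> K * sqrt p"
    using K p by (intro mult_right_mono) auto
  finally show "(\<integral>w. \<bar>U w\<bar> powr p \<partial>M) powr (1 / p) \<le> K * sqrt p" .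
qed

section \<open>Linear functionals of a Gaussian vector\<close>

definition gauss_comb :: "nat \<Rightarrow> (nat \<Rightarrow> real) \<Rightarrow> (nat \<Rightarrow> real) \<Rightarrow> real" where
  "gauss_comb M b w = (\<Sum>c<M. w c * b c)"

abbreviation sum_sq :: "nat \<Rightarrow> (nat \<Rightarrow> real) \<Rightarrow> real" where
  "sum_sq M b \<equiv> \<Sum>c<M. (b c)\<^sup>2"

lemma prob_space_gauss_vec: "prob_space (gauss_vec M)"
  by (rule prob_space_PiM) (rule prob_space_gauss, simp)

lemma measurable_gauss_comb [measurable]: "gauss_comb M b \<in> borel_measurable (gauss_vec M)"
  unfolding gauss_comb_def[abs_def] by measurable

lemma gauss_comb_distributed:
  assumes "\<exists>c<M. b c \<noteq> 0"
  shows "distributed (gauss_vec M) lborel (gauss_comb M b) (normal_density 0 (sqrt (sum_sq M b)))"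
proof -
  interpret Q: prob_space "gauss_vec M" by (rule prob_space_gauss_vec)
  \<comment> \<open>Zero coefficients are dropped: the theorem on sums of independent normals
    requires positive deviations.\<close>
  define I where "I = {c. c < M \<and> b c \<noteq> 0}"
  have I: "finite I" "I \<noteq> {}" "I \<subseteq> {..<M}" using assms by (auto simp: I_def)
  have comp: "distr (gauss_vec M) (gauss 1) (\<lambda>w. w c) = gauss 1" if "c < M" for c
    using that by (intro distr_PiM_component) (auto intro: prob_space_gauss)
  have coord: "distributed (gauss_vec M) lborel (\<lambda>w. w c) (normal_density 0 1)" if "c < M" for c
  proof -
    have "distr (gauss_vec M) lborel (\<lambda>w. w c) = distr (gauss_vec M) (gauss 1) (\<lambda>w. w c)"
      by (rule distr_cong) auto
    then show ?thesis
      using that comp[OF that] by (auto simp: distributed_def gauss_def)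
  qed
  have each: "distributed (gauss_vec M) lborel (\<lambda>w. w c * b c) (normal_density 0 \<bar>b c\<bar>)" if "c \<in> I" for c
    using Q.normal_density_affine[OF coord[of c], of "b c" 0] that by (simp add: I_def mult.commute)
  have scaled: "distr (gauss_vec M) borel (\<lambda>w. w c * b c) = distr (gauss 1) borel (\<lambda>x. x * b c)" if "c < M" for c
    using that by (subst comp[OF that, symmetric]) (simp add: distr_distr comp_def)
  have "Q.indep_vars (\<lambda>_. borel) (\<lambda>c w. w c * b c) {..<M}"
  proof (subst Q.indep_vars_iff_distr_eq_PiM')
    show "{..<M} \<noteq> {}" using assms by auto
    have "distr (gauss_vec M) (PiM {..<M} (\<lambda>_. borel)) (\<lambda>w. \<lambda>c\<in>{..<M}. w c * b c)
       = PiM {..<M} (\<lambda>c. distr (gauss 1) borel (\<lambda>x. x * b c))"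
      by (rule distr_PiM_componentwise) (auto intro: prob_space_gauss)
    also have "\<dots> = PiM {..<M} (\<lambda>c. distr (gauss_vec M) borel (\<lambda>w. w c * b c))"
      by (intro PiM_cong) (auto simp: scaled)
    finally show "distr (gauss_vec M) (PiM {..<M} (\<lambda>_. borel)) (\<lambda>w. \<lambda>c\<in>{..<M}. w c * b c) = \<dots>" .
  qed auto
  then have "Q.indep_vars (\<lambda>_. borel) (\<lambda>c w. w c * b c) I"
    by (rule Q.indep_vars_subset) (rule I)
  from Q.sum_indep_normal[OF I(1,2) this, of "\<lambda>c. \<bar>b c\<bar>" "\<lambda>_. 0"]
  have "distributed (gauss_vec M) lborel (\<lambda>w. \<Sum>c\<in>I. w c * b c) (normal_density 0 (sqrt (\<Sum>c\<in>I. (b c)\<^sup>2)))"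
    using each by (simp add: I_def)
  moreover have "(\<lambda>w. \<Sum>c\<in>I. w c * b c) = gauss_comb M b"
    unfolding gauss_comb_def[abs_def] by (intro ext sum.mono_neutral_left) (auto simp: I_def)
  moreover have "(\<Sum>c\<in>I. (b c)\<^sup>2) = sum_sq M b"
    by (intro sum.mono_neutral_left) (auto simp: I_def)
  ultimately show ?thesis by simp
qed

lemma gauss_comb_cases:
  obtains "\<And>w. gauss_comb M b w = 0" "sum_sq M b = 0"
  | "0 < sum_sq M b" "distributed (gauss_vec M) lborel (gauss_comb M b) (normal_density 0 (sqrt (sum_sq M b)))"
proof (cases "\<exists>c<M. b c \<noteq> 0")
  case True
  then obtain c where c: "c < M" "b c \<noteq> 0" by auto
  have "(b c)\<^sup>2 \<le> sum_sq M b" using c by (intro member_le_sum) auto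
  moreover have "0 < (b c)\<^sup>2" using c by simp
  ultimately have "0 < sum_sq M b" by linarith
  then show ?thesis using gauss_comb_distributed[OF True] that(2) by blast
next
  case False
  then show ?thesis by (intro that(1)) (auto simp: gauss_comb_def)
qed

lemma centred_normal_gauss_comb: "centred_normal (gauss_vec M) (gauss_comb M b)"
  by (rule gauss_comb_cases[of M b]) (auto simp: centred_normal_def intro!: exI[of _ "sqrt (sum_sq M b)"])

lemma subgaussian_gauss_comb:
  assumes "4 * sum_sq M b \<le> K\<^sup>2" and K: "0 < K"
  shows "subgaussian K (gauss_vec M) (gauss_comb M b)"
proof (rule gauss_comb_cases[of M b])
  assume z: "\<And>w. gauss_comb M b w = 0"
  show ?thesis unfolding subgaussian_def z using K by auto
next
  assume p: "0 < sum_sq M b"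
    and d: "distributed (gauss_vec M) lborel (gauss_comb M b) (normal_density 0 (sqrt (sum_sq M b)))"
  have "2 * sqrt (sum_sq M b) = sqrt (4 * sum_sq M b)" by (simp add: real_sqrt_mult)
  also have "\<dots> \<le> K" using assms by (intro real_le_lsqrt) (auto simp: sum_nonneg)
  finally show ?thesis using p by (intro subgaussian_normal[OF d]) auto
qed

lemma gauss_comb_moments:
  "integrable (gauss_vec M) (gauss_comb M b)" "(\<integral>w. gauss_comb M b w \<partial>gauss_vec M) = 0"
  "integrable (gauss_vec M) (\<lambda>w. (gauss_comb M b w)\<^sup>2)" "(\<integral>w. (gauss_comb M b w)\<^sup>2 \<partial>gauss_vec M) = sum_sq M b"
proof -
  let ?v = "\<Sum>c<M. (b c)\<^sup>2"
  have "integrable (gauss_vec M) (gauss_comb M b) \<and> (\<integral>w. gauss_comb M b w \<partial>gauss_vec M) = 0 \<and>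
    integrable (gauss_vec M) (\<lambda>w. (gauss_comb M b w)\<^sup>2) \<and> (\<integral>w. (gauss_comb M b w)\<^sup>2 \<partial>gauss_vec M) = ?v"
  proof (rule gauss_comb_cases[of M b])
    assume z: "\<And>w. gauss_comb M b w = 0" "?v = 0"
    show ?thesis unfolding z by simp
  next
    assume p: "0 < ?v" and d: "distributed (gauss_vec M) lborel (gauss_comb M b) (normal_density 0 (sqrt ?v))"
    have "integrable (gauss_vec M) (\<lambda>w. gauss_comb M b w)"
      using distributed_integrable[OF d, of "\<lambda>x. x"] integrable_normal_moment[of "sqrt ?v" 0 1] p by simp
    moreover have "integrable (gauss_vec M) (\<lambda>w. (gauss_comb M b w)\<^sup>2)"
      using distributed_integrable[OF d, of "\<lambda>x. x\<^sup>2"] integrable_normal_moment[of "sqrt ?v" 0 2] p by simp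
    moreover have "(\<integral>w. gauss_comb M b w \<partial>gauss_vec M) = 0"
      using distributed_integral[OF d, of "\<lambda>x. x"] integral_normal_moment_odd[of "sqrt ?v" 0 0] p by simp
    moreover have "(\<integral>w. (gauss_comb M b w)\<^sup>2 \<partial>gauss_vec M) = ?v"
      using distributed_integral[OF d, of "\<lambda>x. x\<^sup>2"] integral_normal_moment_even[of "sqrt ?v" 0 1] p by simp
    ultimately show ?thesis by simp
  qed
  then show "integrable (gauss_vec M) (gauss_comb M b)" "(\<integral>w. gauss_comb M b w \<partial>gauss_vec M) = 0"
    "integrable (gauss_vec M) (\<lambda>w. (gauss_comb M b w)\<^sup>2)" "(\<integral>w. (gauss_comb M b w)\<^sup>2 \<partial>gauss_vec M) = ?v" by auto
qed

text \<open>Polarisation reduces the covariance to the variances of sum and difference.\<close>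

lemma gauss_comb_covariance:
  "(\<integral>w. gauss_comb M b w * gauss_comb M b' w \<partial>gauss_vec M) = (\<Sum>c<M. b c * b' c)"
proof -
  let ?p = "\<lambda>c. b c + b' c" and ?m = "\<lambda>c. b c - b' c"
  have "gauss_comb M b w * gauss_comb M b' w = ((gauss_comb M ?p w)\<^sup>2 - (gauss_comb M ?m w)\<^sup>2) / 4" for w
  proof -
    have pm: "gauss_comb M ?p w = gauss_comb M b w + gauss_comb M b' w" "gauss_comb M ?m w = gauss_comb M b w - gauss_comb M b' w"
      by (simp_all add: gauss_comb_def distrib_left right_diff_distrib sum.distrib sum_subtractf)
    show ?thesis unfolding pm by (simp add: power2_eq_square algebra_simps)
  qed
  then have "(\<integral>w. gauss_comb M b w * gauss_comb M b' w \<partial>gauss_vec M)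
    = (\<integral>w. ((gauss_comb M ?p w)\<^sup>2 - (gauss_comb M ?m w)\<^sup>2) / 4 \<partial>gauss_vec M)"
    by (rule Bochner_Integration.integral_cong[OF refl])
  also have "\<dots> = ((\<Sum>c<M. (?p c)\<^sup>2) - (\<Sum>c<M. (?m c)\<^sup>2)) / 4"
    by (simp add: gauss_comb_moments)
  also have "\<dots> = (\<Sum>c<M. b c * b' c)"
    by (simp add: sum_subtractf[symmetric] sum_divide_distrib power2_eq_square algebra_simps)
  finally show ?thesis .
qed

lemma cov_fun_rank_model: "cov_fun (rank_model P \<sigma> M \<psi>) s t = (\<Sum>c<M. \<psi> c s * \<psi> c t)"
proof -
  have "cov_fun (rank_model P \<sigma> M \<psi>) s t = (\<integral>w. gauss_comb M (\<lambda>c. \<psi> c s) w * gauss_comb M (\<lambda>c. \<psi> c t) w \<partial>gauss_vec M)"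
    unfolding cov_fun_def Let_def rank_model_simps gauss_comb_def[symmetric] gauss_comb_moments(2) by simp
  then show ?thesis by (simp add: gauss_comb_covariance)
qed

lemma finite_measure_circle: "finite_measure circle"
  by (rule finite_measureI) (simp add: circle_def space_restrict_space emeasure_restrict_space)

text \<open>Point values of the curve and its integrals against \<open>g\<close> are linear in the
  finitely many amplitudes, so both Gaussianity clauses reduce to
  \<open>centred_normal_gauss_comb\<close>.\<close>

lemma gaussian_curve_rank_model:
  assumes [measurable]: "\<And>c. \<psi> c \<in> borel_measurable borel"
    and per: "\<And>c t. \<psi> c (t + 1) = \<psi> c t"
    and bdd: "\<And>c t. \<bar>\<psi> c t\<bar> \<le> L"
  shows "gaussian_curve (rank_model P \<sigma> M \<psi>)"
proof -
  interpret C: finite_measure circle by (rule finite_measure_circle)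
  have mc: "f \<in> borel_measurable borel \<Longrightarrow> f \<in> borel_measurable circle" for f :: "real \<Rightarrow> real"
    by (rule measurable_compose[OF measurable_circle_ident])
  have curve: "integrable circle (\<lambda>t. (\<Sum>c<M. w c * \<psi> c t)\<^sup>2)" for w
  proof (rule C.integrable_const_bound)
    show "(\<lambda>t. (\<Sum>c<M. w c * \<psi> c t)\<^sup>2) \<in> borel_measurable circle" by (rule mc) measurable
    have "\<bar>\<Sum>c<M. w c * \<psi> c t\<bar> \<le> (\<Sum>c<M. \<bar>w c\<bar> * L)" for t
      by (rule order_trans[OF sum_abs]) (auto simp: abs_mult intro!: sum_mono mult_left_mono bdd)
    then have "(\<Sum>c<M. w c * \<psi> c t)\<^sup>2 \<le> (\<Sum>c<M. \<bar>w c\<bar> * L)\<^sup>2" for t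
      by (metis abs_ge_zero power2_abs power_mono)
    then show "AE t in circle. norm ((\<Sum>c<M. w c * \<psi> c t)\<^sup>2) \<le> (\<Sum>c<M. \<bar>w c\<bar> * L)\<^sup>2" by simp
  qed
  have lin: "centred_normal (gauss_vec M) (\<lambda>w. \<integral>t. (\<Sum>c<M. w c * \<psi> c t) * g t \<partial>circle)"
    if g[measurable]: "g \<in> borel_measurable circle" and g2: "integrable circle (\<lambda>t. (g t)\<^sup>2)" for g
  proof -
    have g1: "integrable circle g"
      by (rule C.square_integrable_imp_integrable) (auto simp: g2)
    have \<psi>g: "integrable circle (\<lambda>t. \<psi> c t * g t)" for c
    proof (rule Bochner_Integration.integrable_bound[OF integrable_mult_right[OF integrable_norm[OF g1], of "L"]])
      show "(\<lambda>t. \<psi> c t * g t) \<in> borel_measurable circle"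
        by (intro borel_measurable_times mc g) measurable
      show "AE t in circle. norm (\<psi> c t * g t) \<le> norm (L * norm (g t))"
        using bdd by (auto simp: abs_mult intro!: AE_I2 mult_mono order_trans[OF bdd])
    qed
    have "(\<integral>t. (\<Sum>c<M. w c * \<psi> c t) * g t \<partial>circle) = gauss_comb M (\<lambda>c. \<integral>t. \<psi> c t * g t \<partial>circle) w" for w
      unfolding gauss_comb_def sum_distrib_right mult.assoc
      by (subst Bochner_Integration.integral_sum) (auto intro: \<psi>g)
    then show ?thesis using centred_normal_gauss_comb by simp
  qed
  have fin: "centred_normal (gauss_vec M) (\<lambda>w. \<Sum>t\<in>S. a t * (\<Sum>c<M. w c * \<psi> c t))" for S a
  proof -
    have "(\<Sum>t\<in>S. a t * (\<Sum>c<M. w c * \<psi> c t)) = gauss_comb M (\<lambda>c. \<Sum>t\<in>S. a t * \<psi> c t) w" for w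
      unfolding gauss_comb_def sum_distrib_left by (subst sum.swap) (simp add: mult_ac)
    then show ?thesis using centred_normal_gauss_comb by simp
  qed
  show ?thesis
    unfolding gaussian_curve_def Let_def rank_model_simps
  proof (intro conjI ballI allI impI)
    show "case_prod (\<lambda>w t. \<Sum>c<M. w c * \<psi> c t) \<in> borel_measurable (gauss_vec M \<Otimes>\<^sub>M borel)"
      by measurable
  qed (auto intro: prob_space_gauss_vec curve lin fin simp: periodic1_def per)
qed

text \<open>Design and counts are inherited from \<open>P\<close>. The noise level
  \<open>subg B / 2\<close> is the largest that \<open>subgaussian_normal\<close> admits, and the
  factor 4 in the variance bound is the same 2, squared.\<close>

lemma rank_model_in_class:
  assumes P: "P \<in> model_class B \<Q> \<beta> R m q" and K: "0 < subg B"
    and \<psi>: "\<And>c. \<psi> c \<in> borel_measurable borel" "\<And>c t. \<psi> c (t + 1) = \<psi> c t" "\<And>c t. \<bar>\<psi> c t\<bar> \<le> L"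
    and v: "\<And>t. 4 * (\<Sum>c<M. (\<psi> c t)\<^sup>2) \<le> (subg B)\<^sup>2"
    and inv: "\<And>s t. (\<Sum>c<M. \<psi> c (s + 1 / real q) * \<psi> c (t + 1 / real q)) = (\<Sum>c<M. \<psi> c s * \<psi> c t)"
    and hoelder: "hoelder_norm \<beta> (\<lambda>(s, t). \<Sum>c<M. \<psi> c s * \<psi> c t) \<le> ennreal R"
  shows "rank_model P (subg B / 2) M \<psi> \<in> model_class B \<Q> \<beta> R m q"
proof -
  have cov: "cov_fun (rank_model P (subg B / 2) M \<psi>) = (\<lambda>s t. \<Sum>c<M. \<psi> c s * \<psi> c t)"
    by (intro ext) (rule cov_fun_rank_model)
  have s: "0 < subg B / 2" using K by simp
  have law: "distributed (gauss (subg B / 2)) lborel (\<lambda>x. x) (normal_density 0 (subg B / 2))"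
    unfolding distributed_def by (auto simp: gauss_def intro!: distr_id2)
  have mean: "(\<integral>x. x \<partial>gauss (subg B / 2)) = 0"
    using distributed_integral[OF law, of "\<lambda>x. x"] integral_normal_moment_odd[OF s, of 0 0] by simp
  have "admissible_noise B (gauss (subg B / 2))"
    unfolding admissible_noise_def using prob_space_gauss[OF s] subgaussian_normal[OF law s] mean by simp
  moreover have "subgaussian (subg B) (gauss_vec M) (\<lambda>w. \<Sum>c<M. w c * \<psi> c t)" for t
    using subgaussian_gauss_comb[OF v K] by (simp add: gauss_comb_def[abs_def])
  ultimately show ?thesis
    using P gaussian_curve_rank_model[OF \<psi>] inv hoelder
    unfolding model_class_def mem_Collect_eq cov shift_invariant_def by auto
qed

section \<open>Hoelder norms of glued bumps\<close>

text \<open>It vanishes together with its derivative at all integers. Hence it may be multiplied by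
  a different constant on each unit interval and keeps a Lipschitz derivative, as smoothness up to
  order 2 requires.\<close>

definition bump :: "real \<Rightarrow> real" where
  "bump x = (sin (pi * x))\<^sup>2"

definition bump' :: "real \<Rightarrow> real" where
  "bump' x = pi * sin (2 * pi * x)"

lemma sin_pi_int: "sin (pi * real_of_int k) = 0"
  by (metis mult.commute sin_integer_2pi sin_zero_iff_int2)

lemma bump_int: "bump (of_int k) = 0" and bump'_int: "bump' (of_int k) = 0"
  using sin_pi_int[of k] sin_pi_int[of "2 * k"] by (simp_all add: bump_def bump'_def mult_ac)

lemma has_real_derivative_bump: "(bump has_real_derivative bump' x) (at x)"
  unfolding bump_def[abs_def] bump'_def
  by (rule derivative_eq_intros refl)+ (use sin_double[of "pi * x"] in \<open>simp add: mult_ac\<close>)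

lemma bump_bounds: "0 \<le> bump x" "bump x \<le> 1" "\<bar>bump x\<bar> \<le> 1" "\<bar>bump' x\<bar> \<le> pi"
proof -
  show "0 \<le> bump x" by (simp add: bump_def)
  show "bump x \<le> 1" unfolding bump_def by (simp add: abs_square_le_1)
  then show "\<bar>bump x\<bar> \<le> 1" by (simp add: bump_def)
  show "\<bar>bump' x\<bar> \<le> pi" unfolding bump'_def abs_mult using mult_left_mono[OF abs_sin_le_one[of "2 * pi * x"], of "\<bar>pi\<bar>"] by simp
qed

lemma abs_diff_le_of_deriv_bound:
  fixes f :: "real \<Rightarrow> real"
  assumes d: "\<And>x. (f has_real_derivative f' x) (at x)" and b: "\<And>x. \<bar>f' x\<bar> \<le> L"
  shows "\<bar>f x - f y\<bar> \<le> L * \<bar>x - y\<bar>"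
  using field_differentiable_bound[of UNIV f f' L x y] d b by auto

lemma bump_lipschitz: "\<bar>bump x - bump y\<bar> \<le> pi * \<bar>x - y\<bar>"
  by (rule abs_diff_le_of_deriv_bound[OF has_real_derivative_bump bump_bounds(4)])

lemma bump'_lipschitz: "\<bar>bump' x - bump' y\<bar> \<le> 2 * pi\<^sup>2 * \<bar>x - y\<bar>"
proof (rule abs_diff_le_of_deriv_bound)
  show "(bump' has_real_derivative 2 * pi\<^sup>2 * cos (2 * pi * x)) (at x)" for x
    unfolding bump'_def[abs_def] by (rule derivative_eq_intros refl)+ (simp add: power2_eq_square)
  show "\<bar>2 * pi\<^sup>2 * cos (2 * pi * x)\<bar> \<le> 2 * pi\<^sup>2" for x
    using mult_left_mono[OF abs_cos_le_one[of "2 * pi * x"], of "2 * pi\<^sup>2"] by (simp add: abs_mult)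
qed

text \<open>If \<open>x\<close> and \<open>y\<close> lie in different unit intervals, there is an
  integer between them where \<open>f\<close> vanishes. The bounds on the two sides of it add up to
  the length of the whole segment, so jumps of \<open>\<kappa>\<close> cost nothing.\<close>

lemma glued_lipschitz:
  fixes f :: "real \<Rightarrow> real" and \<kappa> :: "int \<Rightarrow> real"
  assumes z: "\<And>k::int. f (of_int k) = 0" and L: "\<And>x y. \<bar>f x - f y\<bar> \<le> L * \<bar>x - y\<bar>"
    and K: "\<And>i. \<bar>\<kappa> i\<bar> \<le> K"
  shows "\<bar>\<kappa> \<lfloor>x\<rfloor> * f x - \<kappa> \<lfloor>y\<rfloor> * f y\<bar> \<le> K * (L * \<bar>x - y\<bar>)"
proof (induction x y rule: linorder_wlog)
  case (sym a b)
  then show ?case by (simp add: abs_minus_commute)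
next
  case (le x y)
  have K0: "0 \<le> K" using K[of 0] by linarith
  show ?case
  proof (cases "\<lfloor>x\<rfloor> = \<lfloor>y\<rfloor>")
    case True
    have "\<bar>\<kappa> \<lfloor>x\<rfloor> * f x - \<kappa> \<lfloor>y\<rfloor> * f y\<bar> = \<bar>\<kappa> \<lfloor>x\<rfloor>\<bar> * \<bar>f x - f y\<bar>"
      unfolding True by (simp add: abs_mult[symmetric] right_diff_distrib)
    also have "\<dots> \<le> K * (L * \<bar>x - y\<bar>)" by (intro mult_mono K L) (use K0 in auto)
    finally show ?thesis .
  next
    case False
    define k where "k = real_of_int \<lfloor>y\<rfloor>"
    have "\<lfloor>x\<rfloor> < \<lfloor>y\<rfloor>" using False le floor_mono[of x y] by linarith
    then have xk: "x \<le> k" "k \<le> y" unfolding k_def by linarith+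
    have fx: "\<bar>f x\<bar> \<le> L * (k - x)" using L[of x k] z[of "\<lfloor>y\<rfloor>"] xk by (simp add: k_def)
    have fy: "\<bar>f y\<bar> \<le> L * (y - k)" using L[of y k] z[of "\<lfloor>y\<rfloor>"] xk by (simp add: k_def)
    have "\<bar>\<kappa> \<lfloor>x\<rfloor> * f x - \<kappa> \<lfloor>y\<rfloor> * f y\<bar> \<le> \<bar>\<kappa> \<lfloor>x\<rfloor>\<bar> * \<bar>f x\<bar> + \<bar>\<kappa> \<lfloor>y\<rfloor>\<bar> * \<bar>f y\<bar>"
      using abs_triangle_ineq4[of "\<kappa> \<lfloor>x\<rfloor> * f x" "\<kappa> \<lfloor>y\<rfloor> * f y"] by (simp add: abs_mult)
    also have "\<dots> \<le> K * (L * (k - x)) + K * (L * (y - k))"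
      by (intro add_mono mult_mono K fx fy) (use K0 in auto)
    also have "\<dots> = K * (L * \<bar>x - y\<bar>)" using le by (simp add: algebra_simps)
    finally show ?thesis .
  qed
qed

text \<open>Off the integers \<open>\<kappa>\<close> is locally constant. At an integer the
  difference quotient is at most \<open>K\<close> times that of \<open>f\<close>, which tends to
  0.\<close>

lemma glued_has_derivative:
  fixes f :: "real \<Rightarrow> real" and \<kappa> :: "int \<Rightarrow> real"
  assumes d: "\<And>x. (f has_real_derivative f' x) (at x)"
    and z: "\<And>k::int. f (of_int k) = 0" "\<And>k::int. f' (of_int k) = 0"
    and K: "\<And>i. \<bar>\<kappa> i\<bar> \<le> K"
  shows "((\<lambda>x. \<kappa> \<lfloor>x\<rfloor> * f x) has_real_derivative \<kappa> \<lfloor>x\<rfloor> * f' x) (at x)"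
proof (cases "x = of_int \<lfloor>x\<rfloor>")
  case True
  have f0: "f x = 0" "f' x = 0" using z[of "\<lfloor>x\<rfloor>"] True by simp_all
  have "((\<lambda>h. (f (x + h) - f x) / h) \<longlongrightarrow> 0) (at 0)"
    using d[of x] unfolding DERIV_def f0 .
  then have lim: "((\<lambda>h. K * \<bar>f (x + h) / h\<bar>) \<longlongrightarrow> K * \<bar>0\<bar>) (at 0)"
    unfolding f0 by (intro tendsto_intros) simp
  have "((\<lambda>h. \<kappa> \<lfloor>x + h\<rfloor> * f (x + h) / h) \<longlongrightarrow> 0) (at 0)"
  proof (rule Lim_null_comparison)
    show "\<forall>\<^sub>F h in at 0. norm (\<kappa> \<lfloor>x + h\<rfloor> * f (x + h) / h) \<le> K * \<bar>f (x + h) / h\<bar>"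
      by (intro always_eventually allI) (auto simp: abs_mult intro!: divide_right_mono mult_right_mono K)
  qed (use lim in simp)
  then show ?thesis unfolding DERIV_def f0 by simp
next
  case False
  let ?S = "{of_int \<lfloor>x\<rfloor><..<of_int \<lfloor>x\<rfloor> + 1}"
  have "((\<lambda>y. \<kappa> \<lfloor>x\<rfloor> * f y) has_real_derivative \<kappa> \<lfloor>x\<rfloor> * f' x) (at x)"
    by (intro DERIV_cmult d)
  then show ?thesis
  proof (rule has_field_derivative_transform_within_open[where S="?S"])
    have "of_int \<lfloor>x\<rfloor> < x" using False of_int_floor_le[of x] by linarith
    moreover have "x < of_int \<lfloor>x\<rfloor> + 1" by linarith
    ultimately show "x \<in> ?S" by simp
    fix y :: real assume "y \<in> ?S"
    then have "\<lfloor>y\<rfloor> = \<lfloor>x\<rfloor>" by (intro floor_unique) auto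
    then show "\<kappa> \<lfloor>x\<rfloor> * f y = \<kappa> \<lfloor>y\<rfloor> * f y" by simp
  qed simp
qed

text \<open>A product of profiles with one coefficient per unit square; the covariances of the waves
  have this form after rescaling.\<close>

definition glued :: "(int \<Rightarrow> int \<Rightarrow> real) \<Rightarrow> (real \<Rightarrow> real) \<Rightarrow> (real \<Rightarrow> real) \<Rightarrow> real \<Rightarrow> real \<Rightarrow> real" where
  "glued \<tau> f g x y = \<tau> \<lfloor>x\<rfloor> \<lfloor>y\<rfloor> * f x * g y"

lemma glued_bound:
  assumes "\<And>i j. \<bar>\<tau> i j\<bar> \<le> 1" "\<And>x. \<bar>f x\<bar> \<le> Kf" "\<And>x. \<bar>g x\<bar> \<le> Kg"
  shows "\<bar>glued \<tau> f g x y\<bar> \<le> Kf * Kg"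
proof -
  have "\<bar>glued \<tau> f g x y\<bar> \<le> 1 * Kf * Kg"
    unfolding glued_def abs_mult using assms(2)[of x] assms(3)[of y]
    by (intro mult_mono assms) auto
  then show ?thesis by simp
qed

text \<open>One variable is moved at a time, the factor of the other being absorbed into the
  coefficients of \<open>glued_lipschitz\<close>.\<close>

lemma glued_pair_lipschitz:
  assumes t: "\<And>i j. \<bar>\<tau> i j\<bar> \<le> 1"
    and f: "\<And>k::int. f (of_int k) = 0" "\<And>x y. \<bar>f x - f y\<bar> \<le> Lf * \<bar>x - y\<bar>" "\<And>x. \<bar>f x\<bar> \<le> Kf"
    and g: "\<And>k::int. g (of_int k) = 0" "\<And>x y. \<bar>g x - g y\<bar> \<le> Lg * \<bar>x - y\<bar>" "\<And>x. \<bar>g x\<bar> \<le> Kg"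
  shows "\<bar>glued \<tau> f g x y - glued \<tau> f g x' y'\<bar> \<le> Kg * (Lf * \<bar>x - x'\<bar>) + Kf * (Lg * \<bar>y - y'\<bar>)"
proof -
  have Kg0: "0 \<le> Kg" using g(3)[of 0] by linarith
  have Kf0: "0 \<le> Kf" using f(3)[of 0] by linarith
  have k1: "\<bar>\<tau> i \<lfloor>y\<rfloor> * g y\<bar> \<le> Kg" for i
    using mult_mono[OF t[of i "\<lfloor>y\<rfloor>"] g(3)[of y]] Kg0 by (simp add: abs_mult)
  have k2: "\<bar>\<tau> \<lfloor>x'\<rfloor> j * f x'\<bar> \<le> Kf" for j
    using mult_mono[OF t[of "\<lfloor>x'\<rfloor>" j] f(3)[of x']] Kf0 by (simp add: abs_mult)
  have "\<bar>glued \<tau> f g x y - glued \<tau> f g x' y\<bar> \<le> Kg * (Lf * \<bar>x - x'\<bar>)"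
    using glued_lipschitz[where f=f and \<kappa>="\<lambda>i. \<tau> i \<lfloor>y\<rfloor> * g y" and x=x and y=x', OF f(1,2) k1] by (simp add: glued_def mult_ac)
  moreover have "\<bar>glued \<tau> f g x' y - glued \<tau> f g x' y'\<bar> \<le> Kf * (Lg * \<bar>y - y'\<bar>)"
    using glued_lipschitz[where f=g and \<kappa>="\<lambda>j. \<tau> \<lfloor>x'\<rfloor> j * f x'" and x=y and y=y', OF g(1,2) k2] by (simp add: glued_def mult_ac)
  ultimately show ?thesis by linarith
qed

text \<open>Interpolation between a sup bound and a Lipschitz bound: for r \<le> 1 one has r \<le>
  r^\<alpha>, otherwise 1 \<le> r^\<alpha>.\<close>

lemma bounded_lipschitz_powr:
  fixes d K r \<alpha> :: real
  assumes "d \<le> K" "d \<le> K * r" "0 \<le> r" "0 \<le> \<alpha>" "\<alpha> \<le> 1" "0 \<le> K"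
  shows "d \<le> K * r powr \<alpha>"
proof (cases "r \<le> 1")
  case True
  have "r \<le> r powr \<alpha>"
    using powr_mono'[of \<alpha> 1 r] assms True by simp
  then have "K * r \<le> K * r powr \<alpha>" using assms by (intro mult_left_mono)
  with assms show ?thesis by linarith
next
  case False
  then have "1 \<le> r powr \<alpha>" using assms by (intro ge_one_powr_ge_zero) auto
  then have "K * 1 \<le> K * r powr \<alpha>" using assms by (intro mult_left_mono)
  with assms show ?thesis by linarith
qed

lemma sup_norm_le: "(\<And>x. norm (g x) \<le> c) \<Longrightarrow> sup_norm g \<le> ennreal c"
  unfolding sup_norm_def by (intro SUP_least ennreal_leI)

lemma hoelder_seminorm_le:
  fixes g :: "'a::metric_space \<Rightarrow> 'b::real_normed_vector"
  assumes "\<And>x y. norm (g x - g y) \<le> c * dist x y powr \<alpha>"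
  shows "hoelder_seminorm \<alpha> g \<le> ennreal c"
  unfolding hoelder_seminorm_def
proof (intro SUP_least ennreal_leI)
  fix x y :: 'a assume "y \<in> - {x}"
  then have "0 < dist x y powr \<alpha>" by simp
  then show "norm (g x - g y) / dist x y powr \<alpha> \<le> c"
    using assms[of x y] by (simp add: divide_le_eq)
qed

lemma hoelder_seminorm_const: "hoelder_seminorm \<alpha> (\<lambda>_::'a::metric_space. k::'b::real_normed_vector) = 0"
  using hoelder_seminorm_le[of "\<lambda>_::'a. k" 0 \<alpha>] by simp

lemma hoelder_norm_const_le: "hoelder_norm \<beta> (\<lambda>_. c) \<le> ennreal \<bar>c\<bar>"
proof -
  have "gradient (\<lambda>_. c) = (\<lambda>_. 0)"
    by (simp add: fun_eq_iff gradient_def frechet_derivative_const zero_prod_def)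
  moreover have "sup_norm (\<lambda>_::real \<times> real. 0::real \<times> real) = 0" "sup_norm (\<lambda>_::real \<times> real. c) = ennreal \<bar>c\<bar>"
    by (simp_all add: sup_norm_def)
  ultimately show ?thesis by (simp add: hoelder_norm_def hoelder_seminorm_const)
qed

lemma abs_diff_le_dist:
  fixes z z' :: "real \<times> real"
  shows "\<bar>fst z - fst z'\<bar> \<le> dist z z'" "\<bar>snd z - snd z'\<bar> \<le> dist z z'"
  using dist_fst_le[of z z'] dist_snd_le[of z z'] by (simp_all add: dist_real_def)

text \<open>Rescaling by \<open>L\<close> costs L^\<beta>. For \<beta> > 1 the constant is 105 = 1 +
  8 + 96, from the sup norms of the function and its gradient and the seminorm of the gradient, all
  compared with A L^\<beta> through L \<ge> 1; for \<beta> \<le> 1 the sum is 1 + 8.\<close>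

lemma hoelder_norm_glued_bump:
  assumes t: "\<And>i j. \<bar>\<tau> i j\<bar> \<le> 1" and L: "1 \<le> L" and A: "0 \<le> A" and b: "0 < \<beta>" "\<beta> \<le> 2"
  shows "hoelder_norm \<beta> (\<lambda>(s, t). A * glued \<tau> bump bump (L * s) (L * t)) \<le> ennreal (105 * (A * L powr \<beta>))"
proof -
  let ?H = "\<lambda>(s, t). A * glued \<tau> bump bump (L * s) (L * t)"
  let ?F = "\<lambda>f g (z::real \<times> real). glued \<tau> f g (L * fst z) (L * snd z)"
  have pi4: "pi \<le> 4" "0 < pi" using pi_less_4 by auto
  then have pi16: "pi\<^sup>2 \<le> 16" using power_mono[of pi 4 2] by simp
  have Lb: "1 \<le> L powr \<beta>" using L b by (intro ge_one_powr_ge_zero) auto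
  have ALb: "A \<le> A * L powr \<beta>" using mult_left_mono[OF Lb A] by simp
  have scale: "L * dist z z' \<ge> \<bar>L * fst z - L * fst z'\<bar>" "L * dist z z' \<ge> \<bar>L * snd z - L * snd z'\<bar>" for z z' :: "real \<times> real"
    using L abs_diff_le_dist[of z z'] by (simp_all add: right_diff_distrib[symmetric] abs_mult)
  have pow: "(L * dist z z') powr \<alpha> = L powr \<alpha> * dist z z' powr \<alpha>" for z z' :: "real \<times> real" and \<alpha>
    using L by (simp add: powr_mult)
  have Fb: "\<bar>?F bump bump z\<bar> \<le> 1" "\<bar>?F bump' bump z\<bar> \<le> 4" "\<bar>?F bump bump' z\<bar> \<le> 4" for z
  proof -
    show "\<bar>?F bump bump z\<bar> \<le> 1"
      using glued_bound[where \<tau>=\<tau> and f=bump and g=bump and x="L * fst z" and y="L * snd z", OF t bump_bounds(3) bump_bounds(3)] by simp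
    have "\<bar>?F bump' bump z\<bar> \<le> pi * 1" "\<bar>?F bump bump' z\<bar> \<le> 1 * pi"
      by (rule glued_bound[where \<tau>=\<tau> and f=bump' and g=bump, OF t bump_bounds(4) bump_bounds(3)] glued_bound[where \<tau>=\<tau> and f=bump and g=bump', OF t bump_bounds(3) bump_bounds(4)])+
    then show "\<bar>?F bump' bump z\<bar> \<le> 4" "\<bar>?F bump bump' z\<bar> \<le> 4" using pi4 by linarith+
  qed
  have step: "Kg * (Lf * \<bar>L * fst z - L * fst z'\<bar>) + Kf * (Lg * \<bar>L * snd z - L * snd z'\<bar>) \<le> (Kg * Lf + Kf * Lg) * (L * dist z z')"
    if "0 \<le> Kg" "0 \<le> Lf" "0 \<le> Kf" "0 \<le> Lg" for Kf Kg Lf Lg and z z' :: "real \<times> real"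
    unfolding distrib_right mult.assoc using that by (intro add_mono mult_left_mono scale)
  note bump_facts = bump_int bump_lipschitz bump_bounds(3) and bump'_facts = bump'_int bump'_lipschitz bump_bounds(4)
  have weaken: "x \<le> K' * (L * dist z z')" if "x \<le> K * (L * dist z z')" "K \<le> K'" for x K K' and z z' :: "real \<times> real"
    using that L by (meson mult_right_mono order_trans zero_le_dist zero_le_mult_iff zero_le_one)
  \<comment> \<open>With pi \<le> 4, the constants 8 here and 48 below bound 2 pi and 3 pi^2. They
    also exceed twice the sup bounds in \<open>Fb\<close>, as \<open>bounded_lipschitz_powr\<close>
    demands.\<close>
  have Fd: "\<bar>?F bump bump z - ?F bump bump z'\<bar> \<le> 8 * (L * dist z z')" for z z'
    using pi4 by (intro weaken[OF order_trans[OF glued_pair_lipschitz[where \<tau>=\<tau> and f=bump and g=bump, OF t bump_facts bump_facts] step]]) auto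
  have Fd': "\<bar>?F bump' bump z - ?F bump' bump z'\<bar> \<le> 48 * (L * dist z z')" for z z'
    using pi4 pi16 by (intro weaken[OF order_trans[OF glued_pair_lipschitz[where \<tau>=\<tau> and f=bump' and g=bump, OF t bump'_facts bump_facts] step]]) (auto simp: power2_eq_square)
  have Fd'': "\<bar>?F bump bump' z - ?F bump bump' z'\<bar> \<le> 48 * (L * dist z z')" for z z'
    using pi4 pi16 by (intro weaken[OF order_trans[OF glued_pair_lipschitz[where \<tau>=\<tau> and f=bump and g=bump', OF t bump_facts bump'_facts] step]]) (auto simp: power2_eq_square)
  have H: "?H z = A * ?F bump bump z" for z by (simp add: split_beta)
  have sup: "sup_norm ?H \<le> ennreal A"
  proof (rule sup_norm_le)
    fix z show "norm (?H z) \<le> A" unfolding H real_norm_def abs_mult using A mult_left_mono[OF Fb(1)[of z] A] by simp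
  qed
  show ?thesis
  proof (cases "\<beta> \<le> 1")
    case True
    have "hoelder_seminorm \<beta> ?H \<le> ennreal (8 * (A * L powr \<beta>))"
    proof (rule hoelder_seminorm_le)
      fix z z'
      have "\<bar>?F bump bump z - ?F bump bump z'\<bar> \<le> 8 * (L * dist z z') powr \<beta>"
        using Fb(1)[of z] Fb(1)[of z'] True b L by (intro bounded_lipschitz_powr Fd) auto
      then have "A * \<bar>?F bump bump z - ?F bump bump z'\<bar> \<le> A * (8 * (L * dist z z') powr \<beta>)"
        using A by (rule mult_left_mono)
      then show "norm (?H z - ?H z') \<le> 8 * (A * L powr \<beta>) * dist z z' powr \<beta>"
        unfolding H real_norm_def right_diff_distrib[symmetric] abs_mult using A by (simp add: pow mult_ac)
    qed
    with sup have "sup_norm ?H + hoelder_seminorm \<beta> ?H \<le> ennreal A + ennreal (8 * (A * L powr \<beta>))"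
      by (rule add_mono)
    also have "\<dots> \<le> ennreal (105 * (A * L powr \<beta>))"
      using A ALb by (simp add: ennreal_plus[symmetric] del: ennreal_plus)
    finally show ?thesis using True by (simp add: hoelder_norm_def)
  next
    case False
    let ?G = "\<lambda>z. (A * L * ?F bump' bump z, A * L * ?F bump bump' z)"
    have AL: "0 \<le> A * L" "A * L \<le> A * L powr \<beta>"
      using A L False powr_mono[of 1 \<beta> L] by (auto intro!: mult_left_mono)
    have absAL: "\<bar>A * L * x\<bar> = A * L * \<bar>x\<bar>" for x
      unfolding abs_mult[of "A * L" x] using AL(1) by simp
    \<comment> \<open>The criterion for joint differentiability by partial derivatives asks for
      continuity of the one in the second variable.\<close>
    have cont: "continuous_on UNIV (?F bump bump')"
    proof -
      have "(48 * L)-lipschitz_on UNIV (?F bump bump')"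
        by (rule lipschitz_onI) (use Fd'' L in \<open>auto simp: dist_real_def mult_ac\<close>)
      then show ?thesis by (rule lipschitz_on_continuous_on)
    qed
    have der: "(?H has_derivative (\<lambda>(u, v). A * L * ?F bump' bump z * u + A * L * ?F bump bump' z * v)) (at z)" for z
    proof -
      obtain s t where z: "z = (s, t)" by (cases z)
      have k1: "\<bar>\<tau> i \<lfloor>L * y\<rfloor> * bump (L * y)\<bar> \<le> 1" for i y
        using mult_mono[OF assms(1)[of i "\<lfloor>L * y\<rfloor>"] bump_bounds(3)[of "L * y"]] by (simp add: abs_mult)
      have k2: "\<bar>\<tau> \<lfloor>L * x\<rfloor> j * bump (L * x)\<bar> \<le> 1" for j x
        using mult_mono[OF assms(1)[of "\<lfloor>L * x\<rfloor>" j] bump_bounds(3)[of "L * x"]] by (simp add: abs_mult)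
      have d1: "((\<lambda>x. glued \<tau> bump bump (L * x) (L * y)) has_real_derivative L * glued \<tau> bump' bump (L * x) (L * y)) (at x)" for x y
        using DERIV_chain2[OF glued_has_derivative[where f=bump and f'=bump' and \<kappa>="\<lambda>i. \<tau> i \<lfloor>L * y\<rfloor> * bump (L * y)" and x="L * x", OF has_real_derivative_bump bump_int bump'_int k1]
            DERIV_cmult_Id[of L]] by (simp add: glued_def mult_ac)
      have d2: "((\<lambda>y. glued \<tau> bump bump (L * x) (L * y)) has_real_derivative L * glued \<tau> bump bump' (L * x) (L * y)) (at y)" for x y
        using DERIV_chain2[OF glued_has_derivative[where f=bump and f'=bump' and \<kappa>="\<lambda>j. \<tau> \<lfloor>L * x\<rfloor> j * bump (L * x)" and x="L * y", OF has_real_derivative_bump bump_int bump'_int k2]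
            DERIV_cmult_Id[of L]] by (simp add: glued_def mult_ac)
      let ?fy = "\<lambda>x y. (A * L * glued \<tau> bump bump' (L * x) (L * y)) *\<^sub>R (id_blinfun :: real \<Rightarrow>\<^sub>L real)"
      have "((\<lambda>(x, y). A * glued \<tau> bump bump (L * x) (L * y)) has_derivative
          (\<lambda>(u, v). A * L * glued \<tau> bump' bump (L * s) (L * t) * u + ?fy s t v)) (at (s, t) within UNIV \<times> UNIV)"
      proof (rule has_derivative_partialsI)
        show "((\<lambda>x. A * glued \<tau> bump bump (L * x) (L * t)) has_derivative (*) (A * L * glued \<tau> bump' bump (L * s) (L * t))) (at s within UNIV)"
          using DERIV_cmult[OF d1[of t s], of A] by (simp add: has_field_derivative_def mult_ac)
        show "((\<lambda>y. A * glued \<tau> bump bump (L * x) (L * y)) has_derivative blinfun_apply (?fy x y)) (at y within UNIV)" for x y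
        proof -
          have "blinfun_apply (?fy x y) = (*) (A * (L * glued \<tau> bump bump' (L * x) (L * y)))"
            by (simp add: fun_eq_iff scaleR_blinfun.rep_eq id_blinfun.rep_eq mult.assoc)
          then show ?thesis
            using DERIV_cmult[OF d2[of x y], of A] by (simp only: has_field_derivative_def)
        qed
        have "continuous_on UNIV (\<lambda>z. (A * L * ?F bump bump' z) *\<^sub>R (id_blinfun :: real \<Rightarrow>\<^sub>L real))"
          by (intro continuous_intros cont)
        then show "continuous (at (s, t) within UNIV \<times> UNIV) (\<lambda>(x, y). ?fy x y)"
          by (simp add: continuous_on_eq_continuous_at split_beta')
      qed auto
      then show ?thesis unfolding z by (simp add: scaleR_blinfun.rep_eq id_blinfun.rep_eq split_beta')
    qed
    have diff: "\<forall>z. ?H differentiable (at z)" using der unfolding differentiable_def by blast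
    have grad: "gradient ?H = ?G"
    proof
      fix z show "gradient ?H z = ?G z"
        unfolding gradient_def frechet_derivative_at[OF der[of z], symmetric] by simp
    qed
    have pair: "norm (x, y) \<le> \<bar>x\<bar> + \<bar>y\<bar>" for x y :: real
      by (simp add: norm_Pair sqrt_sum_squares_le_sum_abs)
    have sup': "sup_norm (gradient ?H) \<le> ennreal (8 * (A * L))"
    proof (unfold grad, rule sup_norm_le)
      fix z
      have "norm (?G z) \<le> \<bar>A * L * ?F bump' bump z\<bar> + \<bar>A * L * ?F bump bump' z\<bar>" by (rule pair)
      also have "\<dots> \<le> A * L * 4 + A * L * 4"
        unfolding abs_mult[of "A * L"] abs_of_nonneg[OF AL(1)] by (intro add_mono mult_left_mono Fb AL)
      finally show "norm (?G z) \<le> 8 * (A * L)" by simp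
    qed
    have sem: "hoelder_seminorm (\<beta> - 1) (gradient ?H) \<le> ennreal (96 * (A * L powr \<beta>))"
    proof (unfold grad, rule hoelder_seminorm_le)
      fix z z'
      have a1: "\<bar>?F bump' bump z - ?F bump' bump z'\<bar> \<le> 48 * (L * dist z z') powr (\<beta> - 1)"
        using Fb(2)[of z] Fb(2)[of z'] False b L by (intro bounded_lipschitz_powr Fd') auto
      have a2: "\<bar>?F bump bump' z - ?F bump bump' z'\<bar> \<le> 48 * (L * dist z z') powr (\<beta> - 1)"
        using Fb(3)[of z] Fb(3)[of z'] False b L by (intro bounded_lipschitz_powr Fd'') auto
      have "norm (?G z - ?G z') \<le> A * L * \<bar>?F bump' bump z - ?F bump' bump z'\<bar> + A * L * \<bar>?F bump bump' z - ?F bump bump' z'\<bar>"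
      proof -
        let ?d = "?F bump' bump z - ?F bump' bump z'" and ?d' = "?F bump bump' z - ?F bump bump' z'"
        have e: "?G z - ?G z' = (A * L * ?d, A * L * ?d')" by (simp add: right_diff_distrib)
        have "norm (?G z - ?G z') \<le> \<bar>A * L * ?d\<bar> + \<bar>A * L * ?d'\<bar>" unfolding e by (rule pair)
        also have "\<dots> = A * L * \<bar>?d\<bar> + A * L * \<bar>?d'\<bar>"
          by (simp only: absAL)
        finally show ?thesis .
      qed
      also have "\<dots> \<le> A * L * (48 * (L * dist z z') powr (\<beta> - 1)) + A * L * (48 * (L * dist z z') powr (\<beta> - 1))"
        by (intro add_mono mult_left_mono a1 a2 AL)
      also have "\<dots> = 96 * (A * (L * L powr (\<beta> - 1))) * dist z z' powr (\<beta> - 1)"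
        by (simp add: pow mult_ac)
      also have "L * L powr (\<beta> - 1) = L powr \<beta>"
        using L powr_mult_base[of L "\<beta> - 1"] by simp
      finally show "norm (?G z - ?G z') \<le> 96 * (A * L powr \<beta>) * dist z z' powr (\<beta> - 1)" .
    qed
    have "sup_norm ?H + sup_norm (gradient ?H) + hoelder_seminorm (\<beta> - 1) (gradient ?H)
      \<le> ennreal A + ennreal (8 * (A * L)) + ennreal (96 * (A * L powr \<beta>))"
      by (intro add_mono sup sup' sem)
    also have "\<dots> = ennreal (A + 8 * (A * L) + 96 * (A * L powr \<beta>))"
      using A AL by (simp add: ennreal_plus[symmetric] del: ennreal_plus)
    also have "\<dots> \<le> ennreal (105 * (A * L powr \<beta>))"
      using ALb AL by (intro ennreal_leI) linarith
    finally show ?thesis using False diff by (simp add: hoelder_norm_def)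
  qed
qed

section \<open>Bumps on alternating half cells\<close>

text \<open>On the axis scaled by L = 2 q M the half cells are unit intervals, numbered by
  \<open>i\<close>. Two consecutive ones form a cell, left half even, and cells congruent modulo
  \<open>M\<close> are translates by multiples of 1/q.\<close>

definition cell :: "nat \<Rightarrow> int \<Rightarrow> nat" where
  "cell M i = nat ((i div 2) mod int M)"

abbreviation in_half :: "nat \<Rightarrow> nat \<Rightarrow> bool \<Rightarrow> int \<Rightarrow> bool" where
  "in_half M c e i \<equiv> cell M i = c \<and> even i = e"

abbreviation half_cells :: "nat \<Rightarrow> nat \<Rightarrow> nat \<Rightarrow> bool \<Rightarrow> nat set" where
  "half_cells L M c e \<equiv> {l. l < L \<and> in_half M c e (int l)}"

abbreviation unit_ind :: "nat \<Rightarrow> real \<Rightarrow> ennreal" where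
  "unit_ind l \<equiv> indicator {real l..<real l + 1}"

text \<open>Only right halves carry a free sign: a sign common to both halves would cancel in the
  covariance.\<close>

definition half_sign :: "nat \<Rightarrow> nat set \<Rightarrow> int \<Rightarrow> real" where
  "half_sign M \<theta> i = (if even i \<or> cell M i \<in> \<theta> then 1 else -1)"

definition wave :: "real \<Rightarrow> real \<Rightarrow> nat \<Rightarrow> nat set \<Rightarrow> nat \<Rightarrow> real \<Rightarrow> real" where
  "wave A L M \<theta> c t = (if cell M \<lfloor>L * t\<rfloor> = c then sqrt A * half_sign M \<theta> \<lfloor>L * t\<rfloor> * bump (L * t) else 0)"

definition half_wave :: "bool \<Rightarrow> real \<Rightarrow> real \<Rightarrow> nat \<Rightarrow> nat \<Rightarrow> real \<Rightarrow> real" where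
  "half_wave e A L M c t = (if in_half M c e \<lfloor>L * t\<rfloor> then sqrt A * bump (L * t) else 0)"

lemma measurable_bump [measurable]: "bump \<in> borel_measurable borel"
  unfolding bump_def[abs_def] by measurable

lemma measurable_wave [measurable]: "wave A L M \<theta> c \<in> borel_measurable borel"
  unfolding wave_def[abs_def] by measurable

lemma measurable_half_wave [measurable]: "half_wave e A L M c \<in> borel_measurable borel"
  unfolding half_wave_def[abs_def] by measurable

lemma cell_less: "1 \<le> M \<Longrightarrow> cell M i < M"
  by (simp add: cell_def nat_less_iff)

lemma half_sign_abs: "\<bar>half_sign M \<theta> i\<bar> = 1" "half_sign M \<theta> i * half_sign M \<theta> i = 1"
  by (simp_all add: half_sign_def)

lemma disjoint_wave: "disjoint_family_fun M (wave A L M \<theta>)"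
  by (auto simp: disjoint_family_fun_def wave_def)

lemma wave_split:
  "c \<in> \<theta> \<Longrightarrow> wave A L M \<theta> c t = half_wave True A L M c t + half_wave False A L M c t"
  "c \<notin> \<theta> \<Longrightarrow> wave A L M \<theta> c t = half_wave True A L M c t - half_wave False A L M c t"
  by (auto simp: wave_def half_wave_def half_sign_def)

lemma half_wave_disjoint: "half_wave True A L M c t * half_wave False A L M c t = 0"
  by (simp add: half_wave_def)

lemma wave_insert_other: "c \<noteq> c0 \<Longrightarrow> wave A L M (insert c0 \<theta>) c = wave A L M \<theta> c"
  by (auto simp: wave_def half_sign_def fun_eq_iff)

definition cell_cov :: "nat \<Rightarrow> nat set \<Rightarrow> int \<Rightarrow> int \<Rightarrow> real" where
  "cell_cov M \<theta> i j = (if cell M i = cell M j then half_sign M \<theta> i * half_sign M \<theta> j else 0)"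

lemma cell_cov_abs: "\<bar>cell_cov M \<theta> i j\<bar> \<le> 1"
  by (simp add: cell_cov_def abs_mult half_sign_abs)

text \<open>By disjointness only the class of the cell containing \<open>s\<close> survives, so the
  covariance is a glued bump with coefficients in {-1, 0, 1}.\<close>

lemma sum_wave_mult:
  assumes M: "1 \<le> M" and A: "0 \<le> A"
  shows "(\<Sum>c<M. wave A L M \<theta> c s * wave A L M \<theta> c t) = A * glued (cell_cov M \<theta>) bump bump (L * s) (L * t)"
proof -
  let ?i = "\<lfloor>L * s\<rfloor>" and ?j = "\<lfloor>L * t\<rfloor>"
  have "(\<Sum>c<M. wave A L M \<theta> c s * wave A L M \<theta> c t) = (\<Sum>c<M. if c = cell M ?i then wave A L M \<theta> c s * wave A L M \<theta> c t else 0)"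
    by (intro sum.cong) (auto simp: wave_def)
  also have "\<dots> = wave A L M \<theta> (cell M ?i) s * wave A L M \<theta> (cell M ?i) t"
    using cell_less[OF M, of ?i] by simp
  also have "\<dots> = A * glued (cell_cov M \<theta>) bump bump (L * s) (L * t)"
    using A by (simp add: wave_def glued_def cell_cov_def mult_ac)
  finally show ?thesis .
qed

text \<open>A shift over \<open>k\<close> blocks of \<open>M\<close> whole cells preserves class,
  half and sign. It serves with \<open>k = q\<close> for the period 1 and with \<open>k = 1\<close>
  for the invariance under 1/q.\<close>

lemma wave_shift:
  assumes M: "1 \<le> M" and d: "L * d = real_of_int (2 * int M * k)"
  shows "wave A L M \<theta> c (t + d) = wave A L M \<theta> c t"
proof -
  have e: "L * (t + d) = L * t + real_of_int (2 * int M * k)" using d by (simp add: distrib_left)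
  have fl: "\<lfloor>L * (t + d)\<rfloor> = \<lfloor>L * t\<rfloor> + 2 * int M * k" unfolding e by (rule floor_add_int[symmetric])
  have dv: "(i + 2 * int M * k) div 2 = i div 2 + int M * k" for i by simp
  have c: "cell M (i + 2 * int M * k) = cell M i" for i
    unfolding cell_def dv by (simp add: mod_add_eq[symmetric])
  have s: "half_sign M \<theta> (i + 2 * int M * k) = half_sign M \<theta> i" for i
    unfolding half_sign_def c by simp
  have "sin (pi * (L * (t + d))) = sin (pi * (L * t) + 2 * pi * real_of_int (int M * k))"
    unfolding e by (simp add: algebra_simps)
  also have "\<dots> = sin (pi * (L * t))"
  proof -
    have "sin (x + 2 * pi * real_of_int n) = sin x" for x n
      by (simp add: sin_add sin_int_2pin cos_int_2pin)
    then show ?thesis .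
  qed
  finally have "bump (L * (t + d)) = bump (L * t)" by (simp add: bump_def)
  then show ?thesis unfolding wave_def fl c s by simp
qed

lemma wave_abs_le: "0 \<le> A \<Longrightarrow> \<bar>wave A L M \<theta> c t\<bar> \<le> sqrt A"
  using mult_left_mono[OF bump_bounds(3)[of "L * t"], of "sqrt A"] by (simp add: wave_def abs_mult half_sign_abs)

section \<open>Mass of the half cells\<close>

lemma nn_integral_circle:
  assumes [measurable]: "g \<in> borel_measurable borel"
  shows "(\<integral>\<^sup>+t. g t \<partial>circle) = (\<integral>\<^sup>+t. g t * indicator {0..<1} t \<partial>lborel)"
  unfolding circle_def by (subst nn_integral_restrict_space) auto

lemma nn_integral_circle_scale:
  fixes L :: nat
  assumes L: "1 \<le> L" and [measurable]: "g \<in> borel_measurable borel"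
  shows "(\<integral>\<^sup>+t. g (real L * t) \<partial>circle) = ennreal (1 / real L) * (\<Sum>l<L. \<integral>\<^sup>+x. g x * unit_ind l x \<partial>lborel)"
proof -
  have ind: "(indicator {0..<real n} x :: ennreal) = (\<Sum>l<n. unit_ind l x)" for n x
  proof (induction n)
    case (Suc n)
    have "(indicator {0..<real (Suc n)} x :: ennreal) = indicator {0..<real n} x + indicator {real n..<real n + 1} x"
      by (auto split: split_indicator)
    then show ?case using Suc by simp
  qed simp
  have "(\<Sum>l<L. \<integral>\<^sup>+x. g x * unit_ind l x \<partial>lborel) = (\<integral>\<^sup>+x. g x * indicator {0..<real L} x \<partial>lborel)"
    unfolding ind sum_distrib_left by (rule nn_integral_sum[symmetric]) measurable
  also have "\<dots> = ennreal \<bar>real L\<bar> * (\<integral>\<^sup>+x. g (0 + real L * x) * indicator {0..<real L} (0 + real L * x) \<partial>lborel)"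
    using L by (intro nn_integral_real_affine) auto
  also have "(\<integral>\<^sup>+x. g (0 + real L * x) * indicator {0..<real L} (0 + real L * x) \<partial>lborel) = (\<integral>\<^sup>+x. g (real L * x) * indicator {0..<1} x \<partial>lborel)"
    using L by (intro nn_integral_cong) (auto split: split_indicator simp: zero_le_mult_iff)
  also have "\<dots> = (\<integral>\<^sup>+t. g (real L * t) \<partial>circle)"
    by (rule nn_integral_circle[symmetric]) measurable
  finally show ?thesis
    using L by (simp add: mult.assoc[symmetric] ennreal_mult[symmetric])
qed

lemma cell_of_nat: "cell M (int l) = (l div 2) mod M"
proof -
  have "int ((l div 2) mod M) = (int l div 2) mod int M" by (simp add: zdiv_int zmod_int)
  then show ?thesis unfolding cell_def by (metis nat_int)
qed

lemma card_half_cell: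
  assumes c: "c < M"
  shows "card (half_cells (2 * q * M) M c e) = q"
proof -
  \<comment> \<open>The cells of class \<open>c\<close> have numbers c + i M, one for each of the
    \<open>q\<close> periods; the last summand selects the half.\<close>
  let ?f = "\<lambda>i::nat. 2 * (c + i * M) + (if e then 0 else 1)"
  have M: "1 \<le> M" using c by simp
  have "(half_cells (2 * q * M) M c e) = ?f ` {..<q}"
  proof (intro set_eqI iffI)
    fix l assume "l \<in> (half_cells (2 * q * M) M c e)"
    then have l: "l < 2 * q * M" "cell M (int l) = c" "even l = e" by auto
    have "cell M (int l) = (l div 2) mod M"
      by (rule cell_of_nat)
    then have m: "(l div 2) mod M = c" using l by simp
    define i where "i = (l div 2) div M"
    have d: "l div 2 = c + i * M" using m by (metis i_def add.commute div_mult_mod_eq)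
    have "l div 2 < q * M" using l(1) by (simp add: mult_ac)
    then have "i < q" using M unfolding i_def by (simp add: less_mult_imp_div_less)
    moreover have "l = ?f i" using l(3) unfolding d[symmetric] by (cases e) (auto elim!: oddE evenE)
    ultimately show "l \<in> ?f ` {..<q}" by blast
  next
    fix l assume "l \<in> ?f ` {..<q}"
    then obtain i where i: "i < q" "l = ?f i" by auto
    have d: "l div 2 = c + i * M" using i by (cases e) auto
    have "cell M (int l) = (l div 2) mod M"
      by (rule cell_of_nat)
    then have "cell M (int l) = c" unfolding d using c by simp
    moreover have "(i + 1) * M \<le> q * M" using i by (intro mult_right_mono) auto
    then have "l < 2 * q * M" using c i(2) by (cases e) (auto simp: algebra_simps)
    ultimately show "l \<in> (half_cells (2 * q * M) M c e)"
      using i(2) by (cases e) auto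
  qed
  moreover have "inj_on ?f {..<q}" using M by (auto simp: inj_on_def)
  ultimately show ?thesis by (simp add: card_image)
qed

lemma bump_ge_half:
  assumes "real l + 1 / 4 \<le> x" "x \<le> real l + 3 / 4"
  shows "1 / 2 \<le> bump x"
proof -
  define y where "y = x - real l"
  have y: "1 / 4 \<le> y" "y \<le> 3 / 4" using assms by (auto simp: y_def)
  have "0 \<le> cos (2 * pi * y - pi)"
  proof (rule cos_ge_zero)
    have "2 * pi * (1 / 4) \<le> 2 * pi * y" "2 * pi * y \<le> 2 * pi * (3 / 4)" using y by (intro mult_left_mono; simp)+
    then show "- (pi / 2) \<le> 2 * pi * y - pi" "2 * pi * y - pi \<le> pi / 2" by linarith+
  qed
  then have "cos (2 * (pi * y)) \<le> 0" by (simp add: cos_diff mult.assoc)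
  then have s: "1 / 2 \<le> (sin (pi * y))\<^sup>2" by (simp add: cos_double_sin)
  have "pi * x = pi * y + real l * pi" by (simp add: y_def algebra_simps)
  then have "(sin (pi * x))\<^sup>2 = (sin (pi * y))\<^sup>2"
    by (simp add: sin_add sin_npi cos_npi power_mult_distrib flip: power_mult) 
  then show ?thesis using s by (simp add: bump_def)
qed

lemma half_wave_square:
  "0 \<le> A \<Longrightarrow> (half_wave e A L M c t)\<^sup>2 = (if in_half M c e \<lfloor>L * t\<rfloor> then A * (bump (L * t))\<^sup>2 else 0)"
  by (simp add: half_wave_def power_mult_distrib)

lemma nn_integral_half_cell:
  assumes c: "c < M" and q: "1 \<le> q" and [measurable]: "g \<in> borel_measurable borel"
    and L: "L = 2 * q * M"
  shows "(\<integral>\<^sup>+t. (if in_half M c e \<lfloor>real L * t\<rfloor> then g (real L * t) else 0) \<partial>circle)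
    = ennreal (1 / real L) * (\<Sum>l\<in>half_cells L M c e. \<integral>\<^sup>+x. g x * unit_ind l x \<partial>lborel)"
proof -
  have L1: "1 \<le> L" using c q by (simp add: L)
  let ?h = "\<lambda>x::real. if in_half M c e \<lfloor>x\<rfloor> then g x else 0"
  have "(\<integral>\<^sup>+t. ?h (real L * t) \<partial>circle) = ennreal (1 / real L) * (\<Sum>l<L. \<integral>\<^sup>+x. ?h x * unit_ind l x \<partial>lborel)"
    by (rule nn_integral_circle_scale[OF L1]) measurable
  also have "(\<Sum>l<L. \<integral>\<^sup>+x. ?h x * unit_ind l x \<partial>lborel)
     = (\<Sum>l<L. if in_half M c e (int l) then \<integral>\<^sup>+x. g x * unit_ind l x \<partial>lborel else 0)"
  proof (rule sum.cong[OF refl])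
    fix l
    have "(\<integral>\<^sup>+x. ?h x * unit_ind l x \<partial>lborel)
       = (\<integral>\<^sup>+x. (if in_half M c e (int l) then g x * unit_ind l x else 0) \<partial>lborel)"
    proof (rule nn_integral_cong)
      fix x :: real
      have "\<lfloor>x\<rfloor> = int l" if "x \<in> {real l..<real l + 1}" using that by (intro floor_unique) auto
      then show "?h x * unit_ind l x = (if in_half M c e (int l) then g x * unit_ind l x else 0)"
        by (auto split: split_indicator)
    qed
    then show "(\<integral>\<^sup>+x. ?h x * unit_ind l x \<partial>lborel)
       = (if in_half M c e (int l) then \<integral>\<^sup>+x. g x * unit_ind l x \<partial>lborel else 0)"
      by auto
  qed
  also have "\<dots> = (\<Sum>l\<in>half_cells L M c e. \<integral>\<^sup>+x. g x * unit_ind l x \<partial>lborel)"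
    by (subst sum.inter_filter[symmetric]) (auto intro!: sum.cong)
  finally show ?thesis .
qed

text \<open>There are \<open>q\<close> half cells of length 1 / (2 q M), and the squared bump is at
  most \<open>A\<close> on them; \<open>q\<close> cancels. This bound controls the
  information.\<close>

lemma half_wave_mass_le:
  assumes c: "c < M" and q: "1 \<le> q" and A: "0 \<le> A"
  shows "(\<integral>\<^sup>+t. ennreal ((half_wave e A (real (2 * q * M)) M c t)\<^sup>2) \<partial>circle) \<le> ennreal (A / (2 * real M))"
proof -
  let ?L = "2 * q * M"
  have "(\<integral>\<^sup>+t. ennreal ((half_wave e A (real ?L) M c t)\<^sup>2) \<partial>circle)
      \<le> (\<integral>\<^sup>+t. (if in_half M c e \<lfloor>real ?L * t\<rfloor> then ennreal A else 0) \<partial>circle)"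
  proof (rule nn_integral_mono)
    fix t
    have "A * (bump x)\<^sup>2 \<le> A" for x using A mult_left_mono[of "(bump x)\<^sup>2" 1 A] bump_bounds(3)[of x] by (simp add: abs_square_le_1)
    then show "ennreal ((half_wave e A (real ?L) M c t)\<^sup>2) \<le> (if in_half M c e \<lfloor>real ?L * t\<rfloor> then ennreal A else 0)"
      unfolding half_wave_square[OF A] by (auto intro!: ennreal_leI)
  qed
  also have "\<dots> = ennreal (1 / real ?L) * (\<Sum>l\<in>half_cells ?L M c e. \<integral>\<^sup>+x. ennreal A * unit_ind l x \<partial>lborel)"
    by (rule nn_integral_half_cell[OF c q, where g="\<lambda>_. ennreal A"]) simp_all
  also have "\<dots> = ennreal (1 / real ?L) * (of_nat q * ennreal A)"
    by (simp add: card_half_cell[OF c, of q e, simplified] nn_integral_cmult_indicator)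
  also have "\<dots> = ennreal (A / (2 * real M))"
    using A c q by (simp add: ennreal_of_nat_eq_real_of_nat ennreal_mult[symmetric])
  finally show ?thesis .
qed

text \<open>On the middle half of each unit interval the squared bump is at least 1/4, so an
  interval contributes A / 8 before scaling by q / (2 q M). This bound yields the
  separation.\<close>

lemma half_wave_mass_ge:
  assumes c: "c < M" and q: "1 \<le> q" and A: "0 \<le> A"
  shows "ennreal (A / (16 * real M)) \<le> (\<integral>\<^sup>+t. ennreal ((half_wave e A (real (2 * q * M)) M c t)\<^sup>2) \<partial>circle)"
proof -
  let ?L = "2 * q * M"
  have cellmass: "ennreal (A / 8) \<le> (\<integral>\<^sup>+x. ennreal (A * (bump x)\<^sup>2) * unit_ind l x \<partial>lborel)" for l
  proof -
    have "ennreal (A / 8) = (\<integral>\<^sup>+x. ennreal (A / 4) * indicator {real l + 1 / 4..real l + 3 / 4} x \<partial>lborel)"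
    proof -
      have "emeasure lborel {real l + 1 / 4..real l + 3 / 4} = ennreal (real l + 3 / 4 - (real l + 1 / 4))"
        by (rule emeasure_lborel_Icc) simp
      also have "real l + 3 / 4 - (real l + 1 / 4) = 1 / 2" by simp
      finally have "ennreal (A / 4) * emeasure lborel {real l + 1 / 4..real l + 3 / 4} = ennreal (A / 8)"
        using A by (simp only: ennreal_mult[symmetric]) simp
      then show ?thesis by (subst nn_integral_cmult_indicator) simp_all
    qed
    also have "\<dots> \<le> (\<integral>\<^sup>+x. ennreal (A * (bump x)\<^sup>2) * unit_ind l x \<partial>lborel)"
    proof (rule nn_integral_mono)
      fix x
      show "ennreal (A / 4) * indicator {real l + 1 / 4..real l + 3 / 4} x \<le> ennreal (A * (bump x)\<^sup>2) * unit_ind l x"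
      proof (cases "x \<in> {real l + 1 / 4..real l + 3 / 4}")
        case True
        then have "(1 / 2)\<^sup>2 \<le> (bump x)\<^sup>2" by (intro power_mono bump_ge_half) auto
        then have "A * (1 / 4) \<le> A * (bump x)\<^sup>2" using A by (intro mult_left_mono) (auto simp: power2_eq_square)
        then show ?thesis using True by (auto intro!: ennreal_leI split: split_indicator)
      qed simp
    qed
    finally show ?thesis .
  qed
  have "ennreal (A / (16 * real M)) = ennreal (1 / real ?L) * (of_nat q * ennreal (A / 8))"
    using A c q by (simp add: ennreal_of_nat_eq_real_of_nat ennreal_mult[symmetric])
  also have "\<dots> = ennreal (1 / real ?L) * (\<Sum>l\<in>half_cells ?L M c e. ennreal (A / 8))"
    by (simp add: card_half_cell[OF c, of q e, simplified])
  also have "\<dots> \<le> ennreal (1 / real ?L) * (\<Sum>l\<in>half_cells ?L M c e. \<integral>\<^sup>+x. ennreal (A * (bump x)\<^sup>2) * unit_ind l x \<partial>lborel)"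
    by (intro mult_left_mono sum_mono cellmass) simp
  also have "\<dots> = (\<integral>\<^sup>+t. (if in_half M c e \<lfloor>real ?L * t\<rfloor> then ennreal (A * (bump (real ?L * t))\<^sup>2) else 0) \<partial>circle)"
    by (rule nn_integral_half_cell[OF c q, where g="\<lambda>x. ennreal (A * (bump x)\<^sup>2)", symmetric]) simp_all
  also have "\<dots> = (\<integral>\<^sup>+t. ennreal ((half_wave e A (real ?L) M c t)\<^sup>2) \<partial>circle)"
    unfolding half_wave_square[OF A] by (intro nn_integral_cong) simp
  finally show ?thesis .
qed

text \<open>For each \<open>c\<close> the sign patterns split into 2^(M-1) pairs that differ at
  \<open>c\<close> only. Summing over all pairs and all \<open>c\<close> gives M 2^(M-1) \<eta>
  \<le> 2^M S.\<close>

lemma assouad_sum: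
  fixes r :: "nat set \<Rightarrow> nat \<Rightarrow> ennreal"
  assumes M: "1 \<le> M" and \<eta>: "0 \<le> \<eta>"
    and pair: "\<And>c \<theta>. c < M \<Longrightarrow> c \<notin> \<theta> \<Longrightarrow> \<theta> \<subseteq> {..<M} \<Longrightarrow> ennreal \<eta> \<le> r (insert c \<theta>) c + r \<theta> c"
    and up: "\<And>\<theta>. \<theta> \<subseteq> {..<M} \<Longrightarrow> (\<Sum>c<M. r \<theta> c) \<le> S"
  shows "ennreal (real M * \<eta> / 2) \<le> S"
proof -
  let ?N = "2 ^ (M - 1) :: nat"
  have each: "of_nat ?N * ennreal \<eta> \<le> (\<Sum>\<theta>\<in>Pow {..<M}. r \<theta> c)" if c: "c < M" for c
  proof -
    let ?I = "{..<M} - {c}"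
    have I: "finite ?I" "card ?I = M - 1" "insert c ?I = {..<M}" using c by auto
    have "of_nat ?N * ennreal \<eta> = (\<Sum>\<theta>\<in>Pow ?I. ennreal \<eta>)"
      using I by (simp add: card_Pow)
    also have "\<dots> \<le> (\<Sum>\<theta>\<in>Pow ?I. r (insert c \<theta>) c + r \<theta> c)"
      using c by (intro sum_mono pair) auto
    also have "\<dots> = (\<Sum>\<theta>\<in>insert c ` Pow ?I. r \<theta> c) + (\<Sum>\<theta>\<in>Pow ?I. r \<theta> c)"
    proof -
      have "inj_on (insert c) (Pow ?I)" by (auto simp: inj_on_def)
      then show ?thesis by (simp add: sum.distrib sum.reindex)
    qed
    also have "\<dots> = (\<Sum>\<theta>\<in>Pow ?I \<union> insert c ` Pow ?I. r \<theta> c)"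
      by (subst sum.union_disjoint) (auto simp: add.commute)
    also have "Pow ?I \<union> insert c ` Pow ?I = Pow {..<M}"
      using Pow_insert[of c ?I] I by simp
    finally show ?thesis .
  qed
  have "of_nat M * (of_nat ?N * ennreal \<eta>) = (\<Sum>c<M. of_nat ?N * ennreal \<eta>)" by simp
  also have "\<dots> \<le> (\<Sum>c<M. \<Sum>\<theta>\<in>Pow {..<M}. r \<theta> c)" by (intro sum_mono each) simp
  also have "\<dots> = (\<Sum>\<theta>\<in>Pow {..<M}. \<Sum>c<M. r \<theta> c)" by (rule sum.swap)
  also have "\<dots> \<le> (\<Sum>\<theta>\<in>Pow {..<M}. S)" by (intro sum_mono up) auto
  also have "\<dots> = of_nat (2 * ?N) * S"
    using M by (simp add: card_Pow power_eq_if)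
  finally have *: "of_nat M * (of_nat ?N * ennreal \<eta>) \<le> of_nat (2 * ?N) * S" .
  \<comment> \<open>The division by 2^M takes place in the reals, so an infinite \<open>S\<close> is
    treated separately.\<close>
  show ?thesis
  proof (cases S)
    case (real x)
    have "ennreal (real M * (real ?N * \<eta>)) \<le> ennreal (real (2 * ?N) * x)"
      using * \<eta> real by (simp add: ennreal_of_nat_eq_real_of_nat ennreal_mult[symmetric] del: of_nat_power of_nat_mult)
    then have "real M * (real ?N * \<eta>) \<le> real (2 * ?N) * x"
      using real by (subst (asm) ennreal_le_iff) auto
    then have "real ?N * (real M * \<eta>) \<le> real ?N * (2 * x)" by (simp add: mult_ac)
    then have "real M * \<eta> \<le> 2 * x" by (subst (asm) mult_le_cancel_left_pos) auto
    then show ?thesis unfolding real by (intro ennreal_leI) simp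
  qed simp
qed

section \<open>Risk bounds\<close>

abbreviation torus :: "(real \<times> real) measure" where
  "torus \<equiv> circle \<Otimes>\<^sub>M circle"

lemma prob_space_circle: "prob_space circle"
  by (rule prob_spaceI) (simp add: circle_def space_restrict_space emeasure_restrict_space)

lemma prob_space_torus: "prob_space torus"
  by (intro prob_space_pair prob_space_circle)

lemma measurable_circle: "f \<in> measurable borel N \<Longrightarrow> f \<in> measurable circle N"
  by (drule measurable_compose[OF measurable_circle_ident])

lemma measurable_torus: "f \<in> measurable (borel \<Otimes>\<^sub>M borel) N \<Longrightarrow> f \<in> measurable torus N"
proof -
  assume f: "f \<in> measurable (borel \<Otimes>\<^sub>M borel) N"
  have "(\<lambda>x. (fst x, snd x)) \<in> measurable torus (borel \<Otimes>\<^sub>M borel)"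
    by (intro measurable_Pair measurable_circle[THEN measurable_compose[OF measurable_fst]]
        measurable_circle[THEN measurable_compose[OF measurable_snd]]) simp_all
  from measurable_compose[OF this f] show ?thesis by simp
qed

text \<open>A local share of the squared error. Assouad's argument needs the loss split into terms
  that each involve one sign only.\<close>

definition weighted_loss ::
    "(real \<times> real \<Rightarrow> real) \<Rightarrow> (real \<times> real \<Rightarrow> real) \<Rightarrow> (real \<Rightarrow> real \<Rightarrow> real) \<Rightarrow> ennreal" where
  "weighted_loss w C E = (\<integral>\<^sup>+z. ennreal (w z * (E (fst z) (snd z) - C z)\<^sup>2) \<partial>torus)"

lemma measurable_estimate_torus:
  assumes Ce: "Ce \<in> estimators n"
  shows "(\<lambda>(d, z). Ce d (fst z) (snd z)) \<in> borel_measurable (data_space n \<Otimes>\<^sub>M torus)"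
  using Ce by (simp add: estimators_def split_beta')

lemma measurable_weighted_loss:
  assumes Ce: "Ce \<in> estimators n"
    and w: "w \<in> borel_measurable (borel \<Otimes>\<^sub>M borel)" and C: "C \<in> borel_measurable (borel \<Otimes>\<^sub>M borel)"
  shows "(\<lambda>d. weighted_loss w C (Ce d)) \<in> borel_measurable (data_space n)"
  unfolding weighted_loss_def
proof (rule sigma_finite_measure.borel_measurable_nn_integral)
  show "sigma_finite_measure torus" by (intro prob_space_imp_sigma_finite prob_space_torus)
  note [measurable] = measurable_torus[OF w] measurable_torus[OF C] measurable_estimate_torus[OF Ce, unfolded split_beta']
  show "(\<lambda>(d, z). ennreal (w z * (Ce d (fst z) (snd z) - C z)\<^sup>2)) \<in> borel_measurable (data_space n \<Otimes>\<^sub>M torus)"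
    unfolding split_beta' by measurable
qed

lemma measurable_estimate:
  assumes Ce: "Ce \<in> estimators n" and d: "d \<in> space (data_space n)"
  shows "(\<lambda>z. Ce d (fst z) (snd z)) \<in> borel_measurable torus"
  using measurable_Pair2[OF measurable_estimate_torus[OF Ce] d] by simp

lemma half_square_diff_le: "(x - y)\<^sup>2 / 2 \<le> (e - x)\<^sup>2 + (e - (y::real))\<^sup>2"
proof -
  have "(e - x)\<^sup>2 + (e - y)\<^sup>2 = (x - y)\<^sup>2 / 2 + ((e - x) + (e - y))\<^sup>2 / 2"
    by (simp add: power2_eq_square field_simps)
  then show ?thesis by simp
qed

text \<open>No estimate can be close to both functions; \<open>half_square_diff_le\<close> holds
  pointwise and is integrated.\<close>

lemma weighted_loss_separation:
  assumes Ce: "Ce \<in> estimators n" and d: "d \<in> space (data_space n)"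
    and w: "w \<in> borel_measurable (borel \<Otimes>\<^sub>M borel)" and C: "C \<in> borel_measurable (borel \<Otimes>\<^sub>M borel)"
      "C' \<in> borel_measurable (borel \<Otimes>\<^sub>M borel)" and w0: "\<And>z. 0 \<le> w z"
  shows "(\<integral>\<^sup>+z. ennreal (w z * (C z - C' z)\<^sup>2 / 2) \<partial>torus) \<le> weighted_loss w C (Ce d) + weighted_loss w C' (Ce d)"
proof -
  note [measurable] = measurable_torus[OF w] measurable_torus[OF C(1)] measurable_torus[OF C(2)] measurable_estimate[OF Ce d]
  have "(\<integral>\<^sup>+z. ennreal (w z * (C z - C' z)\<^sup>2 / 2) \<partial>torus)
     \<le> (\<integral>\<^sup>+z. ennreal (w z * (Ce d (fst z) (snd z) - C z)\<^sup>2) + ennreal (w z * (Ce d (fst z) (snd z) - C' z)\<^sup>2) \<partial>torus)"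
  proof (rule nn_integral_mono)
    fix z
    let ?e = "Ce d (fst z) (snd z)"
    have "(C z - C' z)\<^sup>2 / 2 \<le> (?e - C z)\<^sup>2 + (?e - C' z)\<^sup>2" by (rule half_square_diff_le)
    from mult_left_mono[OF this w0[of z]]
    have "w z * (C z - C' z)\<^sup>2 / 2 \<le> w z * (?e - C z)\<^sup>2 + w z * (?e - C' z)\<^sup>2"
      by (simp add: distrib_left)
    then show "ennreal (w z * (C z - C' z)\<^sup>2 / 2) \<le> ennreal (w z * (?e - C z)\<^sup>2) + ennreal (w z * (?e - C' z)\<^sup>2)"
      using w0[of z] by (simp add: ennreal_plus[symmetric] ennreal_leI del: ennreal_plus)
  qed
  also have "\<dots> = weighted_loss w C (Ce d) + weighted_loss w C' (Ce d)"
    unfolding weighted_loss_def by (rule nn_integral_add) measurable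
  finally show ?thesis .
qed

text \<open>Agreement of \<open>C c\<close> with the covariance is asked only where
  \<open>w c\<close> is nonzero. So \<open>C c\<close> can be chosen to depend on one sign, although
  the covariance depends on all of them.\<close>

lemma risk_ge_weighted_loss:
  assumes Ce: "Ce \<in> estimators n" and fin: "finite I"
    and w: "\<And>c. c \<in> I \<Longrightarrow> w c \<in> borel_measurable (borel \<Otimes>\<^sub>M borel)" "\<And>c z. c \<in> I \<Longrightarrow> 0 \<le> w c z" "\<And>z. (\<Sum>c\<in>I. w c z) \<le> 1"
    and C: "\<And>c. c \<in> I \<Longrightarrow> C c \<in> borel_measurable (borel \<Otimes>\<^sub>M borel)"
    and eq: "\<And>c s t. c \<in> I \<Longrightarrow> w c (s, t) \<noteq> 0 \<Longrightarrow> C c (s, t) = cov_fun P s t"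
  shows "(\<Sum>c\<in>I. \<integral>\<^sup>+d. weighted_loss (w c) (C c) (Ce d) \<partial>data_law n P) \<le> risk n P Ce"
proof -
  have sp: "space (data_law n P) = space (data_space n)" and st: "sets (data_law n P) = sets (data_space n)"
    by (simp_all add: data_law_def)
  have "(\<Sum>c\<in>I. \<integral>\<^sup>+d. weighted_loss (w c) (C c) (Ce d) \<partial>data_law n P)
     = (\<integral>\<^sup>+d. (\<Sum>c\<in>I. weighted_loss (w c) (C c) (Ce d)) \<partial>data_law n P)"
  proof (rule nn_integral_sum[symmetric])
    fix c assume "c \<in> I"
    then show "(\<lambda>d. weighted_loss (w c) (C c) (Ce d)) \<in> borel_measurable (data_law n P)"
      using measurable_weighted_loss[OF Ce w(1) C] st by (simp cong: measurable_cong_sets)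
  qed
  also have "\<dots> \<le> risk n P Ce"
    unfolding risk_def
  proof (rule nn_integral_mono)
    fix d assume "d \<in> space (data_law n P)"
    then have d: "d \<in> space (data_space n)" unfolding sp .
    have "(\<Sum>c\<in>I. weighted_loss (w c) (C c) (Ce d)) = (\<integral>\<^sup>+z. (\<Sum>c\<in>I. ennreal (w c z * (Ce d (fst z) (snd z) - C c z)\<^sup>2)) \<partial>torus)"
      unfolding weighted_loss_def
    proof (rule nn_integral_sum[symmetric])
      fix c assume c: "c \<in> I"
      note [measurable] = measurable_torus[OF w(1)[OF c]] measurable_torus[OF C[OF c]] measurable_estimate[OF Ce d]
      show "(\<lambda>z. ennreal (w c z * (Ce d (fst z) (snd z) - C c z)\<^sup>2)) \<in> borel_measurable torus" by measurable
    qed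
    also have "\<dots> \<le> (\<integral>\<^sup>+(s, t). ennreal ((Ce d s t - cov_fun P s t)\<^sup>2) \<partial>torus)"
    proof (rule nn_integral_mono)
      fix z :: "real \<times> real"
      obtain s t where z: "z = (s, t)" by (cases z)
      have "(\<Sum>c\<in>I. ennreal (w c z * (Ce d (fst z) (snd z) - C c z)\<^sup>2)) = (\<Sum>c\<in>I. ennreal (w c z * (Ce d s t - cov_fun P s t)\<^sup>2))"
      proof (rule sum.cong[OF refl])
        fix c assume "c \<in> I"
        then show "ennreal (w c z * (Ce d (fst z) (snd z) - C c z)\<^sup>2) = ennreal (w c z * (Ce d s t - cov_fun P s t)\<^sup>2)"
          using eq[of c s t] by (cases "w c z = 0") (simp_all add: z)
      qed
      also have "\<dots> = ennreal ((\<Sum>c\<in>I. w c z) * (Ce d s t - cov_fun P s t)\<^sup>2)"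
        using w(2) by (simp add: sum_distrib_right)
      also have "\<dots> \<le> ennreal ((Ce d s t - cov_fun P s t)\<^sup>2)"
        using mult_right_mono[OF w(3)[of z], of "(Ce d s t - cov_fun P s t)\<^sup>2"] by (intro ennreal_leI) simp
      finally show "(\<Sum>c\<in>I. ennreal (w c z * (Ce d (fst z) (snd z) - C c z)\<^sup>2)) \<le> (case z of (s, t) \<Rightarrow> ennreal ((Ce d s t - cov_fun P s t)\<^sup>2))"
        by (simp add: z)
    qed
    finally show "(\<Sum>c\<in>I. weighted_loss (w c) (C c) (Ce d)) \<le> (\<integral>\<^sup>+(s, t). ennreal ((Ce d s t - cov_fun P s t)\<^sup>2) \<partial>torus)" .
  qed
  finally show ?thesis .
qed

section \<open>Bounds taken from the class\<close>

lemma prob_space_design_law: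
  assumes f: "admissible_design B \<Q> (design_density P)" and B: "bounds_positive B"
  shows "prob_space (design_law P)"
proof (rule prob_spaceI)
  \<comment> \<open>The integral is 1, whereas a non-integrable function would have integral 0 by
    convention.\<close>
  have int: "integrable circle (design_density P)"
    using f not_integrable_integral_eq[of circle "design_density P"] by (auto simp: admissible_design_def)
  have pos: "0 \<le> design_density P t" for t
    using f B by (auto simp: admissible_design_def bounds_positive_def intro: order_trans[OF less_imp_le])
  have m: "design_density P \<in> borel_measurable circle" using int by auto
  have "(\<integral>\<^sup>+t. ennreal (design_density P t) \<partial>circle) = ennreal 1"
    using f pos int by (subst nn_integral_eq_integral) (auto simp: admissible_design_def)
  then show "emeasure (design_law P) (space (design_law P)) = 1"
    unfolding design_law_def using m by (simp add: emeasure_density cong: nn_integral_cong)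
qed

lemma nn_integral_design_law_le:
  assumes f: "admissible_design B \<Q> (design_density P)" and b: "0 \<le> dens_hi B"
    and [measurable]: "g \<in> borel_measurable borel"
  shows "(\<integral>\<^sup>+t. g t \<partial>design_law P) \<le> ennreal (dens_hi B) * (\<integral>\<^sup>+t. g t \<partial>circle)"
proof -
  have m: "design_density P \<in> borel_measurable circle" "g \<in> borel_measurable circle"
    using f by (auto simp: admissible_design_def intro: measurable_circle)
  have "(\<integral>\<^sup>+t. g t \<partial>design_law P) = (\<integral>\<^sup>+t. ennreal (design_density P t) * g t \<partial>circle)"
    unfolding design_law_def using m by (subst nn_integral_density) auto
  also have "\<dots> \<le> (\<integral>\<^sup>+t. ennreal (dens_hi B) * g t \<partial>circle)"
    using f by (intro nn_integral_mono mult_right_mono ennreal_leI) (auto simp: admissible_design_def)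
  also have "\<dots> = ennreal (dens_hi B) * (\<integral>\<^sup>+t. g t \<partial>circle)"
    using m by (intro nn_integral_cmult)
  finally show ?thesis .
qed

lemma admissible_counts_pairs:
  assumes p: "admissible_counts B m p" and B: "bounds_positive B" and m: "0 \<le> m"
  shows "integrable (measure_pmf p) (\<lambda>k. real k * (real k - 1))"
    "0 \<le> measure_pmf.expectation p (\<lambda>k. real k * (real k - 1))"
    "measure_pmf.expectation p (\<lambda>k. real k * (real k - 1)) \<le> pair_hi B * (mean_hi B * m)\<^sup>2"
proof -
  have kk: "0 \<le> real k * (real k - 1)" "real k * (real k - 1) \<le> real k ^ 4" for k :: nat
  proof -
    show a: "0 \<le> real k * (real k - 1)" by (cases k) auto
    show "real k * (real k - 1) \<le> real k ^ 4"
    proof (cases "k = 0")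
      case False
      then have k1: "1 \<le> real k" by simp
      have "real k * (real k - 1) \<le> real k * real k" using k1 by (intro mult_left_mono) auto
      also have "\<dots> = real k ^ 2" by (simp add: power2_eq_square)
      also have "\<dots> \<le> real k ^ 4" using k1 by (intro power_increasing) auto
      finally show ?thesis .
    qed simp
  qed
  show "integrable (measure_pmf p) (\<lambda>k. real k * (real k - 1))"
  proof (rule Bochner_Integration.integrable_bound)
    show "integrable (measure_pmf p) (\<lambda>k. real k ^ 4)" using p by (simp add: admissible_counts_def Let_def)
    show "AE k in measure_pmf p. norm (real k * (real k - 1)) \<le> norm (real k ^ 4)"
      using kk by (intro AE_I2) (simp only: real_norm_def abs_of_nonneg power_abs abs_of_nat)
  qed simp
  show "0 \<le> measure_pmf.expectation p (\<lambda>k. real k * (real k - 1))"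
    by (intro Bochner_Integration.integral_nonneg kk)
  let ?\<mu> = "measure_pmf.expectation p real"
  have "0 \<le> ?\<mu>" by (intro Bochner_Integration.integral_nonneg) simp
  moreover have "?\<mu> \<le> mean_hi B * m" using p by (simp add: admissible_counts_def Let_def)
  ultimately have "?\<mu>\<^sup>2 \<le> (mean_hi B * m)\<^sup>2" by (intro power_mono)
  then have "pair_hi B * ?\<mu>\<^sup>2 \<le> pair_hi B * (mean_hi B * m)\<^sup>2"
    using B by (intro mult_left_mono) (auto simp: bounds_positive_def)
  then show "measure_pmf.expectation p (\<lambda>k. real k * (real k - 1)) \<le> pair_hi B * (mean_hi B * m)\<^sup>2"
    using p by (simp add: admissible_counts_def Let_def)
qed

text \<open>With \<delta>^2 = 1/n the separation is v^2 / (2 n). The two-point bound divides it by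
  8, and the two risks are each at most the supremum, which gives another factor 2.\<close>

lemma constant_curve_lower_bound:
  assumes P: "P \<in> model_class B \<Q> \<beta> R m q" and B: "bounds_positive B"
    and Ce: "Ce \<in> estimators n" and n: "1 \<le> n"
    and v: "0 < v" "2 * v \<le> R" "8 * v \<le> (subg B)\<^sup>2"
  shows "ennreal (v\<^sup>2 / (32 * real n)) \<le> (SUP P\<in>model_class B \<Q> \<beta> R m q. risk n P Ce)"
proof -
  define \<sigma> where "\<sigma> = subg B / 2"
  \<comment> \<open>Then n \<delta>^2 / 4 = 1/4 meets the budget 1/2, and \<delta> \<le> 1 keeps
    both variances below 2 v, for which the hypotheses on \<open>v\<close> are made.\<close>
  define \<delta> where "\<delta> = 1 / sqrt (real n)"
  define v' where "v' = v * (1 + \<delta>)"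
  define S where "S = (SUP P\<in>model_class B \<Q> \<beta> R m q. risk n P Ce)"
  have K: "0 < subg B" using B by (simp add: bounds_positive_def)
  then have s: "0 < \<sigma>" by (simp add: \<sigma>_def)
  have d: "0 \<le> \<delta>" "\<delta> \<le> 1" "\<delta>\<^sup>2 = 1 / real n" using n by (auto simp: \<delta>_def power_divide)
  have v': "0 < v'" "v' \<le> 2 * v" using v d mult_left_mono[OF d(2), of v] by (auto simp: v'_def algebra_simps add_pos_nonneg)
  have D: "prob_space (design_law P)"
    using P by (intro prob_space_design_law[OF _ B, of \<Q>]) (simp add: model_class_def)
  let ?\<psi> = "\<lambda>v (c::nat) (t::real). sqrt v"
  have cls: "rank_model P \<sigma> 1 (?\<psi> x) \<in> model_class B \<Q> \<beta> R m q" if x: "0 < x" "x \<le> 2 * v" for x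
    unfolding \<sigma>_def
  proof (rule rank_model_in_class[OF P K, where L="sqrt x"])
    have "hoelder_norm \<beta> (\<lambda>z::real\<times>real. x) \<le> ennreal R"
      by (rule order_trans[OF hoelder_norm_const_le]) (use x v in \<open>auto intro: ennreal_leI\<close>)
    then show "hoelder_norm \<beta> (\<lambda>(s, t). \<Sum>c<1::nat. sqrt x * sqrt x) \<le> ennreal R"
      using x by (simp add: split_beta')
  qed (use x v in auto)
  have cov: "cov_fun (rank_model P \<sigma> 1 (?\<psi> x)) s t = x" if "0 < x" for x s t
    using that by (simp add: cov_fun_rank_model)
  let ?l = "\<lambda>x d. weighted_loss (\<lambda>_. 1) (\<lambda>_. x) (Ce d)"
  have up: "(\<integral>\<^sup>+d. ?l x d \<partial>data_law n (rank_model P \<sigma> 1 (?\<psi> x))) \<le> S" if x: "0 < x" "x \<le> 2 * v" for x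
  proof -
    have "(\<Sum>c\<in>{0::nat}. \<integral>\<^sup>+d. ?l x d \<partial>data_law n (rank_model P \<sigma> 1 (?\<psi> x))) \<le> risk n (rank_model P \<sigma> 1 (?\<psi> x)) Ce"
      by (rule risk_ge_weighted_loss[OF Ce]) (use x in \<open>auto simp: cov[simplified]\<close>)
    also have "\<dots> \<le> S" unfolding S_def by (rule SUP_upper) (rule cls[OF x])
    finally show ?thesis by simp
  qed
  have sep: "ennreal (v\<^sup>2 * \<delta>\<^sup>2 / 2) \<le> ?l v e + ?l v' e" if e: "e \<in> space (data_space n)" for e
  proof -
    have "(v - v')\<^sup>2 = v\<^sup>2 * \<delta>\<^sup>2" by (simp add: v'_def power2_eq_square algebra_simps)
    then have "ennreal (v\<^sup>2 * \<delta>\<^sup>2 / 2) = (\<integral>\<^sup>+z. ennreal (1 * (v - v')\<^sup>2 / 2) \<partial>torus)"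
      using prob_space.emeasure_space_1[OF prob_space_torus] by simp
    also have "\<dots> \<le> ?l v e + ?l v' e"
      by (rule weighted_loss_separation[OF Ce e]) auto
    finally show ?thesis .
  qed
  have "ennreal (v\<^sup>2 * \<delta>\<^sup>2 / 2 / 8) \<le> (\<integral>\<^sup>+d. ?l v d \<partial>data_law n (rank_model P \<sigma> 1 (?\<psi> v))) + (\<integral>\<^sup>+d. ?l v' d \<partial>data_law n (rank_model P \<sigma> 1 (?\<psi> v')))"
  proof (rule data_law_two_point[OF D s, where \<epsilon>="\<delta>\<^sup>2 / 4"])
    show "ennreal (1 - \<delta>\<^sup>2 / 4) \<le> affinity P \<sigma> 1 (?\<psi> v) (?\<psi> v')"
      by (rule scale_affinity[OF D s d(1), of _ "sqrt v" _ "sqrt v'"]) (use v v' in \<open>auto simp: v'_def\<close>)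
    show "real n * (\<delta>\<^sup>2 / 4) \<le> 1 / 2" using n d by simp
    show "(\<lambda>d. ?l v d) \<in> borel_measurable (data_space n)" "(\<lambda>d. ?l v' d) \<in> borel_measurable (data_space n)"
      by (intro measurable_weighted_loss[OF Ce]; simp)+
    show "ennreal (v\<^sup>2 * \<delta>\<^sup>2 / 2) \<le> ?l v e + ?l v' e" if "e \<in> space (data_space n)" for e by (rule sep[OF that])
  qed (use n in \<open>auto simp: disjoint_family_fun_def\<close>)
  also have "\<dots> \<le> S + S" using v v' by (intro add_mono up) auto
  finally have "ennreal (v\<^sup>2 * \<delta>\<^sup>2 / 2 / 8) \<le> 2 * S" by (simp add: mult_2)
  moreover have "2 * ennreal (v\<^sup>2 / (32 * real n)) = ennreal (v\<^sup>2 * \<delta>\<^sup>2 / 2 / 8)"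
    by (simp add: d ennreal_mult[symmetric] flip: ennreal_numeral)
  ultimately have "2 * ennreal (v\<^sup>2 / (32 * real n)) \<le> 2 * S" by simp
  then show ?thesis unfolding S_def[symmetric]
    by (subst (asm) ennreal_mult_le_mult_iff) auto
qed

text \<open>The constant: local separation 2 (A / (16 M))^2, divided by 8 in the two-point bound and
  multiplied by M / 2 in Assouad's sum. The hypothesis \<open>info\<close> bounds n times the
  expectation of u v.\<close>

lemma wave_lower_bound:
  fixes M q n :: nat and \<beta> :: real
  assumes P: "P \<in> model_class B \<Q> \<beta> R m q" and B: "bounds_positive B"
    and Ce: "Ce \<in> estimators n" and n: "1 \<le> n" and M: "1 \<le> M" and q: "1 \<le> q" and m: "0 \<le> m"
    and \<beta>: "0 < \<beta>" "\<beta> \<le> 2"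
    and A: "0 \<le> A" "105 * (A * real (2 * q * M) powr \<beta>) \<le> R" "4 * A \<le> (subg B)\<^sup>2"
    and info: "real n * (pair_hi B * (mean_hi B * m)\<^sup>2 * (dens_hi B * (A / (2 * real M)) / (subg B / 2)\<^sup>2)\<^sup>2) \<le> 1 / 2"
  shows "ennreal (A\<^sup>2 / (2048 * real M)) \<le> (SUP P\<in>model_class B \<Q> \<beta> R m q. risk n P Ce)"
proof -
  define \<sigma> where "\<sigma> = subg B / 2"
  define L where "L = real (2 * q * M)"
  define S where "S = (SUP P\<in>model_class B \<Q> \<beta> R m q. risk n P Ce)"
  define \<alpha> where "\<alpha> = dens_hi B * (A / (2 * real M)) / \<sigma>\<^sup>2"
  have K: "0 < subg B" and b: "0 \<le> dens_hi B" using B by (simp_all add: bounds_positive_def)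
  then have s: "0 < \<sigma>" by (simp add: \<sigma>_def)
  have "1 * 1 \<le> q * M" using M q by (intro mult_mono) auto
  then have "1 \<le> 2 * q * M" by simp
  then have L1: "1 \<le> L" unfolding L_def by linarith
  have Pd: "admissible_design B \<Q> (design_density P)" and Pc: "admissible_counts B m (counts P)"
    using P by (simp_all add: model_class_def)
  have D: "prob_space (design_law P)" by (rule prob_space_design_law[OF Pd B])
  let ?\<psi> = "wave A L M"
  have cls: "rank_model P \<sigma> M (?\<psi> \<theta>) \<in> model_class B \<Q> \<beta> R m q" for \<theta>
    unfolding \<sigma>_def
  proof (rule rank_model_in_class[OF P K, where L="sqrt A"])
    show "wave A L M \<theta> c (t + 1) = wave A L M \<theta> c t" for c t
      by (rule wave_shift[OF M, where k="int q"]) (simp add: L_def)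
    have "wave A L M \<theta> c (t + 1 / real q) = wave A L M \<theta> c t" for c t
      by (rule wave_shift[OF M, where k=1]) (use q in \<open>simp add: L_def\<close>)
    then show "(\<Sum>c<M. wave A L M \<theta> c (s + 1 / real q) * wave A L M \<theta> c (t + 1 / real q)) = (\<Sum>c<M. wave A L M \<theta> c s * wave A L M \<theta> c t)" for s t
      by simp
    show "4 * (\<Sum>c<M. (wave A L M \<theta> c t)\<^sup>2) \<le> (subg B)\<^sup>2" for t
    proof -
      have "(\<Sum>c<M. (wave A L M \<theta> c t)\<^sup>2) \<le> A"
        using sum_wave_mult[OF M A(1), of L \<theta> t t] mult_left_mono[OF abs_le_D1[OF glued_bound[where \<tau>="cell_cov M \<theta>" and f=bump and g=bump and x="L * t" and y="L * t", OF cell_cov_abs bump_bounds(3) bump_bounds(3)]] A(1)]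
        by (simp add: power2_eq_square)
      then show ?thesis using A(3) by linarith
    qed
    have "hoelder_norm \<beta> (\<lambda>(s, t). A * glued (cell_cov M \<theta>) bump bump (L * s) (L * t)) \<le> ennreal (105 * (A * L powr \<beta>))"
      by (rule hoelder_norm_glued_bump[OF cell_cov_abs L1 A(1) \<beta>])
    also have "\<dots> \<le> ennreal R" using A(2) by (intro ennreal_leI) (simp add: L_def)
    finally show "hoelder_norm \<beta> (\<lambda>(s, t). \<Sum>c<M. wave A L M \<theta> c s * wave A L M \<theta> c t) \<le> ennreal R"
      unfolding sum_wave_mult[OF M A(1)] .
  qed (use wave_abs_le[OF A(1)] in auto)
  define e where "e c t = half_wave True 1 L M c t" for c t
  define o' where "o' c t = half_wave False 1 L M c t" for c t
  have [measurable]: "e c \<in> borel_measurable borel" "o' c \<in> borel_measurable borel" for c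
    unfolding e_def[abs_def] o'_def[abs_def] by measurable
  \<comment> \<open>The indicator of left half times right half within class \<open>c\<close>. There
    the covariance equals the sign of \<open>c\<close> times \<open>A\<close> times two bumps, which
    is what \<open>C\<close> records.\<close>
  define w where "w c z = (if cell M \<lfloor>L * fst z\<rfloor> = c \<and> even \<lfloor>L * fst z\<rfloor> \<and> cell M \<lfloor>L * snd z\<rfloor> = c \<and> odd \<lfloor>L * snd z\<rfloor> then 1 else 0 :: real)" for c z
  define C where "C \<epsilon> c z = \<epsilon> * A * (e c (fst z) * o' c (snd z))" for \<epsilon> :: real and c z
  have mw: "w c \<in> borel_measurable (borel \<Otimes>\<^sub>M borel)" for c
    unfolding w_def[abs_def] by measurable
  have mC: "C \<epsilon> c \<in> borel_measurable (borel \<Otimes>\<^sub>M borel)" for \<epsilon> c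
    unfolding C_def[abs_def] by measurable
  define sg where "sg \<theta> c = (if c \<in> \<theta> then 1 else -1 :: real)" for \<theta> and c :: nat
  let ?l = "\<lambda>\<epsilon> c d. weighted_loss (w c) (C \<epsilon> c) (Ce d)"
  define r where "r \<theta> c = (\<integral>\<^sup>+d. ?l (sg \<theta> c) c d \<partial>data_law n (rank_model P \<sigma> M (?\<psi> \<theta>)))" for \<theta> c
  have up: "(\<Sum>c<M. r \<theta> c) \<le> S" for \<theta>
  proof -
    have "(\<Sum>c<M. r \<theta> c) \<le> risk n (rank_model P \<sigma> M (?\<psi> \<theta>)) Ce"
      unfolding r_def
    proof (rule risk_ge_weighted_loss[OF Ce])
      show "(\<Sum>c<M. w c z) \<le> 1" for z
      proof -
        \<comment> \<open>The first coordinate determines the class, so at most one weight is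
          nonzero.\<close>
        have "(\<Sum>c<M. w c z) \<le> (\<Sum>c<M. if c = cell M \<lfloor>L * fst z\<rfloor> then 1 else 0)"
          by (intro sum_mono) (auto simp: w_def)
        also have "\<dots> \<le> 1" by simp
        finally show ?thesis .
      qed
      show "C (sg \<theta> c) c (s, t) = cov_fun (rank_model P \<sigma> M (?\<psi> \<theta>)) s t" if "w c (s, t) \<noteq> 0" for c s t
        using that A unfolding cov_fun_rank_model sum_wave_mult[OF M A(1)]
        by (auto simp: w_def C_def e_def o'_def half_wave_def glued_def cell_cov_def half_sign_def sg_def split: if_splits)
    qed (auto intro: mw mC simp: w_def)
    also have "\<dots> \<le> S" unfolding S_def by (rule SUP_upper) (rule cls)
    finally show ?thesis .
  qed
  let ?\<delta> = "2 * (A / (16 * real M))\<^sup>2"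
  have sep: "ennreal ?\<delta> \<le> ?l 1 c d + ?l (-1) c d" if c: "c < M" and d: "d \<in> space (data_space n)" for c d
  proof -
    \<comment> \<open>The two candidates differ by 2 A times unit bumps; the square over 2 gives the
      factor 2, and A^2 is distributed over the two half waves of height sqrt A.\<close>
    have eq: "w c z * (C 1 c z - C (-1) c z)\<^sup>2 / 2 = 2 * ((half_wave True A L M c (fst z))\<^sup>2 * (half_wave False A L M c (snd z))\<^sup>2)" for z
      using A(1) by (auto simp: w_def C_def e_def o'_def half_wave_def power_mult_distrib power2_eq_square)
    interpret sigma_finite_measure circle by (intro prob_space_imp_sigma_finite prob_space_circle)
    have "ennreal ?\<delta> = 2 * (ennreal (A / (16 * real M)) * ennreal (A / (16 * real M)))"
      using A by (simp add: ennreal_mult[symmetric] power2_eq_square flip: ennreal_numeral)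
    also have "\<dots> \<le> 2 * ((\<integral>\<^sup>+t. ennreal ((half_wave True A L M c t)\<^sup>2) \<partial>circle) * (\<integral>\<^sup>+t. ennreal ((half_wave False A L M c t)\<^sup>2) \<partial>circle))"
      unfolding L_def by (intro mult_left_mono mult_mono half_wave_mass_ge c q A) auto
    also have "\<dots> = (\<integral>\<^sup>+s. \<integral>\<^sup>+t. 2 * (ennreal ((half_wave True A L M c s)\<^sup>2) * ennreal ((half_wave False A L M c t)\<^sup>2)) \<partial>circle \<partial>circle)"
    proof -
      note [measurable] = measurable_circle[OF measurable_half_wave]
      show ?thesis by (simp add: nn_integral_cmult nn_integral_multc)
    qed
    also have "\<dots> = (\<integral>\<^sup>+z. ennreal (2 * ((half_wave True A L M c (fst z))\<^sup>2 * (half_wave False A L M c (snd z))\<^sup>2)) \<partial>torus)"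
    proof -
      have "(\<lambda>z. ennreal (2 * ((half_wave True A L M c (fst z))\<^sup>2 * (half_wave False A L M c (snd z))\<^sup>2))) \<in> borel_measurable torus"
        by (rule measurable_torus) measurable
      from nn_integral_fst[OF this] show ?thesis by (simp add: ennreal_mult)
    qed
    also have "\<dots> \<le> ?l 1 c d + ?l (-1) c d"
      unfolding eq[symmetric] by (rule weighted_loss_separation[OF Ce d mw mC mC]) (simp add: w_def)
    finally show ?thesis .
  qed
  have mass: "(\<integral>\<^sup>+t. ennreal ((half_wave b A L M c t / \<sigma>)\<^sup>2) \<partial>design_law P) \<le> ennreal \<alpha>" if c: "c < M" for b c
  proof -
    have "(\<integral>\<^sup>+t. ennreal ((half_wave b A L M c t / \<sigma>)\<^sup>2) \<partial>design_law P) \<le> ennreal (dens_hi B) * (\<integral>\<^sup>+t. ennreal ((half_wave b A L M c t / \<sigma>)\<^sup>2) \<partial>circle)"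
      by (rule nn_integral_design_law_le[OF Pd b]) measurable
    also have "(\<integral>\<^sup>+t. ennreal ((half_wave b A L M c t / \<sigma>)\<^sup>2) \<partial>circle) = ennreal (1 / \<sigma>\<^sup>2) * (\<integral>\<^sup>+t. ennreal ((half_wave b A L M c t)\<^sup>2) \<partial>circle)"
    proof -
      note [measurable] = measurable_circle[OF measurable_half_wave]
      show ?thesis by (subst nn_integral_cmult[symmetric]) (auto simp: ennreal_mult[symmetric] power_divide)
    qed
    also have "ennreal (dens_hi B) * (ennreal (1 / \<sigma>\<^sup>2) * (\<integral>\<^sup>+t. ennreal ((half_wave b A L M c t)\<^sup>2) \<partial>circle))
       \<le> ennreal (dens_hi B) * (ennreal (1 / \<sigma>\<^sup>2) * ennreal (A / (2 * real M)))"
      unfolding L_def by (intro mult_left_mono half_wave_mass_le c q A) auto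
    also have "\<dots> = ennreal \<alpha>"
      using b A by (simp add: ennreal_mult[symmetric] \<alpha>_def)
    finally show ?thesis .
  qed
  have pair: "ennreal (?\<delta> / 8) \<le> r (insert c \<theta>) c + r \<theta> c" if c: "c < M" "c \<notin> \<theta>" for c \<theta>
  proof -
    let ?E = "measure_pmf.expectation (counts P) (\<lambda>k. real k * (real k - 1))"
    note cnt = admissible_counts_pairs[OF Pc B m]
    have sgs: "sg (insert c \<theta>) c = 1" "sg \<theta> c = -1" using c by (simp_all add: sg_def)
    show ?thesis
      unfolding r_def sgs
    proof (rule data_law_two_point[OF D s, where \<epsilon>="?E * \<alpha>\<^sup>2"])
      show "ennreal (1 - ?E * \<alpha>\<^sup>2) \<le> affinity P \<sigma> M (?\<psi> (insert c \<theta>)) (?\<psi> \<theta>)"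
      proof (rule flip_affinity[OF D s c(1), where A="half_wave True A L M c" and B="half_wave False A L M c"])
        show "wave A L M (insert c \<theta>) c t = half_wave True A L M c t + half_wave False A L M c t" for t
          by (rule wave_split) simp
        show "wave A L M \<theta> c t = half_wave True A L M c t - half_wave False A L M c t" for t
          by (rule wave_split) (rule c)
        show "wave A L M \<theta> c' = wave A L M (insert c \<theta>) c'" if "c' \<noteq> c" for c'
          using wave_insert_other[OF that] by simp
        show "0 \<le> \<alpha>" using b A by (simp add: \<alpha>_def)
      qed (rule disjoint_wave half_wave_disjoint mass[OF c(1)] cnt measurable_wave measurable_half_wave)+
      show "0 \<le> ?E * \<alpha>\<^sup>2" using cnt(2) by simp
      have "?E * \<alpha>\<^sup>2 \<le> pair_hi B * (mean_hi B * m)\<^sup>2 * \<alpha>\<^sup>2"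
        using cnt(3) by (intro mult_right_mono) auto
      then have "real n * (?E * \<alpha>\<^sup>2) \<le> real n * (pair_hi B * (mean_hi B * m)\<^sup>2 * \<alpha>\<^sup>2)"
        by (intro mult_left_mono) auto
      also have "\<dots> \<le> 1 / 2" using info unfolding \<alpha>_def \<sigma>_def .
      finally show "real n * (?E * \<alpha>\<^sup>2) \<le> 1 / 2" .
      show "(\<lambda>d. ?l 1 c d) \<in> borel_measurable (data_space n)" "(\<lambda>d. ?l (-1) c d) \<in> borel_measurable (data_space n)"
        by (intro measurable_weighted_loss[OF Ce] mw mC)+
      show "ennreal ?\<delta> \<le> ?l 1 c d + ?l (-1) c d" if "d \<in> space (data_space n)" for d
        by (rule sep[OF c(1) that])
    qed (rule disjoint_wave n measurable_wave | simp)+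
  qed
  have "ennreal (real M * (?\<delta> / 8) / 2) \<le> S"
    by (rule assouad_sum[OF M _ pair up]) auto
  moreover have "real M * (?\<delta> / 8) / 2 = A\<^sup>2 / (2048 * real M)"
    using M by (simp add: power2_eq_square field_simps)
  ultimately show ?thesis unfolding S_def by simp
qed

section \<open>Choice of the number of cells and conclusion\<close>

lemma divisor_chain_ge_one:
  assumes "divisor_chain \<Q>" "q \<in> \<Q>"
  shows "1 \<le> q"
proof -
  obtain J r where r: "r 0 = 1" "\<forall>j<J. r j < r (Suc j) \<and> r j dvd r (Suc j)" "\<Q> = r ` {..J}"
    using assms(1) unfolding divisor_chain_def by blast
  have "1 \<le> r j" if "j \<le> J" for j
    using that
  proof (induction j)
    case (Suc j)
    then have "1 \<le> r j" "r j < r (Suc j)" using r(2) by auto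
    then show ?case by linarith
  qed (simp add: r(1))
  then show ?thesis using assms(2) r(3) by auto
qed

text \<open>Balancing X (q M)^(-2 \<beta>) with M^2 gives the real solution \<open>x\<close>, and M
  is \<open>x\<close> rounded up. Rounding costs the factor \<open>\<kappa>\<close> at most, because
  \<open>x\<close> is bounded below.\<close>

lemma number_of_cells:
  fixes X q D \<beta> :: real
  assumes X: "0 < X" and q: "1 \<le> q" and D: "1 \<le> D" and \<beta>: "0 < \<beta>"
    and le: "q \<le> D * X powr (1 / (2 * \<beta> + 1))"
  defines "\<kappa> \<equiv> 1 + 1 / D powr (- (2 * \<beta> + 1) / (2 * \<beta> + 2))"
  obtains M :: nat where "1 \<le> M" "X * (q * real M) powr (- 2 * \<beta>) / (real M)\<^sup>2 \<le> 1"
    "(X * q) powr (- ((2 * \<beta> + 1) / (2 * \<beta> + 2))) \<le> \<kappa> powr (2 * \<beta> + 1) * ((q * real M) powr (- 2 * \<beta>) / real M)"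
proof -
  define e where "e = 2 * \<beta> + 2"
  define Y where "Y = X * q powr (- 2 * \<beta>)"
  define x where "x = Y powr (1 / e)"
  define \<kappa>0 where "\<kappa>0 = D powr (- (2 * \<beta> + 1) / e)"
  have e: "0 < e" using \<beta> by (simp add: e_def)
  have Y: "0 < Y" using X q by (simp add: Y_def)
  then have x: "0 < x" by (simp add: x_def)
  have \<kappa>0: "0 < \<kappa>0" using D by (simp add: \<kappa>0_def)
  have \<kappa>: "\<kappa> = 1 + 1 / \<kappa>0" by (simp add: \<kappa>_def \<kappa>0_def e_def)
  have xe: "x powr e = Y" using Y e by (simp add: x_def powr_powr)
  \<comment> \<open>The bound on \<open>q\<close>, raised to the power 2 \<beta> + 1 and divided by
    q^(2 \<beta>), reads q \<le> D^(2 \<beta> + 1) Y; as q \<ge> 1, \<open>Y\<close> is bounded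
    below.\<close>
  have lo: "\<kappa>0 \<le> x"
  proof -
    have "q powr (2 * \<beta> + 1) \<le> (D * X powr (1 / (2 * \<beta> + 1))) powr (2 * \<beta> + 1)"
      using q le \<beta> by (intro powr_mono2) auto
    also have "\<dots> = D powr (2 * \<beta> + 1) * X"
      using X D \<beta> by (simp add: powr_mult powr_powr)
    finally have "q powr (2 * \<beta> + 1) * q powr (- 2 * \<beta>) \<le> D powr (2 * \<beta> + 1) * X * q powr (- 2 * \<beta>)"
      by (rule mult_right_mono) simp
    then have "q \<le> D powr (2 * \<beta> + 1) * Y"
      using q by (simp add: powr_add[symmetric] Y_def mult.assoc)
    then have "1 \<le> D powr (2 * \<beta> + 1) * Y" using q by linarith
    then have "D powr (- (2 * \<beta> + 1)) \<le> D powr (- (2 * \<beta> + 1)) * (D powr (2 * \<beta> + 1) * Y)"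
      using mult_left_mono[of 1 "D powr (2 * \<beta> + 1) * Y" "D powr (- (2 * \<beta> + 1))"] by simp
    also have "\<dots> = Y"
      using D by (simp add: mult.assoc[symmetric] powr_add[symmetric])
    finally have "(D powr (- (2 * \<beta> + 1))) powr (1 / e) \<le> Y powr (1 / e)"
      using e by (intro powr_mono2) auto
    then show ?thesis by (simp add: x_def \<kappa>0_def powr_powr)
  qed
  define M where "M = nat \<lceil>x\<rceil>"
  have M: "x \<le> real M" "real M \<le> x + 1" "1 \<le> M" using x by (auto simp: M_def) linarith+
  have M0: "0 < real M" using M by simp
  have "1 \<le> x / \<kappa>0" using lo \<kappa>0 by simp
  then have "real M \<le> \<kappa> * x" using M(2) by (simp add: \<kappa> algebra_simps)
  then have Mk: "real M powr (2 * \<beta> + 1) \<le> \<kappa> powr (2 * \<beta> + 1) * x powr (2 * \<beta> + 1)"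
    using M0 \<beta> powr_mono2[of "2 * \<beta> + 1" "real M" "\<kappa> * x"] x \<kappa>0 by (simp add: powr_mult \<kappa>)
  have qM: "(q * real M) powr (- 2 * \<beta>) = q powr (- 2 * \<beta>) * real M powr (- 2 * \<beta>)"
    using q by (simp add: powr_mult)
  show ?thesis
  proof (rule that[OF M(3)])
    have "x powr e \<le> real M powr e" using M(1) x e by (intro powr_mono2) auto
    then have "Y \<le> real M powr (2 * \<beta>) * (real M)\<^sup>2"
      unfolding xe using M0 by (simp add: e_def powr_add)
    then have "Y * real M powr (- 2 * \<beta>) \<le> real M powr (2 * \<beta>) * (real M)\<^sup>2 * real M powr (- 2 * \<beta>)"
      by (rule mult_right_mono) simp
    also have "\<dots> = (real M)\<^sup>2" using M0 by (simp add: mult_ac powr_add[symmetric])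
    finally show "X * (q * real M) powr (- 2 * \<beta>) / (real M)\<^sup>2 \<le> 1"
      unfolding qM using M0 by (simp add: Y_def mult.assoc)
  next
    define p where "p = (2 * \<beta> + 1) / e"
    have p: "0 < p" using \<beta> e by (simp add: p_def)
    have xp: "x powr (- (2 * \<beta> + 1)) = X powr (- p) * q powr (2 * \<beta> * p)"
    proof -
      have "x powr r = X powr (r / e) * q powr (- 2 * \<beta> * r / e)" for r
        using X q by (simp add: x_def Y_def powr_mult powr_powr)
      moreover have "- (2 * \<beta> + 1) / e = - p"
        unfolding p_def by (rule minus_divide_left[symmetric])
      moreover have "- 2 * \<beta> * (- (2 * \<beta> + 1)) / e = 2 * \<beta> * p"
        unfolding p_def times_divide_eq_right by (simp only: mult_minus_left mult_minus_right minus_minus)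
      ultimately show ?thesis by (simp only:)
    qed
    \<comment> \<open>The difference of the exponents is 1 / (2 \<beta> + 2): a power of
      \<open>q\<close> with this exponent is given away here.\<close>
    have ex: "- p \<le> 2 * \<beta> * p - 2 * \<beta>"
    proof -
      have "(2 * \<beta> + 1) * p - 2 * \<beta> = 1 / e"
        using e by (simp add: p_def e_def field_simps)
      moreover have "0 < 1 / e" using e by simp
      ultimately show ?thesis by (simp add: algebra_simps)
    qed
    have "(X * q) powr (- p) = X powr (- p) * q powr (- p)" using X q by (simp add: powr_mult)
    also have "\<dots> \<le> X powr (- p) * q powr (2 * \<beta> * p - 2 * \<beta>)"
      using q ex by (intro mult_left_mono powr_mono) auto
    also have "\<dots> = q powr (- 2 * \<beta>) * x powr (- (2 * \<beta> + 1))"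
      unfolding xp using q by (simp add: powr_diff powr_minus field_simps)
    also have "x powr (- (2 * \<beta> + 1)) \<le> \<kappa> powr (2 * \<beta> + 1) * real M powr (- (2 * \<beta> + 1))"
    proof -
      have "inverse y \<le> k * inverse z" if "z \<le> k * y" "0 < y" "0 < z" for k y z :: real
        using that by (simp add: field_simps)
      from this[OF Mk] show ?thesis unfolding powr_minus using x M0 by simp
    qed
    finally have "(X * q) powr (- p) \<le> q powr (- 2 * \<beta>) * (\<kappa> powr (2 * \<beta> + 1) * real M powr (- (2 * \<beta> + 1)))"
      by (simp add: mult_left_mono)
    also have "real M powr (- (2 * \<beta> + 1)) = real M powr (- 2 * \<beta>) / real M"
      using M0 powr_diff[of "real M" "- 2 * \<beta>" 1] by simp
    finally show "(X * q) powr (- ((2 * \<beta> + 1) / (2 * \<beta> + 2))) \<le> \<kappa> powr (2 * \<beta> + 1) * ((q * real M) powr (- 2 * \<beta>) / real M)"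
      unfolding qM p_def e_def by (simp add: mult_ac)
  qed
qed

theorem theorem6p2:
  fixes \<beta> R :: real and B :: model_bounds and K :: "real \<Rightarrow> real"
  assumes "0 < \<beta>" and "\<beta> \<le> 2" and "0 < R"
    and "bounds_positive B"
    and "smoothing_kernel K"
  shows "\<exists>c>0. \<forall>(n::nat) (m::real) \<Q> q.
           1 \<le> n \<longrightarrow> 2 \<le> m \<longrightarrow> divisor_chain \<Q> \<longrightarrow> q \<in> \<Q> \<longrightarrow>
           real q \<le> q_sharp K \<beta> n m \<longrightarrow>
           model_class B \<Q> \<beta> R m q \<noteq> {} \<longrightarrow>
           (INF Ce\<in>estimators n. SUP P\<in>model_class B \<Q> \<beta> R m q. risk n P Ce) \<ge>
             ennreal (c * ((real n * m\<^sup>2 * real q) powr (- ((2 * \<beta> + 1) / (2 * \<beta> + 2))) + 1 / real n))"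
proof -
  \<comment> \<open>The kernel enters through q_sharp only, by a factor free of n, m and q; the
    maximum with 1 gives the form that \<open>number_of_cells\<close> expects.\<close>
  define D where "D = max 1 (kernel_const K powr ((2 * \<beta> + 2) / (2 * \<beta> + 1)))"
  define \<kappa> where "\<kappa> = 1 + 1 / D powr (- (2 * \<beta> + 1) / (2 * \<beta> + 2))"
  define \<sigma> where "\<sigma> = subg B / 2"
  \<comment> \<open>The square root of the constants multiplying n m^2 (A / M)^2 / (4 \<sigma>^4) in
    the information bound.\<close>
  define G where "G = dens_hi B * mean_hi B * sqrt (pair_hi B)"
  \<comment> \<open>\<open>a\<close> will be A L^\<beta>. The three entries secure the Hoelder ball,
    the moment bound of the curve and the information budget.\<close>
  define a where "a = min (R / 105) (min ((subg B)\<^sup>2 / 4) (\<sigma>\<^sup>2 / G))"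
  define v where "v = min (R / 2) ((subg B)\<^sup>2 / 8)"
  \<comment> \<open>Here A^2 = a^2 2^(-2 \<beta>) (q M)^(-2 \<beta>) is inserted into the bound A^2
    / (2048 M) and compared with the rate at the cost of \<kappa>^(2 \<beta> + 1).\<close>
  define c1 where "c1 = a\<^sup>2 * 2 powr (- 2 * \<beta>) / (2048 * \<kappa> powr (2 * \<beta> + 1))"
  define c2 where "c2 = v\<^sup>2 / 32"
  have B: "0 < subg B" "0 < dens_hi B" "0 < mean_hi B" "0 < pair_hi B"
    using assms(4) by (simp_all add: bounds_positive_def)
  have G: "0 < G" and s: "0 < \<sigma>" using B by (simp_all add: G_def \<sigma>_def)
  have "0 < a" "0 < v" using assms(3) B G s by (simp_all add: a_def v_def)
  then have a: "0 < a" "a \<le> R / 105" "a \<le> (subg B)\<^sup>2 / 4" "a \<le> \<sigma>\<^sup>2 / G"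
    and v: "0 < v" "v \<le> R / 2" "v \<le> (subg B)\<^sup>2 / 8"
    unfolding a_def v_def by linarith+
  have D1: "1 \<le> D" by (simp add: D_def)
  then have "0 < D powr (- (2 * \<beta> + 1) / (2 * \<beta> + 2))" by simp
  then have "0 < \<kappa>" unfolding \<kappa>_def by (simp add: add_pos_pos)
  then have c: "0 < c1" "0 < c2" using a v by (simp_all add: c1_def c2_def)
  have "ennreal (min c1 c2 / 2 * ((real n * m\<^sup>2 * real q) powr (- ((2 * \<beta> + 1) / (2 * \<beta> + 2))) + 1 / real n))
      \<le> (SUP P\<in>model_class B \<Q> \<beta> R m q. risk n P Ce)"
    if n: "1 \<le> n" and m: "2 \<le> m" and chain: "divisor_chain \<Q>" "q \<in> \<Q>" and qs: "real q \<le> q_sharp K \<beta> n m"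
      and P: "P \<in> model_class B \<Q> \<beta> R m q" and Ce: "Ce \<in> estimators n" for n m \<Q> q P Ce
  proof -
    let ?T = "(real n * m\<^sup>2 * real q) powr (- ((2 * \<beta> + 1) / (2 * \<beta> + 2)))"
    let ?S = "SUP P\<in>model_class B \<Q> \<beta> R m q. risk n P Ce"
    have q: "1 \<le> q" by (rule divisor_chain_ge_one[OF chain])
    have X: "0 < real n * m\<^sup>2" using n m by simp
    have "q_sharp K \<beta> n m \<le> D * (real n * m\<^sup>2) powr (1 / (2 * \<beta> + 1))"
      unfolding q_sharp_def D_def by (intro mult_right_mono) auto
    then have qD: "real q \<le> D * (real n * m\<^sup>2) powr (1 / (2 * \<beta> + 1))" using qs by linarith
    have q1: "1 \<le> real q" using q by simp
    obtain M :: nat where M: "1 \<le> M" "real n * m\<^sup>2 * (real q * real M) powr (- 2 * \<beta>) / (real M)\<^sup>2 \<le> 1"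
      "?T \<le> \<kappa> powr (2 * \<beta> + 1) * ((real q * real M) powr (- 2 * \<beta>) / real M)"
      unfolding \<kappa>_def by (rule number_of_cells[OF X q1 D1 assms(1) qD])
    define L where "L = real (2 * q * M)"
    define A where "A = a / L powr \<beta>"
    have qM: "0 < real q * real M" using q M by simp
    have L: "L = 2 * (real q * real M)" by (simp add: L_def)
    have "1 * 1 \<le> real q * real M" using q M by (intro mult_mono) auto
    then have L1: "1 \<le> L" unfolding L by simp
    have Lb: "1 \<le> L powr \<beta>" using L1 assms(1) by (intro ge_one_powr_ge_zero) auto
    have "a * 1 \<le> a * L powr \<beta>" using a Lb by (intro mult_left_mono) auto
    then have A: "0 \<le> A" "A \<le> a" "A * L powr \<beta> = a"
      using a L1 Lb by (simp_all add: A_def pos_divide_le_eq)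
    have A2: "A\<^sup>2 = a\<^sup>2 * 2 powr (- 2 * \<beta>) * (real q * real M) powr (- 2 * \<beta>)"
    proof -
      have "(L powr \<beta>)\<^sup>2 = L powr (2 * \<beta>)" using L1 by (simp add: powr_power mult.commute)
      moreover have "L powr (- 2 * \<beta>) = 1 / L powr (2 * \<beta>)"
        using powr_minus_divide[of L "2 * \<beta>"] by simp
      ultimately have "A\<^sup>2 = a\<^sup>2 * L powr (- 2 * \<beta>)"
        unfolding A_def power_divide by (simp only:) simp
      also have "L powr (- 2 * \<beta>) = 2 powr (- 2 * \<beta>) * (real q * real M) powr (- 2 * \<beta>)"
        unfolding L using qM by (intro powr_mult) 
      finally show ?thesis by (simp add: mult.assoc)
    qed
    have two: "2 powr (- 2 * \<beta>) \<le> 1" using powr_mono[of "- 2 * \<beta>" 0 "2::real"] assms(1) by simp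
    \<comment> \<open>The choice of \<open>M\<close> bounds n m^2 (q M)^(-2 \<beta>) / M^2 by 1, so
      the information stays bounded uniformly in n, m and q.\<close>
    have small: "real n * m\<^sup>2 * A\<^sup>2 / (real M)\<^sup>2 \<le> a\<^sup>2"
    proof -
      have "real n * m\<^sup>2 * A\<^sup>2 / (real M)\<^sup>2 = a\<^sup>2 * 2 powr (- 2 * \<beta>) * (real n * m\<^sup>2 * (real q * real M) powr (- 2 * \<beta>) / (real M)\<^sup>2)"
        unfolding A2 by (simp add: mult_ac)
      also have "\<dots> \<le> a\<^sup>2 * 2 powr (- 2 * \<beta>) * 1" using M(2) by (intro mult_left_mono) auto
      also have "\<dots> \<le> a\<^sup>2 * 1" using two by (simp add: mult_left_le)
      finally show ?thesis by simp
    qed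
    have first: "ennreal (A\<^sup>2 / (2048 * real M)) \<le> ?S"
    proof (rule wave_lower_bound[OF P assms(4) Ce n M(1) q _ assms(1,2) A(1)])
      show "0 \<le> m" using m by simp
      show "105 * (A * real (2 * q * M) powr \<beta>) \<le> R" using A(3) a(2) unfolding L_def by simp
      show "4 * A \<le> (subg B)\<^sup>2" using A(2) a(3) by simp
      have "G * a \<le> \<sigma>\<^sup>2" using a(4) G by (simp add: field_simps)
      then have g: "(G * a)\<^sup>2 \<le> (\<sigma>\<^sup>2)\<^sup>2" using G a by (intro power_mono) auto
      have G2: "G\<^sup>2 = (dens_hi B)\<^sup>2 * (mean_hi B)\<^sup>2 * pair_hi B" using B by (simp add: G_def power_mult_distrib)
      have "real n * (pair_hi B * (mean_hi B * m)\<^sup>2 * (dens_hi B * (A / (2 * real M)) / \<sigma>\<^sup>2)\<^sup>2)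
         = G\<^sup>2 / (4 * (\<sigma>\<^sup>2)\<^sup>2) * (real n * m\<^sup>2 * A\<^sup>2 / (real M)\<^sup>2)"
        unfolding G2 by (simp add: power_mult_distrib power_divide mult_ac)
      also have "\<dots> \<le> G\<^sup>2 / (4 * (\<sigma>\<^sup>2)\<^sup>2) * a\<^sup>2" by (intro mult_left_mono small) auto
      also have "\<dots> = (G * a)\<^sup>2 / (\<sigma>\<^sup>2)\<^sup>2 / 4" by (simp add: power_mult_distrib)
      also have "\<dots> \<le> 1 / 4" using g s by (intro divide_right_mono) auto
      finally show "real n * (pair_hi B * (mean_hi B * m)\<^sup>2 * (dens_hi B * (A / (2 * real M)) / (subg B / 2)\<^sup>2)\<^sup>2) \<le> 1 / 2"
        unfolding \<sigma>_def by simp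
    qed
    have "c1 * ?T \<le> c1 * (\<kappa> powr (2 * \<beta> + 1) * ((real q * real M) powr (- 2 * \<beta>) / real M))"
      using M(3) c by (intro mult_left_mono) auto
    also have "\<dots> = A\<^sup>2 / (2048 * real M)"
      unfolding A2 c1_def using \<open>0 < \<kappa>\<close> by simp
    finally have le: "c1 * ?T \<le> A\<^sup>2 / (2048 * real M)" .
    have t1: "ennreal (c1 * ?T) \<le> ?S" by (rule order_trans[OF ennreal_leI[OF le] first])
    have "ennreal (v\<^sup>2 / (32 * real n)) \<le> ?S"
      by (rule constant_curve_lower_bound[OF P assms(4) Ce n]) (use v in auto)
    then have t2: "ennreal (c2 * (1 / real n)) \<le> ?S" by (simp add: c2_def)
    \<comment> \<open>The two terms come from different submodels, so only their maximum is
      available; it is at least half the sum.\<close>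
    have "min c1 c2 / 2 * (?T + 1 / real n) \<le> max (c1 * ?T) (c2 * (1 / real n))"
    proof -
      have "min c1 c2 * ?T \<le> c1 * ?T" "min c1 c2 * (1 / real n) \<le> c2 * (1 / real n)"
        by (intro mult_right_mono; simp)+
      then have "min c1 c2 * (?T + 1 / real n) \<le> 2 * max (c1 * ?T) (c2 * (1 / real n))"
        unfolding distrib_left by linarith
      then show ?thesis by simp
    qed
    then have "ennreal (min c1 c2 / 2 * (?T + 1 / real n)) \<le> ennreal (max (c1 * ?T) (c2 * (1 / real n)))"
      by (rule ennreal_leI)
    also have "\<dots> \<le> ?S" using t1 t2 by (auto simp: max_def)
    finally show ?thesis .
  qed
  \<comment> \<open>Non-emptiness of the class provides the \<open>P\<close> whose design and counts
    the submodels borrow.\<close>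
  then show ?thesis
    using c by (intro exI[of _ "min c1 c2 / 2"]) (auto simp: le_INF_iff)
qed

end
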